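(* Let $\nu>0$ and $\varepsilon>0$ be constants. Let $G$ be a graph on $n$ vertices with minimum degree $\delta(G)\ge k\ge \nu n$, and let $p=\frac{1+\varepsilon}{k}$. Then with high probability (as $k\to\infty$) \[ h(G_p)=\Omega\!\left(\sqrt{k}\right), \] i.e. there is a constant $c=c(\nu,\varepsilon)>0$ such that $\mathbb{P}\big(h(G_p)\ge c\sqrt{k}\big)\to 1$ as $k\to\infty$.
   Context: For a graph $G$ and $p\in[0,1]$, $G_p$ denotes the random subgraph of $G$ on the same vertex set obtained by retaining each edge of $G$ independently with probability $p$. $h(H)$ denotes the Hadwiger number of a graph $H$, i.e. the largest $t$ such that $H$ contains $K_t$ as a minor. All asymptotics are as $k\to\infty$. *)

theory Defs
  imports "HOL-Probability.Probability" "HOL-Library.Ramsey"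
begin

datatype 'a graph = Graph (verts: "'a set") (edges: "'a set set")

(* As usual, graphs have at least one vertex; this makes the minimum degree meaningful. *)
definition simple_graph :: "'a graph \<Rightarrow> bool" where
  "simple_graph G \<longleftrightarrow> finite (verts G) \<and> verts G \<noteq> {} \<and> edges G \<subseteq> nsets (verts G) 2"

definition degree :: "'a graph \<Rightarrow> 'a \<Rightarrow> nat" where
  "degree G v = card {e \<in> edges G. v \<in> e}"

definition min_degree :: "'a graph \<Rightarrow> nat" where
  "min_degree G = Min (degree G ` verts G)"

definition complete_graph :: "nat \<Rightarrow> nat graph" where
  "complete_graph t = Graph {..<t} (nsets {..<t} 2)"

definition induced_subgraph :: "'a graph \<Rightarrow> 'a set \<Rightarrow> 'a graph" where
  "induced_subgraph G W = Graph (verts G \<inter> W) {e \<in> edges G. e \<subseteq> W}"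

definition connected_graph :: "'a graph \<Rightarrow> bool" where
  "connected_graph G \<longleftrightarrow> verts G \<noteq> {} \<and>
     (\<forall>u\<in>verts G. \<forall>v\<in>verts G. (u, v) \<in> {(x, y). {x, y} \<in> edges G}\<^sup>*)"

(* B assigns to every vertex of H its branch set in G; contracting the branch sets and
   deleting what is superfluous turns G into H. *)
definition is_minor :: "'b graph \<Rightarrow> 'a graph \<Rightarrow> bool" where
  "is_minor H G \<longleftrightarrow> (\<exists>B :: 'b \<Rightarrow> 'a set.
     (\<forall>x\<in>verts H. B x \<subseteq> verts G \<and> connected_graph (induced_subgraph G (B x))) \<and>
     disjoint_family_on B (verts H) \<and>
     (\<forall>x\<in>verts H. \<forall>y\<in>verts H. {x, y} \<in> edges H \<longrightarrow>
        (\<exists>u\<in>B x. \<exists>v\<in>B y. {u, v} \<in> edges G)))"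

definition hadwiger_number :: "'a graph \<Rightarrow> nat" where
  "hadwiger_number G = Max {t. is_minor (complete_graph t) G}"

(* The maximum above is taken over a finite nonempty set. *)
lemma is_minor_complete_graph_0: "is_minor (complete_graph 0) G"
  by (simp add: is_minor_def complete_graph_def disjoint_family_on_def)

lemma is_minor_complete_graph_le:
  assumes "is_minor (complete_graph t) G" and fin: "finite (verts G)"
  shows "t \<le> card (verts G)"
proof -
  from assms(1) obtain B :: "nat \<Rightarrow> 'a set" where
    B: "\<And>x. x < t \<Longrightarrow> B x \<subseteq> verts G \<and> connected_graph (induced_subgraph G (B x))"
    and disj: "disjoint_family_on B {..<t}"
    unfolding is_minor_def complete_graph_def graph.sel lessThan_iff Ball_def by metis
  have "B x \<noteq> {}" if "x < t" for x
    using B[OF that] by (auto simp: connected_graph_def induced_subgraph_def)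
  then have "\<forall>x. x < t \<longrightarrow> (\<exists>v. v \<in> B x)" by blast
  then obtain f where f: "\<And>x. x < t \<Longrightarrow> f x \<in> B x" by metis
  have "inj_on f {..<t}"
  proof (rule inj_onI)
    fix x y assume "x \<in> {..<t}" "y \<in> {..<t}" "f x = f y"
    then show "x = y"
      using disjoint_family_onD[OF disj, of x y] f[of x] f[of y] by (cases "x = y") auto
  qed
  moreover have "f ` {..<t} \<subseteq> verts G"
    using B f by (meson image_subsetI lessThan_iff subsetD)
  ultimately have "card {..<t} \<le> card (verts G)"
    using fin by (rule card_inj_on_le)
  then show ?thesis by simp
qed

lemma finite_complete_minors:
  "finite (verts G) \<Longrightarrow> finite {t. is_minor (complete_graph t) G}"
  by (rule finite_subset[of _ "{..card (verts G)}"]) (auto dest: is_minor_complete_graph_le)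

definition random_subgraph :: "'a graph \<Rightarrow> real \<Rightarrow> 'a graph pmf" where
  "random_subgraph G p =
     map_pmf (\<lambda>X. Graph (verts G) {e \<in> edges G. X e})
       (Pi_pmf (edges G) False (\<lambda>_. bernoulli_pmf p))"

end

theory Submission imports Defs begin

text \<open>
  Expose \<open>G\<^sub>p\<close> in two rounds, with edge probabilities \<open>p1 \<ge> (1 + e) / k\<close> and \<open>p2 = e / k\<close>. Depth-first
  search in the first round yields a path on linearly many vertices, which is cut into \<open>M\<close> pieces
  of constant size \<open>s\<close>. A vertex off the path that has exactly two neighbours on the path in the
  second round links two pieces. Since \<open>G\<close> is dense, codegrees into the path are quadratic, so on a
  suitable set \<open>Q\<close> of linearly many pieces every balanced cut carries about \<open>s * card Q\<close> expected
  links; for large \<open>s\<close> this beats the \<open>4 ^ card Q\<close> choices of a cut, and the graph of linked pieces has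
  no sparse balanced cut. After deletion of the pieces of large degree, it has bounded degree.

  A graph of bounded degree on \<open>N\<close> vertices without sparse balanced cuts contains a complete minor of
  order proportional to \<open>sqrt N\<close>, by an argument in the spirit of Krivelevich and Nenadov. Branch sets of size
  proportional to \<open>sqrt N\<close> are added one at a time, while non-expanding parts are discarded. A new
  branch set must meet the neighbourhoods \<open>U\<close> of all earlier ones: a random walk of length about
  \<open>sqrt N\<close> misses the ball of radius \<open>r\<close> around \<open>U\<close> with probability decaying geometrically in \<open>r\<close>, so the
  expected distance from the walk to \<open>U\<close> is bounded and the walk can be joined to all the
  neighbourhoods by short paths of total length proportional to \<open>sqrt N\<close>. No logarithm is lost.
\<close>

section \<open>Expanders of bounded degree\<close>

text \<open>Direct edges between pieces are of no use: \<open>G\<close> may have hardly any, since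
  the minimum degree only guarantees a path vertex neighbours off the path. Common neighbours, in
  contrast, are forced by Cauchy-Schwarz, hence the links through a third vertex. For different
  linking vertices they depend on disjoint sets of edges, so the failure probabilities multiply.

  Passing to \<open>Q\<close> is unavoidable: \<open>G\<close> may be disconnected or consist of
  dense parts that barely touch, and then the graph of all pieces has balanced cuts without links.

  The union bound over cuts is affordable only for sets of linear size; single pieces may well be
  isolated. Hence the minor argument assumes something about balanced cuts alone and obtains
  expansion of smaller sets by discarding.

  Two pieces are linked with probability of order \<open>s ^ 2 / k\<close> on average, and
  \<open>card Q\<close> is of order \<open>k / s\<close>; this is the source of the count
  \<open>s * card Q\<close>. Constants are fixed in the order \<open>s\<close>, then
  \<open>\<Delta>\<close> (depending on \<open>s\<close>), then the constant of the minor (depending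
  on \<open>\<Delta>\<close>).\<close>

definition conn :: "('b \<Rightarrow> 'b \<Rightarrow> bool) \<Rightarrow> 'b set \<Rightarrow> bool" where
  "conn adj B \<longleftrightarrow> B \<noteq> {} \<and> (\<forall>u\<in>B. \<forall>v\<in>B. (u, v) \<in> {(x, y). x \<in> B \<and> y \<in> B \<and> adj x y}\<^sup>*)"

lemma conn_singleton: "conn adj {x}"
  by (auto simp: conn_def)

lemma conn_reach_mono:
  assumes "conn adj B" "u \<in> B" "v \<in> B" "B \<subseteq> C"
  shows "(u, v) \<in> {(x, y). x \<in> C \<and> y \<in> C \<and> adj x y}\<^sup>*"
proof -
  have "{(x, y). x \<in> B \<and> y \<in> B \<and> adj x y} \<subseteq> {(x, y). x \<in> C \<and> y \<in> C \<and> adj x y}"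
    using assms by auto
  then show ?thesis using assms rtrancl_mono unfolding conn_def by blast
qed

lemma conn_mono:
  assumes "conn adj B" "\<And>x y. adj x y \<Longrightarrow> adj' x y"
  shows "conn adj' B"
proof -
  have "{(x, y). x \<in> B \<and> y \<in> B \<and> adj x y}\<^sup>* \<subseteq> {(x, y). x \<in> B \<and> y \<in> B \<and> adj' x y}\<^sup>*"
    using assms(2) by (intro rtrancl_mono) auto
  then show ?thesis using assms(1) unfolding conn_def by blast
qed

lemma conn_Un:
  assumes A: "conn adj A" and B: "conn adj B" and "x \<in> A" "y \<in> B" "adj x y" "adj y x"
  shows "conn adj (A \<union> B)"
proof -
  let ?R = "{(x, y). x \<in> A \<union> B \<and> y \<in> A \<union> B \<and> adj x y}"
  have 1: "(u, v) \<in> ?R\<^sup>*" if "u \<in> A" "v \<in> A" for u v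
    by (rule conn_reach_mono[OF A that]) auto
  have 2: "(u, v) \<in> ?R\<^sup>*" if "u \<in> B" "v \<in> B" for u v
    by (rule conn_reach_mono[OF B that]) auto
  have "(x, y) \<in> ?R\<^sup>*" "(y, x) \<in> ?R\<^sup>*" using assms by auto
  then have 3: "(u, v) \<in> ?R\<^sup>*" "(v, u) \<in> ?R\<^sup>*" if "u \<in> A" "v \<in> B" for u v
    using that assms 1 2 by (meson rtrancl_trans)+
  show ?thesis using 1 2 3 A unfolding conn_def by blast
qed

lemma conn_insert:
  assumes "conn adj B" "x \<in> B" "adj x y" "adj y x"
  shows "conn adj (insert y B)"
  using conn_Un[OF assms(1) conn_singleton, of x y] assms by simp

lemma conn_nonempty: "conn adj B \<Longrightarrow> B \<noteq> {}"
  by (simp add: conn_def)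

text \<open>The set \<open>S\<close> need not lie in \<open>Y\<close>: besides subsets of
  \<open>Y\<close>, the proof considers the neighbours in \<open>Y\<close> of branch sets disjoint
  from \<open>Y\<close>.\<close>

definition nbhd :: "('b \<Rightarrow> 'b \<Rightarrow> bool) \<Rightarrow> 'b set \<Rightarrow> 'b set \<Rightarrow> 'b set" where
  "nbhd adj Y S = {y \<in> Y - S. \<exists>x\<in>S. adj x y}"

locale expander =
  fixes V :: "'b set" and adj :: "'b \<Rightarrow> 'b \<Rightarrow> bool" and \<beta> :: real and \<Delta> :: nat
  assumes fin: "finite V" and ne: "V \<noteq> {}"
    and sym: "adj x y \<Longrightarrow> adj y x"
    and beta: "\<beta> > 0" and Delta: "\<Delta> > 0"
    and deg: "x \<in> V \<Longrightarrow> card {y \<in> V. adj x y} \<le> \<Delta>"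
    and expand: "S \<subseteq> V \<Longrightarrow> S \<noteq> {} \<Longrightarrow> 2 * card S \<le> card V \<Longrightarrow> \<beta> * card S \<le> card (nbhd adj V S)"
begin

section \<open>Dirichlet form (every edge counted in both directions), Cheeger and Poincare
  inequalities\<close>

definition dirichlet :: "('b \<Rightarrow> real) \<Rightarrow> real" where
  "dirichlet g = (\<Sum>x\<in>V. \<Sum>y\<in>{y\<in>V. adj x y}. (g x - g y)\<^sup>2)"

lemma sum_adj_swap: "(\<Sum>x\<in>V. \<Sum>y\<in>{y\<in>V. adj x y}. f x y) = (\<Sum>x\<in>V. \<Sum>y\<in>{y\<in>V. adj x y}. f y x)"
  for f :: "'b \<Rightarrow> 'b \<Rightarrow> real"
proof -
  have "(\<Sum>x\<in>V. \<Sum>y\<in>{y\<in>V. adj x y}. f x y) = (\<Sum>y\<in>V. \<Sum>x\<in>{x\<in>V. adj x y}. f x y)"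
    by (rule sum.swap_restrict) (auto simp: fin)
  also have "\<dots> = (\<Sum>y\<in>V. \<Sum>x\<in>{x\<in>V. adj y x}. f x y)"
    using sym by (intro sum.cong refl) auto
  finally show ?thesis .
qed

lemma sum_boundary_ge:
  assumes "S \<subseteq> V" "S \<noteq> {}" "2 * card S \<le> card V"
  shows "\<beta> * card S \<le> (\<Sum>x\<in>V. \<Sum>y\<in>{y\<in>V. adj x y}. \<bar>indicator S x - indicator S y\<bar>)"
proof -
  have f: "finite (nbhd adj V S)" by (simp add: nbhd_def fin)
  have "real (card (nbhd adj V S)) = (\<Sum>x\<in>nbhd adj V S. 1)" by simp
  also have "\<dots> \<le> (\<Sum>x\<in>nbhd adj V S. \<Sum>y\<in>{y\<in>V. adj x y}. \<bar>indicator S x - indicator S y\<bar>)"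
  proof (rule sum_mono)
    fix x assume "x \<in> nbhd adj V S"
    then obtain y where y: "y \<in> S" "adj y x" "x \<notin> S" by (auto simp: nbhd_def)
    then have "(\<Sum>y\<in>{y}. \<bar>indicator S x - indicator S y\<bar>) \<le> (\<Sum>y\<in>{y\<in>V. adj x y}. \<bar>indicator S x - indicator S y :: real\<bar>)"
      using assms sym fin by (intro sum_mono2) auto
    then show "1 \<le> (\<Sum>y\<in>{y\<in>V. adj x y}. \<bar>indicator S x - indicator S y :: real\<bar>)" using y by simp
  qed
  also have "\<dots> \<le> (\<Sum>x\<in>V. \<Sum>y\<in>{y\<in>V. adj x y}. \<bar>indicator S x - indicator S y\<bar>)"
    by (rule sum_mono2) (auto simp: fin nbhd_def intro: sum_nonneg)
  finally show ?thesis using expand[OF assms] by linarith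
qed

text \<open>Induction on the size of the support \<open>S\<close>. Subtracting \<open>\<mu>\<close>
  times the indicator of \<open>S\<close>, with \<open>\<mu>\<close> the least positive value,
  shrinks the support. Expansion of \<open>S\<close> pays for the removed mass, and the variations
  of the two summands add up without cancellation, as \<open>eq\<close> records.\<close>

lemma coarea:
  assumes "\<And>x. x \<in> V \<Longrightarrow> F x \<ge> 0" "2 * card {x\<in>V. F x > 0} \<le> card V"
  shows "\<beta> * (\<Sum>x\<in>V. F x) \<le> (\<Sum>x\<in>V. \<Sum>y\<in>{y\<in>V. adj x y}. \<bar>F x - F y\<bar>)"
  using assms
proof (induction "card {x\<in>V. F x > 0}" arbitrary: F rule: less_induct)
  case less
  define S where "S = {x\<in>V. F x > 0}"
  show ?case
  proof (cases "S = {}")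
    case True
    then have "F x = 0" if "x \<in> V" for x using that less.prems(1)[OF that] unfolding S_def by force
    then have "(\<Sum>x\<in>V. F x) = 0" by simp
    then show ?thesis by (simp add: sum_nonneg)
  next
    case False
    have fS: "finite S" "S \<subseteq> V" using fin by (auto simp: S_def)
    define \<mu> where "\<mu> = Min (F ` S)"
    have mu: "\<mu> \<le> F x" if "x \<in> S" for x using that fS by (simp add: \<mu>_def)
    have "\<mu> \<in> F ` S" unfolding \<mu>_def using fS False by (intro Min_in) auto
    then obtain z where z: "z \<in> S" "F z = \<mu>" by auto
    then have mu0: "\<mu> > 0" by (auto simp: S_def)
    define F' where "F' = (\<lambda>x. F x - \<mu> * indicator S x)"
    have F'0: "F' x \<ge> 0" if "x \<in> V" for x
      using mu less.prems(1)[OF that] by (cases "x \<in> S") (auto simp: F'_def)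
    have out: "F x = 0" if "x \<in> V" "x \<notin> S" for x
      using that less.prems(1)[OF that(1)] by (auto simp: S_def)
    have "{x\<in>V. F' x > 0} \<subset> S"
    proof
      show "{x\<in>V. F' x > 0} \<subseteq> S"
      proof safe
        fix x assume x: "x \<in> V" "F' x > 0"
        then show "x \<in> S" using out[OF x(1)] by (cases "x \<in> S") (auto simp: F'_def)
      qed
      have "z \<notin> {x\<in>V. F' x > 0}" using z by (simp add: F'_def)
      then show "{x\<in>V. F' x > 0} \<noteq> S" using z by blast
    qed
    then have lt: "card {x\<in>V. F' x > 0} < card {x\<in>V. F x > 0}"
      using fS psubset_card_mono unfolding S_def by blast
    have IH: "\<beta> * (\<Sum>x\<in>V. F' x) \<le> (\<Sum>x\<in>V. \<Sum>y\<in>{y\<in>V. adj x y}. \<bar>F' x - F' y\<bar>)"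
      by (rule less.hyps[OF lt]) (use F'0 less.prems lt in auto)
    have bd: "\<beta> * card S \<le> (\<Sum>x\<in>V. \<Sum>y\<in>{y\<in>V. adj x y}. \<bar>indicator S x - indicator S y\<bar>)"
      using less.prems fS False by (intro sum_boundary_ge) (auto simp: S_def)
    have eq: "\<bar>F x - F y\<bar> = \<bar>F' x - F' y\<bar> + \<mu> * \<bar>indicator S x - indicator S y\<bar>" if "x \<in> V" "y \<in> V" for x y
      using out[OF that(1)] out[OF that(2)] mu[of x] mu[of y] mu0 by (cases "x \<in> S"; cases "y \<in> S") (auto simp: F'_def)
    have "(\<Sum>x\<in>V. F x) = (\<Sum>x\<in>V. F' x) + \<mu> * card S"
    proof -
      have "(\<Sum>x\<in>V. indicator S x) = real (card S)"
        using fS fin by (simp add: indicator_def sum.If_cases Int_absorb1)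
      then show ?thesis by (simp add: F'_def sum_subtractf flip: sum_distrib_left)
    qed
    then have "\<beta> * (\<Sum>x\<in>V. F x) = \<beta> * (\<Sum>x\<in>V. F' x) + \<mu> * (\<beta> * card S)" by (simp add: algebra_simps)
    also have "\<dots> \<le> (\<Sum>x\<in>V. \<Sum>y\<in>{y\<in>V. adj x y}. \<bar>F' x - F' y\<bar>)
        + \<mu> * (\<Sum>x\<in>V. \<Sum>y\<in>{y\<in>V. adj x y}. \<bar>indicator S x - indicator S y\<bar>)"
      using IH bd mu0 by (intro add_mono mult_left_mono) auto
    also have "\<dots> = (\<Sum>x\<in>V. \<Sum>y\<in>{y\<in>V. adj x y}. \<bar>F x - F y\<bar>)"
      using eq by (simp add: sum_distrib_left flip: sum.distrib)
    finally show ?thesis .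
  qed
qed

lemma sum_adj_le:
  assumes "\<And>x. x \<in> V \<Longrightarrow> f x \<ge> 0"
  shows "(\<Sum>x\<in>V. \<Sum>y\<in>{y\<in>V. adj x y}. f x) \<le> \<Delta> * (\<Sum>x\<in>V. f x :: real)"
proof -
  have "(\<Sum>x\<in>V. \<Sum>y\<in>{y\<in>V. adj x y}. f x) = (\<Sum>x\<in>V. card {y\<in>V. adj x y} * f x)" by simp
  also have "\<dots> \<le> (\<Sum>x\<in>V. \<Delta> * f x)"
    using deg assms by (intro sum_mono mult_right_mono) auto
  finally show ?thesis by (simp add: sum_distrib_left)
qed

text \<open>Apply \<open>coarea\<close> to the square of \<open>g\<close>, factor the differences of
  squares and use Cauchy-Schwarz; the factors \<open>g x + g y\<close> are controlled by the degree
  bound. The support condition allows expansion to be used at every level set.\<close>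

lemma cheeger:
  assumes g0: "\<And>x. x \<in> V \<Longrightarrow> g x \<ge> 0" and supp: "2 * card {x\<in>V. g x > 0} \<le> card V"
  shows "\<beta>\<^sup>2 * (\<Sum>x\<in>V. (g x)\<^sup>2) \<le> 4 * \<Delta> * dirichlet g"
proof -
  define s where "s = (\<Sum>x\<in>V. (g x)\<^sup>2)"
  have s0: "s \<ge> 0" by (auto simp: s_def intro: sum_nonneg)
  let ?P = "SIGMA x:V. {y\<in>V. adj x y}"
  have D0: "dirichlet g \<ge> 0" by (auto simp: dirichlet_def intro!: sum_nonneg)
  have "{x\<in>V. (g x)\<^sup>2 > 0} = {x\<in>V. g x > 0}" using g0 by force
  then have "\<beta> * s \<le> (\<Sum>x\<in>V. \<Sum>y\<in>{y\<in>V. adj x y}. \<bar>(g x)\<^sup>2 - (g y)\<^sup>2\<bar>)"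
    unfolding s_def using supp by (intro coarea) auto
  also have "\<dots> = (\<Sum>(x,y)\<in>?P. \<bar>(g x)\<^sup>2 - (g y)\<^sup>2\<bar>)"
    by (rule sum.Sigma) (auto simp: fin)
  also have "\<dots> = (\<Sum>p\<in>?P. \<bar>g (fst p) - g (snd p)\<bar> * \<bar>g (fst p) + g (snd p)\<bar>)"
    by (intro sum.cong refl) (auto simp: power2_eq_square square_diff_square_factored abs_mult)
  finally have 1: "\<beta> * s \<le> (\<Sum>p\<in>?P. \<bar>g (fst p) - g (snd p)\<bar> * \<bar>g (fst p) + g (snd p)\<bar>)" .
  have "(\<beta> * s)\<^sup>2 \<le> (\<Sum>p\<in>?P. \<bar>g (fst p) - g (snd p)\<bar> * \<bar>g (fst p) + g (snd p)\<bar>)\<^sup>2"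
    using 1 beta s0 by (intro power_mono) auto
  also have "\<dots> \<le> (\<Sum>p\<in>?P. \<bar>g (fst p) - g (snd p)\<bar>\<^sup>2) * (\<Sum>p\<in>?P. \<bar>g (fst p) + g (snd p)\<bar>\<^sup>2)"
    by (rule Cauchy_Schwarz_ineq_sum)
  also have "(\<Sum>p\<in>?P. \<bar>g (fst p) - g (snd p)\<bar>\<^sup>2) = dirichlet g"
    unfolding dirichlet_def by (subst sum.Sigma) (auto simp: fin case_prod_beta)
  also have "(\<Sum>p\<in>?P. \<bar>g (fst p) + g (snd p)\<bar>\<^sup>2) = (\<Sum>x\<in>V. \<Sum>y\<in>{y\<in>V. adj x y}. (g x + g y)\<^sup>2)"
    by (subst sum.Sigma) (auto simp: fin case_prod_beta)
  also have "dirichlet g * \<dots> \<le> dirichlet g * (4 * \<Delta> * s)"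
  proof (rule mult_left_mono[OF _ D0])
    have "(\<Sum>x\<in>V. \<Sum>y\<in>{y\<in>V. adj x y}. (g x + g y)\<^sup>2) \<le> (\<Sum>x\<in>V. \<Sum>y\<in>{y\<in>V. adj x y}. 2 * (g x)\<^sup>2 + 2 * (g y)\<^sup>2)"
    proof (intro sum_mono)
      fix x y show "(g x + g y)\<^sup>2 \<le> 2 * (g x)\<^sup>2 + 2 * (g y)\<^sup>2"
        using zero_le_power2[of "g x - g y"] by (simp add: power2_eq_square algebra_simps)
    qed
    also have "\<dots> = 2 * (\<Sum>x\<in>V. \<Sum>y\<in>{y\<in>V. adj x y}. 2 * (g x)\<^sup>2)"
      using sum_adj_swap[of "\<lambda>x y. 2 * (g y)\<^sup>2"] by (simp add: sum.distrib)
    also have "\<dots> \<le> 2 * (\<Delta> * (\<Sum>x\<in>V. 2 * (g x)\<^sup>2))"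
      using sum_adj_le[of "\<lambda>x. 2 * (g x)\<^sup>2"] by simp
    also have "\<dots> = 4 * \<Delta> * s" by (simp add: s_def sum_distrib_left algebra_simps)
    finally show "(\<Sum>x\<in>V. \<Sum>y\<in>{y\<in>V. adj x y}. (g x + g y)\<^sup>2) \<le> 4 * \<Delta> * s" .
  qed
  finally have *: "(\<beta>\<^sup>2 * s) * s \<le> (4 * \<Delta> * dirichlet g) * s" by (simp add: power2_eq_square algebra_simps)
  show ?thesis
  proof (cases "s = 0")
    case True then show ?thesis using D0 by (simp add: s_def)
  next
    case False
    then have "s > 0" using s0 by simp
    with * have "\<beta>\<^sup>2 * s \<le> 4 * \<Delta> * dirichlet g" by (rule mult_right_le_imp_le)
    then show ?thesis unfolding s_def .
  qed
qed

lemma dirichlet_le: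
  assumes "\<And>x y. x \<in> V \<Longrightarrow> y \<in> V \<Longrightarrow> \<bar>g x - g y\<bar> \<le> \<bar>h x - h y\<bar>"
  shows "dirichlet g \<le> dirichlet h"
  unfolding dirichlet_def using assms by (intro sum_mono) (auto simp: abs_le_square_iff)

lemma exists_median:
  assumes h0: "\<And>x. x \<in> V \<Longrightarrow> (h x :: real) \<ge> 0"
  obtains c where "c \<ge> 0" "2 * card {x\<in>V. h x > c} \<le> card V" "2 * card {x\<in>V. h x < c} \<le> card V"
proof -
  let ?C = "{z \<in> h ` V. 2 * card {x\<in>V. h x > z} \<le> card V}"
  have fC: "finite ?C" using fin by auto
  have "Max (h ` V) \<in> h ` V" using fin ne by (intro Max_in) auto
  moreover have e: "{x\<in>V. h x > Max (h ` V)} = {}" using fin by (auto simp: not_less)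
  have "2 * card {x\<in>V. h x > Max (h ` V)} \<le> card V" unfolding e by simp
  ultimately have "Max (h ` V) \<in> ?C" by blast
  then have neC: "?C \<noteq> {}" by blast
  \<comment> \<open>The least value with at most half of the vertices strictly above it; minimality
    bounds the number of vertices strictly below it.\<close>
  define c where "c = Min ?C"
  have c: "c \<in> ?C" unfolding c_def by (rule Min_in[OF fC neC])
  have "2 * card {x\<in>V. h x < c} \<le> card V"
  proof (cases "{x\<in>V. h x < c} = {}")
    case False
    let ?B = "h ` {x\<in>V. h x < c}"
    define d where "d = Max ?B"
    have fB: "finite ?B" using fin by auto
    have d: "d \<in> ?B" unfolding d_def using fB False by (intro Max_in) auto
    have dmax: "h x \<le> d" if "x \<in> V" "h x < c" for x
      unfolding d_def using that fB by (intro Max_ge) auto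
    have "d \<notin> ?C"
    proof
      assume "d \<in> ?C"
      then have "c \<le> d" unfolding c_def using fC by (rule Min_le[rotated])
      then show False using d by auto
    qed
    then have gt: "2 * card {x\<in>V. h x > d} > card V" using d by auto
    have disj: "card {x\<in>V. h x > d} + card {x\<in>V. h x < c} = card ({x\<in>V. h x > d} \<union> {x\<in>V. h x < c})"
      using dmax fin by (subst card_Un_disjoint) (auto simp: not_less[symmetric])
    have "\<dots> \<le> card V" by (rule card_mono) (auto simp: fin)
    then show ?thesis using gt disj by linarith
  next
    case True
    show ?thesis unfolding True by simp
  qed
  then show ?thesis using c h0 by (intro that[of c]) auto
qed

text \<open>Cut \<open>h\<close> at a median \<open>c\<close>. The parts above and below
  \<open>c\<close> are each supported on at most half of the vertices, so \<open>cheeger\<close>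
  applies to both. The part below equals \<open>c\<close> on \<open>U\<close>, which controls
  \<open>c\<close> itself and takes the place of the usual normalisation by the mean.\<close>

lemma poincare_vanishing:
  assumes h0: "\<And>x. x \<in> V \<Longrightarrow> h x \<ge> 0" and U: "U \<subseteq> V" and hU: "\<And>x. x \<in> U \<Longrightarrow> h x = 0"
  shows "\<beta>\<^sup>2 * card U * (\<Sum>x\<in>V. (h x)\<^sup>2) \<le> 16 * \<Delta> * card V * dirichlet h"
proof -
  obtain c where c: "c \<ge> 0" "2 * card {x\<in>V. h x > c} \<le> card V" "2 * card {x\<in>V. h x < c} \<le> card V"
    using exists_median[of h, OF h0] by metis
  define g where "g = (\<lambda>x. max 0 (h x - c))"
  define g' where "g' = (\<lambda>x. max 0 (c - h x))"
  have D: "dirichlet g \<le> dirichlet h" "dirichlet g' \<le> dirichlet h"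
    by (intro dirichlet_le; simp add: g_def g'_def max_def abs_minus_commute)+
  have D0: "dirichlet h \<ge> 0" by (auto simp: dirichlet_def intro!: sum_nonneg)
  have "\<beta>\<^sup>2 * (\<Sum>x\<in>V. (g x)\<^sup>2) \<le> 4 * \<Delta> * dirichlet g"
    using c by (intro cheeger) (auto simp: g_def less_max_iff_disj)
  then have 1: "\<beta>\<^sup>2 * (\<Sum>x\<in>V. (g x)\<^sup>2) \<le> 4 * \<Delta> * dirichlet h"
    using mult_left_mono[OF D(1), of "4 * real \<Delta>"] by simp
  have "\<beta>\<^sup>2 * (\<Sum>x\<in>V. (g' x)\<^sup>2) \<le> 4 * \<Delta> * dirichlet g'"
    using c by (intro cheeger) (auto simp: g'_def less_max_iff_disj)
  then have 2: "\<beta>\<^sup>2 * (\<Sum>x\<in>V. (g' x)\<^sup>2) \<le> 4 * \<Delta> * dirichlet h"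
    using mult_left_mono[OF D(2), of "4 * real \<Delta>"] by simp
  have fU: "finite U" using U fin finite_subset by blast
  have "card U * c\<^sup>2 = (\<Sum>x\<in>U. (g' x)\<^sup>2)" using hU c by (simp add: g'_def)
  also have "\<dots> \<le> (\<Sum>x\<in>V. (g' x)\<^sup>2)" using U fin by (intro sum_mono2) auto
  finally have 3: "\<beta>\<^sup>2 * (card U * c\<^sup>2) \<le> 4 * \<Delta> * dirichlet h"
    using 2 mult_left_mono[of _ _ "\<beta>\<^sup>2"] by (meson order_trans zero_le_power2)
  have "(\<Sum>x\<in>V. (h x)\<^sup>2) \<le> (\<Sum>x\<in>V. 2 * (g x)\<^sup>2 + 2 * c\<^sup>2)"
  proof (rule sum_mono)
    fix x assume x: "x \<in> V"
    have "(h x)\<^sup>2 \<le> (g x + c)\<^sup>2" using h0[OF x] c by (intro power_mono) (auto simp: g_def)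
    also have "\<dots> \<le> 2 * (g x)\<^sup>2 + 2 * c\<^sup>2"
      using zero_le_power2[of "g x - c"] by (simp add: power2_eq_square algebra_simps)
    finally show "(h x)\<^sup>2 \<le> 2 * (g x)\<^sup>2 + 2 * c\<^sup>2" .
  qed
  also have "\<dots> = 2 * (\<Sum>x\<in>V. (g x)\<^sup>2) + 2 * card V * c\<^sup>2"
    by (simp add: sum.distrib sum_distrib_left)
  finally have "\<beta>\<^sup>2 * card U * (\<Sum>x\<in>V. (h x)\<^sup>2) \<le> \<beta>\<^sup>2 * card U * (2 * (\<Sum>x\<in>V. (g x)\<^sup>2) + 2 * card V * c\<^sup>2)"
    by (intro mult_left_mono) auto
  also have "\<dots> = 2 * card U * (\<beta>\<^sup>2 * (\<Sum>x\<in>V. (g x)\<^sup>2)) + 2 * card V * (\<beta>\<^sup>2 * (card U * c\<^sup>2))"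
    by (simp add: algebra_simps)
  also have "\<dots> \<le> 2 * card V * (4 * \<Delta> * dirichlet h) + 2 * card V * (4 * \<Delta> * dirichlet h)"
    using card_mono[OF fin U] by (intro add_mono mult_mono[OF _ 1] mult_left_mono[OF 3])
      (auto intro!: sum_nonneg mult_nonneg_nonneg)
  finally show ?thesis by (simp add: algebra_simps)
qed

text \<open>The probability that \<open>k\<close> steps of the lazy walk from \<open>x\<close>, which moves along each incident edge
  with probability \<open>1 / \<Delta>\<close>, avoid \<open>U\<close>.\<close>
fun avoid :: "'b set \<Rightarrow> nat \<Rightarrow> 'b \<Rightarrow> real" where
  "avoid U 0 x = (if x \<in> U then 0 else 1)"
| "avoid U (Suc k) x = (if x \<in> U then 0 else
     ((\<Sum>y\<in>{y\<in>V. adj x y}. avoid U k y) + (real \<Delta> - real (card {y\<in>V. adj x y})) * avoid U k x) / real \<Delta>)"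

lemma avoid_nonneg: "x \<in> V \<Longrightarrow> avoid U k x \<ge> 0"
proof (induction k arbitrary: x)
  case (Suc k)
  have "(\<Sum>y\<in>{y\<in>V. adj x y}. avoid U k y) \<ge> 0" using Suc by (intro sum_nonneg) auto
  moreover have "(real \<Delta> - real (card {y\<in>V. adj x y})) * avoid U k x \<ge> 0"
    using Suc deg[of x] by auto
  ultimately show ?case by simp
qed simp

lemma avoid_Suc_le: "x \<in> V \<Longrightarrow> avoid U (Suc k) x \<le> avoid U k x"
proof (induction k arbitrary: x)
  case 0
  have "(\<Sum>y\<in>{y\<in>V. adj x y}. avoid U 0 y) \<le> (\<Sum>y\<in>{y\<in>V. adj x y}. 1)" by (intro sum_mono) auto
  then show ?case using Delta by (auto simp: field_simps)
next
  case (Suc k)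
  have "(\<Sum>y\<in>{y\<in>V. adj x y}. avoid U (Suc k) y) \<le> (\<Sum>y\<in>{y\<in>V. adj x y}. avoid U k y)"
    using Suc.IH by (intro sum_mono) blast
  moreover have "(real \<Delta> - real (card {y\<in>V. adj x y})) * avoid U (Suc k) x
      \<le> (real \<Delta> - real (card {y\<in>V. adj x y})) * avoid U k x"
    using Suc deg[of x] by (intro mult_left_mono) auto
  ultimately show ?case
    unfolding avoid.simps(2)[of U "Suc k"] avoid.simps(2)[of U k x]
    using Delta by (auto intro!: divide_right_mono simp del: avoid.simps)
qed

lemma avoid_mono: "x \<in> V \<Longrightarrow> k \<le> l \<Longrightarrow> avoid U l x \<le> avoid U k x"
  by (rule lift_Suc_antimono_le[of "\<lambda>k. avoid U k x"]) (auto intro: avoid_Suc_le simp del: avoid.simps)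

text \<open>The truncated expected hitting time \<open>h = (\<Sum>k<l. avoid U k)\<close> vanishes on \<open>U\<close>, and one lazy step
  lowers it by at most 1 elsewhere; so its Dirichlet form is at most \<open>2 * \<Delta> * sum h V\<close>, and the Poincare
  inequality turns this into a bound on \<open>sum h V\<close>.\<close>
lemma sum_avoid_le:
  assumes U: "U \<subseteq> V" "U \<noteq> {}" and l: "l > 0"
  shows "(\<Sum>x\<in>V. avoid U l x) \<le> 32 * \<Delta>\<^sup>2 * (card V)\<^sup>2 / (\<beta>\<^sup>2 * card U * l)"
proof -
  define h where "h = (\<lambda>x. \<Sum>k<l. avoid U k x)"
  have h0: "h x \<ge> 0" if "x \<in> V" for x using that by (auto simp: h_def intro!: sum_nonneg avoid_nonneg)
  have avoidU: "avoid U k x = 0" if "x \<in> U" for k x using that by (cases k) auto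
  have hU: "h x = 0" if "x \<in> U" for x using that by (simp add: h_def avoidU)
  have flow: "(\<Sum>y\<in>{y\<in>V. adj x y}. h x - h y) \<le> \<Delta>" if x: "x \<in> V" "x \<notin> U" for x
  proof -
    let ?d = "real (card {y\<in>V. adj x y})"
    have "\<Delta> * (\<Sum>k<l. avoid U (Suc k) x) = (\<Sum>k<l. (\<Sum>y\<in>{y\<in>V. adj x y}. avoid U k y) + (real \<Delta> - ?d) * avoid U k x)"
      using x Delta by (simp add: sum_distrib_left)
    also have "\<dots> = (\<Sum>y\<in>{y\<in>V. adj x y}. h y) + (real \<Delta> - ?d) * h x"
      unfolding h_def sum.distrib by (subst sum.swap) (simp add: sum_distrib_left)
    \<comment> \<open>Shifting the sum by one time step costs its first term, which is 1 off
      \<open>U\<close>; this is the drop of \<open>h\<close>.\<close>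
    also have "(\<Sum>k<l. avoid U (Suc k) x) = h x - 1 + avoid U l x"
    proof -
      have "(\<Sum>k<Suc l. avoid U k x) = avoid U 0 x + (\<Sum>k<l. avoid U (Suc k) x)"
        by (rule sum.lessThan_Suc_shift)
      then show ?thesis using x by (simp add: h_def)
    qed
    finally have "?d * h x - (\<Sum>y\<in>{y\<in>V. adj x y}. h y) = \<Delta> - \<Delta> * avoid U l x" by (simp add: algebra_simps)
    then show ?thesis using avoid_nonneg[OF x(1), of U l] by (simp add: sum_subtractf)
  qed
  \<comment> \<open>Summation by parts: by symmetry of \<open>adj\<close> the two halves of the
    square have equal sums, so only the Laplacian of \<open>h\<close>, bounded by
    \<open>flow\<close>, enters.\<close>
  have "dirichlet h = (\<Sum>x\<in>V. \<Sum>y\<in>{y\<in>V. adj x y}. h x * (h x - h y)) + (\<Sum>x\<in>V. \<Sum>y\<in>{y\<in>V. adj x y}. h y * (h y - h x))"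
    unfolding dirichlet_def by (simp flip: sum.distrib add: power2_eq_square algebra_simps)
  also have "\<dots> = 2 * (\<Sum>x\<in>V. h x * (\<Sum>y\<in>{y\<in>V. adj x y}. h x - h y))"
    using sum_adj_swap[of "\<lambda>x y. h y * (h y - h x)"] by (simp add: sum_distrib_left)
  also have "\<dots> \<le> 2 * (\<Sum>x\<in>V. h x * \<Delta>)"
  proof -
    have "h x * (\<Sum>y\<in>{y\<in>V. adj x y}. h x - h y) \<le> h x * \<Delta>" if "x \<in> V" for x
      using flow[OF that] h0[OF that] hU[of x] by (cases "x \<in> U") (auto intro: mult_left_mono)
    then show ?thesis by (simp add: sum_mono)
  qed
  also have "\<dots> = 2 * \<Delta> * (\<Sum>x\<in>V. h x)" by (simp add: sum_distrib_right[symmetric])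
  finally have D: "dirichlet h \<le> 2 * \<Delta> * (\<Sum>x\<in>V. h x)" .
  define H where "H = (\<Sum>x\<in>V. h x)"
  have H0: "H \<ge> 0" by (auto simp: H_def intro!: sum_nonneg h0)
  have "H\<^sup>2 = (\<Sum>x\<in>V. 1 * h x)\<^sup>2" by (simp add: H_def)
  also have "\<dots> \<le> (\<Sum>x\<in>V. 1\<^sup>2) * (\<Sum>x\<in>V. (h x)\<^sup>2)" by (rule Cauchy_Schwarz_ineq_sum)
  finally have cs: "H\<^sup>2 \<le> card V * (\<Sum>x\<in>V. (h x)\<^sup>2)" by simp
  have "\<beta>\<^sup>2 * card U * H\<^sup>2 \<le> \<beta>\<^sup>2 * card U * (card V * (\<Sum>x\<in>V. (h x)\<^sup>2))"
    by (rule mult_left_mono[OF cs]) auto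
  also have "\<dots> = card V * (\<beta>\<^sup>2 * card U * (\<Sum>x\<in>V. (h x)\<^sup>2))" by simp
  also have "\<dots> \<le> card V * (16 * \<Delta> * card V * (2 * \<Delta> * H))"
  proof (rule mult_left_mono)
    have "\<beta>\<^sup>2 * card U * (\<Sum>x\<in>V. (h x)\<^sup>2) \<le> 16 * \<Delta> * card V * dirichlet h"
      by (rule poincare_vanishing[OF h0 U(1) hU])
    also have "\<dots> \<le> 16 * \<Delta> * card V * (2 * \<Delta> * H)"
      using D by (intro mult_left_mono) (auto simp: H_def)
    finally show "\<beta>\<^sup>2 * card U * (\<Sum>x\<in>V. (h x)\<^sup>2) \<le> 16 * \<Delta> * card V * (2 * \<Delta> * H)" .
  qed simp
  finally have *: "(\<beta>\<^sup>2 * card U * H) * H \<le> (32 * \<Delta>\<^sup>2 * (card V)\<^sup>2) * H"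
    by (simp add: power2_eq_square algebra_simps)
  have HH: "\<beta>\<^sup>2 * card U * H \<le> 32 * \<Delta>\<^sup>2 * (card V)\<^sup>2"
  proof (cases "H = 0")
    case False
    then have "H > 0" using H0 by simp
    with * show ?thesis by (rule mult_right_le_imp_le)
  qed simp
  \<comment> \<open>As \<open>avoid U k x\<close> decreases in \<open>k\<close>, its value at time
    \<open>l\<close> is at most the average over the times before; this gains the factor
    \<open>1 / l\<close>.\<close>
  have "l * (\<Sum>x\<in>V. avoid U l x) = (\<Sum>x\<in>V. \<Sum>k<l. avoid U l x)" by (simp add: sum_distrib_left)
  also have "\<dots> \<le> H" unfolding H_def h_def
    by (intro sum_mono) (auto intro: avoid_mono)
  finally have a: "l * (\<Sum>x\<in>V. avoid U l x) \<le> H" .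
  have cU: "card U > 0" using U fin finite_subset card_gt_0_iff by blast
  have "(\<Sum>x\<in>V. avoid U l x) * (\<beta>\<^sup>2 * card U * l) = \<beta>\<^sup>2 * card U * (l * (\<Sum>x\<in>V. avoid U l x))" by simp
  also have "\<dots> \<le> \<beta>\<^sup>2 * card U * H" by (rule mult_left_mono[OF a]) auto
  also note HH
  finally show ?thesis using cU l beta by (simp add: pos_le_divide_eq)
qed

end

text \<open>The first factor is the constant of \<open>sum_avoid_le\<close>. In the second,
  \<open>(1 + \<beta>) / \<beta>\<close> is the geometric series with ratio
  \<open>1 / (1 + \<beta>)\<close> over the growing balls, and 2 pays for the ball with more than
  half of the vertices. Together they bound the average missed weight per target set.\<close>

definition hit_const :: "real \<Rightarrow> nat \<Rightarrow> real" where
  "hit_const \<beta> \<Delta> = 32 * (real \<Delta>)\<^sup>2 / \<beta>\<^sup>2 * ((1 + \<beta>) / \<beta> + 2)"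

context expander begin

text \<open>The method of conditional expectations: the next step is chosen so that the expected missed
  weight does not increase.\<close>
lemma exists_walk:
  assumes "x \<in> V" "finite J" "\<And>j. j \<in> J \<Longrightarrow> \<omega> j \<ge> 0"
  shows "\<exists>W\<subseteq>V. x \<in> W \<and> conn adj W \<and> card W \<le> Suc l \<and>
     (\<Sum>j\<in>{j\<in>J. U j \<inter> W = {}}. \<omega> j) \<le> (\<Sum>j\<in>J. \<omega> j * avoid (U j) l x)"
  using assms
proof (induction l arbitrary: x J)
  case 0
  have "(\<Sum>j\<in>{j\<in>J. U j \<inter> {x} = {}}. \<omega> j) = (\<Sum>j\<in>J. if U j \<inter> {x} = {} then \<omega> j else 0)"
    by (rule sum.inter_filter[OF 0(2)])
  also have "\<dots> = (\<Sum>j\<in>J. \<omega> j * avoid (U j) 0 x)"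
    by (intro sum.cong refl) auto
  finally show ?case using 0 by (intro exI[of _ "{x}"]) (auto simp: conn_singleton)
next
  case (Suc l)
  define J' where "J' = {j\<in>J. x \<notin> U j}"
  define A where "A = (\<lambda>y. \<Sum>j\<in>J'. \<omega> j * avoid (U j) l y)"
  define N where "N = {y\<in>V. adj x y}"
  have J': "finite J'" "\<And>j. j \<in> J' \<Longrightarrow> \<omega> j \<ge> 0" using Suc.prems by (auto simp: J'_def)
  have dN: "real (card N) \<le> \<Delta>" using deg[OF Suc.prems(1)] by (simp add: N_def)
  have "(\<Sum>j\<in>J. \<omega> j * avoid (U j) (Suc l) x) = (\<Sum>j\<in>J'. \<omega> j * avoid (U j) (Suc l) x)"
    unfolding J'_def using Suc.prems(2) by (intro sum.mono_neutral_right) auto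
  also have "\<dots> = (\<Sum>j\<in>J'. (\<Sum>y\<in>N. \<omega> j * avoid (U j) l y) + (real \<Delta> - real (card N)) * (\<omega> j * avoid (U j) l x)) / \<Delta>"
    unfolding sum_divide_distrib
    by (intro sum.cong refl) (auto simp: J'_def N_def sum_distrib_left algebra_simps)
  also have "\<dots> = ((\<Sum>y\<in>N. A y) + (real \<Delta> - real (card N)) * A x) / \<Delta>"
    unfolding sum.distrib A_def by (subst sum.swap) (simp add: sum_distrib_left)
  finally have avg: "\<Delta> * (\<Sum>j\<in>J. \<omega> j * avoid (U j) (Suc l) x) = (\<Sum>y\<in>N. A y) + (real \<Delta> - real (card N)) * A x"
    using Delta by simp
  define m where "m = (\<Sum>j\<in>J. \<omega> j * avoid (U j) (Suc l) x)"
  have "\<exists>z\<in>insert x N. A z \<le> m"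
  proof (rule ccontr)
    assume "\<not> ?thesis"
    then have gt: "A z > m" if "z \<in> insert x N" for z using that by auto
    have "(\<Sum>y\<in>N. m) \<le> (\<Sum>y\<in>N. A y)" by (rule sum_mono) (auto intro: less_imp_le gt)
    moreover have "(\<Delta> - real (card N)) * m \<le> (\<Delta> - real (card N)) * A x"
      using dN gt[of x] by (intro mult_left_mono) auto
    \<comment> \<open>Moves and holding at \<open>x\<close> have total weight
      \<open>\<Delta> > 0\<close>: if \<open>N\<close> is empty, all weight is on holding, and
      otherwise the sum over \<open>N\<close> is strictly larger.\<close>
    moreover have "(\<Sum>y\<in>N. m) < (\<Sum>y\<in>N. A y) \<or> (\<Delta> - real (card N)) * m < (\<Delta> - real (card N)) * A x"
    proof (cases "N = {}")
      case True
      then show ?thesis using Delta gt[of x] by auto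
    next
      case False
      have "finite N" using fin by (simp add: N_def)
      then show ?thesis using False gt by (intro disjI1 sum_strict_mono) auto
    qed
    ultimately have "\<Delta> * m < (\<Sum>y\<in>N. A y) + (real \<Delta> - real (card N)) * A x"
      by (simp add: algebra_simps) linarith
    then show False using avg by (simp add: m_def)
  qed
  then obtain z where z: "z \<in> insert x N" "A z \<le> m" by blast
  have zV: "z \<in> V" using z Suc.prems by (auto simp: N_def)
  from Suc.IH[OF zV J'] obtain W where W: "W \<subseteq> V" "z \<in> W" "conn adj W" "card W \<le> Suc l"
    "(\<Sum>j\<in>{j\<in>J'. U j \<inter> W = {}}. \<omega> j) \<le> A z" unfolding A_def by blast
  have "conn adj (insert x W)"
  proof (cases "z = x")
    case True then show ?thesis using W by (simp add: insert_absorb)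
  next
    case False
    then have "adj x z" using z by (auto simp: N_def)
    then show ?thesis using W sym by (intro conn_insert[of _ _ z]) auto
  qed
  moreover have "card (insert x W) \<le> Suc (Suc l)"
    using W fin by (metis le_SucI Suc_le_mono card_insert_if finite_subset)
  moreover have "{j\<in>J. U j \<inter> insert x W = {}} = {j\<in>J'. U j \<inter> W = {}}" by (auto simp: J'_def)
  ultimately show ?case using W z Suc.prems(1) unfolding m_def by (intro exI[of _ "insert x W"]) auto
qed

section \<open>Balls, and small connected sets meeting many given sets\<close>

fun ball :: "'b set \<Rightarrow> nat \<Rightarrow> 'b set" where
  "ball U 0 = U"
| "ball U (Suc r) = ball U r \<union> nbhd adj V (ball U r)"

lemma ball_subset: "U \<subseteq> V \<Longrightarrow> ball U r \<subseteq> V"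
  by (induction r) (auto simp: nbhd_def)

lemma subset_ball: "U \<subseteq> ball U r"
  by (induction r) auto

lemma ball_growth:
  assumes U: "U \<subseteq> V" "U \<noteq> {}" and small: "\<And>r. r < R \<Longrightarrow> 2 * card (ball U r) \<le> card V"
  shows "r \<le> R \<Longrightarrow> (1 + \<beta>) ^ r * card U \<le> card (ball U r)"
proof (induction r)
  case (Suc r)
  have "card (ball U (Suc r)) = card (ball U r) + card (nbhd adj V (ball U r))"
    using ball_subset[OF U(1), of r] fin
    by (auto simp: nbhd_def intro!: card_Un_disjoint intro: finite_subset)
  moreover have "\<beta> * card (ball U r) \<le> card (nbhd adj V (ball U r))"
    using ball_subset[OF U(1)] subset_ball[of U r] U(2) Suc.prems by (intro expand small) auto
  ultimately have "(1 + \<beta>) * card (ball U r) \<le> card (ball U (Suc r))" by (simp add: algebra_simps)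
  moreover have "(1 + \<beta>) * ((1 + \<beta>) ^ r * card U) \<le> (1 + \<beta>) * card (ball U r)"
    using Suc beta by (intro mult_left_mono) auto
  ultimately show ?case by (simp add: algebra_simps)
qed simp

lemma ball_exceeds_half:
  assumes U: "U \<subseteq> V" "U \<noteq> {}"
  shows "\<exists>r. card V < 2 * card (ball U r)"
proof (rule ccontr)
  assume "\<not> ?thesis"
  then have small: "2 * card (ball U r) \<le> card V" for r by (auto simp: not_less)
  have cU: "real (card U) \<ge> 1"
    using U fin finite_subset by (metis One_nat_def Suc_leI card_gt_0_iff of_nat_1 of_nat_mono)
  obtain r where r: "(1 + \<beta>) ^ r > card V" using beta real_arch_pow[of "1 + \<beta>"] by auto
  have "(1 + \<beta>) ^ r * 1 \<le> (1 + \<beta>) ^ r * card U" using cU beta by (intro mult_left_mono) auto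
  also have "\<dots> \<le> card (ball U r)" using ball_growth[OF U, of r r] small by simp
  finally show False using r small[of r] by linarith
qed

text \<open>Induction on the radius: a vertex of \<open>W\<close> in the outer layer has a neighbour
  one layer closer to \<open>U\<close>, so reaching \<open>U\<close> from distance \<open>d\<close>
  costs at most \<open>d\<close> new vertices.\<close>

lemma attach:
  assumes U: "U \<subseteq> V" and "conn adj W" "W \<subseteq> V" "W \<inter> ball U d \<noteq> {}"
  shows "\<exists>B. W \<subseteq> B \<and> B \<subseteq> V \<and> conn adj B \<and> card B \<le> card W + d \<and> B \<inter> U \<noteq> {}"
  using assms(2-)
proof (induction d arbitrary: W)
  case (Suc d)
  show ?case
  proof (cases "W \<inter> ball U d = {}")
    case False
    then obtain B where "W \<subseteq> B" "B \<subseteq> V" "conn adj B" "card B \<le> card W + d" "B \<inter> U \<noteq> {}"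
      using Suc.IH[of W] Suc.prems by auto
    then show ?thesis by (intro exI[of _ B]) auto
  next
    case True
    then obtain y x where y: "y \<in> W" "x \<in> ball U d" "adj x y"
      using Suc.prems(3) by (auto simp: nbhd_def)
    have x: "x \<in> V" using ball_subset[OF U] y by blast
    let ?W = "insert x W"
    have "conn adj ?W" using y sym Suc.prems by (intro conn_insert[of _ _ y]) auto
    then obtain B where B: "?W \<subseteq> B" "B \<subseteq> V" "conn adj B" "card B \<le> card ?W + d" "B \<inter> U \<noteq> {}"
      using Suc.IH[of ?W] Suc.prems y x by auto
    have "finite W" using Suc.prems fin finite_subset by blast
    then have "card ?W \<le> Suc (card W)" by (simp add: card_insert_if)
    then show ?thesis using B by (intro exI[of _ B]) auto
  qed
qed auto

lemma attach_all:
  assumes "finite I" "\<And>i. i \<in> I \<Longrightarrow> U i \<subseteq> V" "conn adj W" "W \<subseteq> V"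
    "\<And>i. i \<in> I \<Longrightarrow> W \<inter> ball (U i) (d i) \<noteq> {}"
  shows "\<exists>B. W \<subseteq> B \<and> B \<subseteq> V \<and> conn adj B \<and> card B \<le> card W + sum d I \<and> (\<forall>i\<in>I. B \<inter> U i \<noteq> {})"
  using assms
proof (induction I rule: finite_induct)
  case empty
  then show ?case by auto
next
  case (insert i I)
  then obtain B where B: "W \<subseteq> B" "B \<subseteq> V" "conn adj B" "card B \<le> card W + sum d I" "\<forall>i\<in>I. B \<inter> U i \<noteq> {}"
    by auto
  have "B \<inter> ball (U i) (d i) \<noteq> {}" using B(1) insert.prems by blast
  with B obtain C where C: "B \<subseteq> C" "C \<subseteq> V" "conn adj C" "card C \<le> card B + d i" "C \<inter> U i \<noteq> {}"
    using attach[of "U i" B "d i"] insert.prems by auto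
  have "\<forall>j\<in>insert i I. C \<inter> U j \<noteq> {}" using B(5) C(1,5) by blast
  then show ?case using B C insert.hyps by (intro exI[of _ C]) auto
qed

text \<open>The balls of radius less than \<open>R i\<close> get weight 1, so that the missed weight bounds the distance from
  the walk to \<open>U i\<close>; the first ball containing more than half of the vertices gets weight \<open>l\<close>, so that it cannot be missed.\<close>
lemma connected_hitting_set:
  assumes I: "finite I" "\<And>i. i \<in> I \<Longrightarrow> U i \<subseteq> V" "\<And>i. i \<in> I \<Longrightarrow> u \<le> card (U i)"
    and u: "u > 0" and l: "l > 0" "card V \<le> u * l" "card I * hit_const \<beta> \<Delta> < l"
  shows "\<exists>B\<subseteq>V. conn adj B \<and> card B \<le> 2 * l + 1 \<and> (\<forall>i\<in>I. B \<inter> U i \<noteq> {})"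
proof -
  define n where "n = card V"
  define K where "K = 32 * (real \<Delta>)\<^sup>2 / \<beta>\<^sup>2"
  have K: "K > 0" using Delta beta by (simp add: K_def)
  have n: "n > 0" using fin ne by (simp add: n_def card_gt_0_iff)
  define R where "R = (\<lambda>i. LEAST r. n < 2 * card (ball (U i) r))"
  have Une: "U i \<noteq> {}" if "i \<in> I" for i using I(3)[OF that] u by auto
  have R: "n < 2 * card (ball (U i) (R i))" if "i \<in> I" for i
    unfolding R_def by (rule LeastI_ex) (use ball_exceeds_half[OF I(2) Une] that in \<open>simp add: n_def\<close>)
  have ltR: "2 * card (ball (U i) r) \<le> n" if "r < R i" for i r
    using not_less_Least[of r "\<lambda>r. n < 2 * card (ball (U i) r)"] that by (simp add: R_def)
  define J where "J = (SIGMA i:I. {..R i})"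
  define S where "S = (\<lambda>(i, r). ball (U i) r)"
  define \<omega> where "\<omega> = (\<lambda>(i, r). if r = R i then real l else 1)"
  have fJ: "finite J" using I by (simp add: J_def)
  have w0: "\<omega> j \<ge> 0" for j by (auto simp: \<omega>_def split: prod.splits)
  have w1: "\<omega> (i, r) \<ge> 1" for i r using l by (auto simp: \<omega>_def)
  have Ssub: "ball (U i) r \<subseteq> V" "ball (U i) r \<noteq> {}" if "i \<in> I" for i r
    using ball_subset[OF I(2)[OF that]] subset_ball[of "U i" r] Une[OF that] by auto
  have av: "(\<Sum>x\<in>V. avoid (ball (U i) r) l x) \<le> K * n\<^sup>2 / (real (card (ball (U i) r)) * real l)" if "i \<in> I" for i r
    using sum_avoid_le[OF Ssub[OF that] l(1)] by (simp add: K_def n_def field_simps)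
  \<comment> \<open>The ball has at least \<open>(1 + \<beta>) ^ r * u\<close> vertices, and
    \<open>card V \<le> u * l\<close> cancels one factor \<open>n\<close> in
    \<open>sum_avoid_le\<close>; what remains decays geometrically in \<open>r\<close>, uniformly in
    \<open>l\<close>.\<close>
  have small: "(\<Sum>x\<in>V. avoid (ball (U i) r) l x) \<le> n * K * (1 / (1 + \<beta>)) ^ r" if i: "i \<in> I" "r < R i" for i r
  proof -
    have "(1 + \<beta>) ^ r * card (U i) \<le> card (ball (U i) r)"
      using ball_growth[OF I(2)[OF i(1)] Une[OF i(1)], of "R i" r] ltR i unfolding n_def by simp
    moreover have "(1 + \<beta>) ^ r * u \<le> (1 + \<beta>) ^ r * card (U i)"
      using I(3)[OF i(1)] beta by (intro mult_left_mono) auto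
    ultimately have g: "(1 + \<beta>) ^ r * u \<le> card (ball (U i) r)" by linarith
    have pos: "(1 + \<beta>) ^ r * u > 0" using u beta by simp
    have "K * n\<^sup>2 / (real (card (ball (U i) r)) * real l) \<le> K * n\<^sup>2 / ((1 + \<beta>) ^ r * u * l)"
    proof (rule divide_left_mono)
      show "(1 + \<beta>) ^ r * u * l \<le> real (card (ball (U i) r)) * l"
        using g by (rule mult_right_mono) simp
      have "0 < real (card (ball (U i) r))" using pos g by linarith
      with pos l show "0 < real (card (ball (U i) r)) * l * ((1 + \<beta>) ^ r * u * l)"
        by (intro mult_pos_pos[OF mult_pos_pos mult_pos_pos]) auto
    qed (use K in auto)
    also have "\<dots> = (n / (u * l)) * (n * K * (1 / (1 + \<beta>)) ^ r)"
      by (simp add: power2_eq_square field_simps)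
    also have "\<dots> \<le> 1 * (n * K * (1 / (1 + \<beta>)) ^ r)"
    proof (rule mult_right_mono)
      have "real n \<le> real (u * l)" using l(2) unfolding n_def by (rule of_nat_mono)
      then show "real n / (u * l) \<le> 1" using u l by (simp add: field_simps)
    qed (use K beta in auto)
    finally show ?thesis using av[OF i(1), of r] by simp
  qed
  have large: "(\<Sum>x\<in>V. avoid (ball (U i) (R i)) l x) \<le> 2 * n * K / l" if i: "i \<in> I" for i
  proof -
    have h: "real n \<le> 2 * card (ball (U i) (R i))" using R[OF i] by linarith
    have "K * n\<^sup>2 / (real (card (ball (U i) (R i))) * real l) \<le> K * n\<^sup>2 / (n / 2 * l)"
      using h n K l by (intro divide_left_mono mult_right_mono mult_pos_pos) auto
    also have "\<dots> = 2 * n * K / l" using n by (simp add: power2_eq_square)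
    finally show ?thesis using av[OF i, of "R i"] by simp
  qed
  have geo: "(\<Sum>r<m. (1 / (1 + \<beta>)) ^ r) \<le> (1 + \<beta>) / \<beta>" for m
  proof -
    define q where "q = 1 / (1 + \<beta>)"
    have q: "0 < q" "q < 1" "1 / (1 - q) = (1 + \<beta>) / \<beta>" using beta by (auto simp: q_def field_simps)
    have "(\<Sum>r<m. q ^ r) = (1 - q ^ m) / (1 - q)" using q by (simp add: sum_gp_strict)
    also have "\<dots> \<le> 1 / (1 - q)" using q by (intro divide_right_mono) auto
    finally show ?thesis using q by (simp add: q_def)
  qed
  have per: "(\<Sum>r\<le>R i. \<omega> (i, r) * (\<Sum>x\<in>V. avoid (ball (U i) r) l x)) \<le> n * hit_const \<beta> \<Delta>" if i: "i \<in> I" for i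
  proof -
    have "(\<Sum>r\<le>R i. \<omega> (i, r) * (\<Sum>x\<in>V. avoid (ball (U i) r) l x))
        = (\<Sum>r<R i. (\<Sum>x\<in>V. avoid (ball (U i) r) l x)) + l * (\<Sum>x\<in>V. avoid (ball (U i) (R i)) l x)"
      by (simp add: \<omega>_def lessThan_Suc_atMost[symmetric] del: sum.lessThan_Suc) (simp add: sum.lessThan_Suc)
    also have "\<dots> \<le> (\<Sum>r<R i. n * K * (1 / (1 + \<beta>)) ^ r) + l * (2 * n * K / l)"
      using small[OF i] large[OF i] by (intro add_mono sum_mono mult_left_mono) auto
    also have "\<dots> = n * K * (\<Sum>r<R i. (1 / (1 + \<beta>)) ^ r) + 2 * n * K"
      using l by (simp add: sum_distrib_left)
    also have "\<dots> \<le> n * K * ((1 + \<beta>) / \<beta>) + 2 * n * K"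
      using K by (intro add_mono mult_left_mono geo) auto
    also have "\<dots> = n * (K * ((1 + \<beta>) / \<beta> + 2))" by (simp add: distrib_left)
    also have "\<dots> = n * hit_const \<beta> \<Delta>" by (simp add: hit_const_def K_def)
    finally show ?thesis .
  qed
  have "(\<Sum>x\<in>V. \<Sum>j\<in>J. \<omega> j * avoid (S j) l x) = (\<Sum>j\<in>J. \<omega> j * (\<Sum>x\<in>V. avoid (S j) l x))"
    by (subst sum.swap) (simp add: sum_distrib_left)
  also have "\<dots> = (\<Sum>i\<in>I. \<Sum>r\<le>R i. \<omega> (i, r) * (\<Sum>x\<in>V. avoid (ball (U i) r) l x))"
    unfolding J_def by (subst sum.Sigma) (auto simp: I S_def intro!: sum.cong)
  also have "\<dots> \<le> (\<Sum>i\<in>I. n * hit_const \<beta> \<Delta>)" by (rule sum_mono[OF per])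
  also have "\<dots> = n * (card I * hit_const \<beta> \<Delta>)" by simp
  also have "\<dots> < n * l" using l(3) n by simp
  also have "\<dots> = (\<Sum>x\<in>V. real l)" by (simp add: n_def)
  finally have lt: "(\<Sum>x\<in>V. \<Sum>j\<in>J. \<omega> j * avoid (S j) l x) < (\<Sum>x\<in>V. real l)" .
  \<comment> \<open>The start is chosen by averaging, because \<open>sum_avoid_le\<close> controls
    only the sum over all starting points.\<close>
  have "\<exists>x\<in>V. (\<Sum>j\<in>J. \<omega> j * avoid (S j) l x) < l"
  proof (rule ccontr)
    assume "\<not> ?thesis"
    then have "(\<Sum>x\<in>V. real l) \<le> (\<Sum>x\<in>V. \<Sum>j\<in>J. \<omega> j * avoid (S j) l x)"
      by (intro sum_mono) (auto simp: not_less)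
    with lt show False by linarith
  qed
  then obtain x where x: "x \<in> V" "(\<Sum>j\<in>J. \<omega> j * avoid (S j) l x) < l" by blast
  obtain W where W: "W \<subseteq> V" "x \<in> W" "conn adj W" "card W \<le> Suc l"
    "(\<Sum>j\<in>{j\<in>J. S j \<inter> W = {}}. \<omega> j) \<le> (\<Sum>j\<in>J. \<omega> j * avoid (S j) l x)"
    using exists_walk[OF x(1) fJ, where \<omega> = \<omega> and U = S and l = l] w0 by blast
  define M where "M = {j\<in>J. S j \<inter> W = {}}"
  have fM: "finite M" using fJ by (simp add: M_def)
  have M: "sum \<omega> M < l" using W x by (simp add: M_def)
  have hitR: "W \<inter> ball (U i) (R i) \<noteq> {}" if "i \<in> I" for i
  proof
    assume "W \<inter> ball (U i) (R i) = {}"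
    then have "(i, R i) \<in> M" using that by (auto simp: M_def J_def S_def)
    then have "\<omega> (i, R i) \<le> sum \<omega> M" using fM w0 by (intro member_le_sum) auto
    then show False using M by (simp add: \<omega>_def)
  qed
  define d where "d = (\<lambda>i. LEAST r. W \<inter> ball (U i) r \<noteq> {})"
  have d: "W \<inter> ball (U i) (d i) \<noteq> {}" if "i \<in> I" for i
    unfolding d_def by (rule LeastI[of "\<lambda>r. W \<inter> ball (U i) r \<noteq> {}"]) (rule hitR[OF that])
  have dR: "d i \<le> R i" if "i \<in> I" for i
    unfolding d_def by (rule Least_le) (rule hitR[OF that])
  have dmiss: "W \<inter> ball (U i) r = {}" if "r < d i" for i r
    using not_less_Least[of r "\<lambda>r. W \<inter> ball (U i) r \<noteq> {}"] that by (auto simp: d_def)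
  \<comment> \<open>All balls of radius below \<open>d i\<close> are missed and have weight at least
    1, so the missed weight dominates the total length of the connecting paths.\<close>
  have "(SIGMA i:I. {..<d i}) \<subseteq> M"
    using dR dmiss by (force simp: M_def J_def S_def)
  then have "sum \<omega> (SIGMA i:I. {..<d i}) \<le> sum \<omega> M" using fM w0 by (intro sum_mono2) auto
  moreover have "real (card (SIGMA i:I. {..<d i})) \<le> sum \<omega> (SIGMA i:I. {..<d i})"
    using w1 sum_mono[of "SIGMA i:I. {..<d i}" "\<lambda>_. 1" \<omega>] by auto
  ultimately have "real (card (SIGMA i:I. {..<d i})) < real l" using M by linarith
  moreover have "card (SIGMA i:I. {..<d i}) = sum d I" using I by (simp add: card_SigmaI)
  ultimately have dl: "sum d I < l" by (simp only: of_nat_less_iff)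
  obtain B where B: "W \<subseteq> B" "B \<subseteq> V" "conn adj B" "card B \<le> card W + sum d I" "\<forall>i\<in>I. B \<inter> U i \<noteq> {}"
    using attach_all[of I U W d, OF I(1,2) W(3,1) d] by blast
  show ?thesis using B W(4) dl by (intro exI[of _ B]) auto
qed

text \<open>As long as the set has at most half of the vertices, expansion provides a further
  neighbour. This brings every branch set to one common size, large enough to guarantee many
  neighbours.\<close>

lemma conn_pad:
  assumes "conn adj B" "B \<subseteq> V" "card B \<le> m" "2 * m \<le> card V"
  shows "\<exists>C. B \<subseteq> C \<and> C \<subseteq> V \<and> conn adj C \<and> card C = m"
  using assms(3,4)
proof (induction m rule: dec_induct)
  case base
  then show ?case using assms by blast
next
  case (step m)
  then obtain C where C: "B \<subseteq> C" "C \<subseteq> V" "conn adj C" "card C = m" by auto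
  have fC: "finite C" using C fin finite_subset by blast
  have "\<beta> * card C \<le> card (nbhd adj V C)"
    using C conn_nonempty[OF C(3)] step.prems by (intro expand) auto
  moreover have "\<beta> * card C > 0" using beta conn_nonempty[OF C(3)] fC by (simp add: card_gt_0_iff)
  ultimately have "nbhd adj V C \<noteq> {}" by auto
  then obtain y x where y: "y \<in> V - C" "x \<in> C" "adj x y" by (auto simp: nbhd_def)
  then have "conn adj (insert y C)" using C sym by (intro conn_insert[of _ _ x]) auto
  then show ?case using C y fC by (intro exI[of _ "insert y C"]) auto
qed

end

section \<open>Complete minors in graphs without sparse balanced cuts\<close>

text \<open>The term \<open>16 / \<eta>\<^sup>2\<close> ensures that \<open>t\<close> branch sets
  cover at most \<open>\<eta> / 2\<close> of the vertices; \<open>hit_const\<close> enters through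
  \<open>connected_hitting_set\<close>, used with expansion \<open>\<eta> / 2\<close>.\<close>

definition minor_const :: "real \<Rightarrow> nat \<Rightarrow> real" where
  "minor_const \<eta> \<Delta> = 16 / \<eta>\<^sup>2 + hit_const (\<eta> / 2) \<Delta> + 1"

lemma hit_const_nonneg: "\<beta> > 0 \<Longrightarrow> hit_const \<beta> \<Delta> \<ge> 0"
  by (auto simp: hit_const_def intro!: mult_nonneg_nonneg add_nonneg_nonneg divide_nonneg_nonneg)

lemma minor_const_pos: "\<eta> > 0 \<Longrightarrow> minor_const \<eta> \<Delta> > 0"
  unfolding minor_const_def using hit_const_nonneg[of "\<eta> / 2" \<Delta>]
  by (intro add_nonneg_pos add_nonneg_nonneg) auto

text \<open>The branch sets of a complete minor, indexed by themselves: being nonempty and disjoint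
  they are distinct anyway, so \<open>card F\<close> is the order of the minor.\<close>

definition clique_family :: "('b \<Rightarrow> 'b \<Rightarrow> bool) \<Rightarrow> 'b set \<Rightarrow> 'b set set \<Rightarrow> bool" where
  "clique_family adj V F \<longleftrightarrow> (\<forall>B\<in>F. B \<subseteq> V \<and> conn adj B) \<and>
     (\<forall>B\<in>F. \<forall>C\<in>F. B \<noteq> C \<longrightarrow> B \<inter> C = {} \<and> (\<exists>x\<in>B. \<exists>y\<in>C. adj x y))"

lemma clique_family_subset:
  assumes "clique_family adj V F" "F' \<subseteq> F" "\<And>B. B \<in> F' \<Longrightarrow> B \<subseteq> V'"
  shows "clique_family adj V' F'"
  using assms unfolding clique_family_def by (meson subsetD)

lemma clique_family_insert:
  assumes F: "clique_family adj V F" and C: "C \<subseteq> V" "conn adj C" and sym: "\<And>x y. adj x y \<Longrightarrow> adj y x"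
    and FC: "\<And>A. A \<in> F \<Longrightarrow> C \<inter> A = {} \<and> (\<exists>x\<in>A. \<exists>y\<in>C. adj x y)"
  shows "clique_family adj V (insert C F)"
proof -
  have "\<exists>x\<in>C. \<exists>y\<in>A. adj x y" "A \<inter> C = {}" if "A \<in> F" for A using FC[OF that] sym by blast+
  then show ?thesis using F C FC unfolding clique_family_def by (metis insert_iff)
qed

text \<open>Take a family \<open>F\<close> of branch sets and a set \<open>D\<close> of discarded vertices with few neighbours outside \<open>F\<close>,
  with \<open>(card D, card F)\<close> lexicographically maximal. Then \<open>D\<close> is small by the cut condition, every
  branch set has many neighbours in the rest \<open>Y\<close>, and \<open>Y\<close> is an expander, for otherwise a branch set or
  a part of \<open>Y\<close> could be discarded. So a further branch set can be added as long as \<open>card F < t\<close>.\<close>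
lemma clique_family_of_no_sparse_cut:
  fixes V :: "'b set" and \<eta> :: real and \<Delta> t :: nat
  assumes fin: "finite V" and ne: "V \<noteq> {}" and sym: "\<And>x y. adj x y \<Longrightarrow> adj y x"
    and Delta: "\<Delta> > 0" and deg: "\<And>x. x \<in> V \<Longrightarrow> card {y \<in> V. adj x y} \<le> \<Delta>"
    and eta: "0 < \<eta>" "\<eta> \<le> 1 / 8"
    and cut: "\<And>X Y. X \<subseteq> V \<Longrightarrow> Y \<subseteq> V \<Longrightarrow> X \<inter> Y = {} \<Longrightarrow> card V \<le> 8 * card X \<Longrightarrow> card V \<le> 8 * card Y
      \<Longrightarrow> card (V - X - Y) \<le> \<eta> * card V \<Longrightarrow> \<exists>x\<in>X. \<exists>y\<in>Y. adj x y"
    and t: "t * minor_const \<eta> \<Delta> \<le> sqrt (card V)"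
  shows "\<exists>F. card F = t \<and> clique_family adj V F"
proof (cases "t = 0")
  case True
  then show ?thesis by (intro exI[of _ "{}"]) (auto simp: clique_family_def)
next
  case False
  define N where "N = card V"
  have N: "N > 0" using fin ne by (simp add: N_def card_gt_0_iff)
  define \<beta> where "\<beta> = \<eta> / 2"
  have beta: "\<beta> > 0" "\<beta> \<le> 1 / 16" using eta by (auto simp: \<beta>_def)
  \<comment> \<open>Both the guaranteed neighbourhood size and the walk length in
    \<open>connected_hitting_set\<close>, which requires their product to be at least the number of
    vertices.\<close>
  define r where "r = nat \<lceil>sqrt N\<rceil>"
  have s1: "sqrt N \<ge> 1" using N by simp
  have r1: "sqrt N \<le> r" unfolding r_def using s1 by linarith
  have r2: "r \<le> 2 * sqrt N" unfolding r_def using s1 by linarith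
  have r0: "r > 0" using s1 r1 by linarith
  have rr: "N \<le> r * r"
  proof -
    have "sqrt N * sqrt N \<le> real r * real r" using r1 by (intro mult_mono) auto
    then have "real N \<le> real (r * r)" by simp
    then show ?thesis using of_nat_le_iff by blast
  qed
  \<comment> \<open>Large enough that more than \<open>\<beta> * L\<close> neighbours means at least
    \<open>r\<close>, and that the connecting set of size at most \<open>2 * r + 1\<close> fits into
    a branch set.\<close>
  define L where "L = nat \<lceil>r / \<beta>\<rceil>"
  have rb: "real r / \<beta> \<ge> 16 * r" using beta r0 by (simp add: field_simps)
  have L1: "real r / \<beta> \<le> L" unfolding L_def by linarith
  have L2: "real L \<le> r / \<beta> + 1" unfolding L_def using rb r0 by linarith
  have L3: "2 * r + 1 \<le> L" using L1 rb r0 by linarith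
  have L0: "L > 0" using L3 by simp
  have t1: "t * (16 / \<eta>\<^sup>2) \<le> sqrt N" "t * hit_const \<beta> \<Delta> < r"
  proof -
    have h: "hit_const \<beta> \<Delta> \<ge> 0" using beta hit_const_nonneg by blast
    have "t * (16 / \<eta>\<^sup>2) \<le> t * minor_const \<eta> \<Delta>"
      using h by (intro mult_left_mono) (auto simp: minor_const_def \<beta>_def)
    then show "t * (16 / \<eta>\<^sup>2) \<le> sqrt N" using t by (simp add: N_def)
    have "t * hit_const \<beta> \<Delta> < t * minor_const \<eta> \<Delta>"
      using False eta by (intro mult_strict_left_mono) (auto simp: minor_const_def \<beta>_def add_nonneg_pos)
    then show "t * hit_const \<beta> \<Delta> < r" using t r1 by (simp add: N_def)
  qed
  have tL: "t * L \<le> \<eta> * N / 2"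
  proof -
    have "real L \<le> 2 * (r / \<beta>)" using L2 rb r0 by linarith
    also have "\<dots> \<le> 2 * (2 * sqrt N / \<beta>)" using r2 beta by (intro mult_left_mono divide_right_mono) auto
    also have "\<dots> = 8 * sqrt N / \<eta>" by (simp add: \<beta>_def)
    finally have "t * real L \<le> t * (8 * sqrt N / \<eta>)" by (intro mult_left_mono) auto
    also have "\<dots> = (\<eta> / 2) * (t * (16 / \<eta>\<^sup>2)) * sqrt N" using eta by (simp add: power2_eq_square field_simps)
    also have "\<dots> \<le> (\<eta> / 2) * sqrt N * sqrt N"
      using t1(1) eta by (intro mult_right_mono mult_left_mono) auto
    also have "\<dots> = \<eta> / 2 * (sqrt N * sqrt N)" by (simp only: mult.assoc)
    also have "\<dots> = \<eta> * N / 2" by simp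
    finally show ?thesis by simp
  qed
  have etaN: "\<eta> * N \<le> N / 8" using eta N by simp
  have tL': "real (t * L) \<le> N / 16" using tL etaN by linarith
  have LN: "16 * L \<le> N"
  proof -
    have "real L \<le> real (t * L)" using False by (cases t) auto
    then show ?thesis using tL' by linarith
  qed
  \<comment> \<open>The bound \<open>5 * N / 8\<close> leaves room to enlarge a \<open>D\<close> of
    size below \<open>N / 8\<close> by as much as half of the remaining vertices, and still keeps
    the complement of \<open>D\<close> large.\<close>
  define valid where "valid = (\<lambda>(D, F). D \<subseteq> V \<and> clique_family adj (V - D) F \<and> (\<forall>B\<in>F. card B = L)
     \<and> card F \<le> t \<and> 8 * card D \<le> 5 * N \<and> real (card (nbhd adj (V - \<Union>F) D)) \<le> \<beta> * card D)"
  \<comment> \<open>As \<open>card F \<le> t\<close>, this number orders pairs lexicographically: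
    one more discarded vertex outweighs any loss of branch sets.\<close>
  define \<mu> where "\<mu> = (\<lambda>(D :: 'b set, F :: 'b set set). card D * (t + 1) + card F)"
  have "valid ({}, {})" by (simp add: valid_def clique_family_def nbhd_def)
  moreover have "\<mu> z \<le> N * (t + 1) + t" if "valid z" for z
    using that fin by (auto simp: valid_def \<mu>_def N_def intro!: add_mono mult_right_mono card_mono)
  ultimately obtain z where z: "valid z" "\<And>y. valid y \<Longrightarrow> \<mu> y \<le> \<mu> z"
    using ex_has_greatest_nat[of valid "({}, {})" \<mu> "Suc (N * (t + 1) + t)"] by (metis le_imp_less_Suc)
  obtain D F where DF: "z = (D, F)" by force
  have D: "D \<subseteq> V" "8 * card D \<le> 5 * N" "card (nbhd adj (V - \<Union>F) D) \<le> \<beta> * card D"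
    and F: "clique_family adj (V - D) F" "\<And>B. B \<in> F \<Longrightarrow> card B = L" "card F \<le> t"
    using z(1) by (auto simp: valid_def DF)
  have mx: "\<not> valid (D', F')" if "card D * (t + 1) + card F < card D' * (t + 1) + card F'" for D' F'
    using z(2)[of "(D', F')"] that by (auto simp: \<mu>_def DF)
  have FV: "B \<subseteq> V" "B \<inter> D = {}" "conn adj B" "finite B" if "B \<in> F" for B
    using F(1) that fin finite_subset by (auto simp: clique_family_def)
  have Fadj: "\<And>B C. B \<in> F \<Longrightarrow> C \<in> F \<Longrightarrow> B \<noteq> C \<Longrightarrow> B \<inter> C = {} \<and> (\<exists>x\<in>B. \<exists>y\<in>C. adj x y)"
    using F(1) unfolding clique_family_def by blast
  have fF: "finite F" using FV(1) fin by (meson finite_Pow_iff finite_subset PowI subsetI)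
  have fD: "finite D" using D fin finite_subset by blast
  have UF: "real (card (\<Union>F)) \<le> \<eta> * N / 2"
  proof -
    have "card (\<Union>F) \<le> (\<Sum>B\<in>F. card B)" using FV(4) by (intro card_Union_le_sum_card)
    also have "\<dots> = card F * L" using F(2) by simp
    also have "\<dots> \<le> t * L" using F(3) by simp
    finally show ?thesis using tL by linarith
  qed
  have fnb: "finite (nbhd adj (V - A) B)" for A B using fin by (auto simp: nbhd_def)
  show ?thesis
  proof (cases "card F = t")
    case True
    then show ?thesis using F(1) by (intro exI[of _ F]) (auto simp: clique_family_def)
  next
    case ltF: False
    then have ltF: "card F < t" using F(3) by simp
    \<comment> \<open>Otherwise \<open>D\<close> and the set \<open>Y'\<close> of vertices neither
      adjacent to it nor in a branch set would be two large sets without an edge between them,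
      separated only by the branch sets and the boundary of \<open>D\<close>.\<close>
    have D8: "8 * card D < N"
    proof (rule ccontr)
      assume "\<not> ?thesis"
      then have big: "N \<le> 8 * card D" by simp
      define Y' where "Y' = V - D - \<Union>F - nbhd adj (V - \<Union>F) D"
      have "V - D - Y' \<subseteq> \<Union>F \<union> nbhd adj (V - \<Union>F) D" by (auto simp: Y'_def)
      moreover have fU: "finite (\<Union>F)" using fF FV by auto
      ultimately have "card (V - D - Y') \<le> card (\<Union>F) + card (nbhd adj (V - \<Union>F) D)"
        using card_mono card_Un_le fnb by (meson finite_UnI order_trans)
      moreover have "\<beta> * card D \<le> \<beta> * N" using D(1) fin beta by (intro mult_left_mono) (auto simp: N_def card_mono)
      ultimately have rest: "card (V - D - Y') \<le> \<eta> * N" using UF D(3) by (simp add: \<beta>_def)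
      have "card V = card D + card Y' + card (V - D - Y')"
      proof -
        have "V = D \<union> Y' \<union> (V - D - Y')" using D(1) by (auto simp: Y'_def)
        then have "card V = card (D \<union> Y' \<union> (V - D - Y'))" by simp
        also have "\<dots> = card (D \<union> Y') + card (V - D - Y')" using fin fD
          by (intro card_Un_disjoint) (auto simp: Y'_def)
        also have "card (D \<union> Y') = card D + card Y'" using fin fD
          by (intro card_Un_disjoint) (auto simp: Y'_def)
        finally show ?thesis .
      qed
      then have "real N = card D + card Y' + card (V - D - Y')" by (simp add: N_def)
      then have "real N \<le> 8 * card Y'" using rest etaN D(2) by linarith
      then have "N \<le> 8 * card Y'" by linarith
      then have "\<exists>x\<in>D. \<exists>y\<in>Y'. adj x y"
        using big rest D by (intro cut) (auto simp: N_def Y'_def)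
      then show False by (auto simp: Y'_def nbhd_def)
    qed
    define Y where "Y = V - D - \<Union>F"
    have fY: "finite Y" using fin by (simp add: Y_def)
    have cY: "N \<le> 2 * card Y"
    proof -
      have "card V \<le> card (Y \<union> (D \<union> \<Union>F))" using fin fD fF FV(4) by (intro card_mono) (auto simp: Y_def)
      also have "\<dots> \<le> card Y + (card D + card (\<Union>F))" by (meson add_left_mono card_Un_le order_trans)
      finally have "real N \<le> card Y + card D + card (\<Union>F)" by (simp add: N_def)
      then have "real N \<le> 2 * card Y" using D8 UF etaN by linarith
      then show ?thesis by linarith
    qed
    \<comment> \<open>A branch set with too few neighbours in \<open>Y\<close> could be moved into
      \<open>D\<close>: its old adjacencies lie in \<open>D\<close>, in other branch sets, or in the
      counted boundary.\<close>
    have a: "\<beta> * L < card (nbhd adj Y B)" if B: "B \<in> F" for B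
    proof (rule ccontr)
      assume n: "\<not> ?thesis"
      have cF: "card (F - {B}) = card F - 1" "card F \<ge> 1" using B fF by (auto simp: card_gt_0_iff Suc_le_eq)
      have cD: "card (D \<union> B) = card D + L" using B FV F(2) fD by (subst card_Un_disjoint) auto
      have "card D * (t + 1) + card F < card (D \<union> B) * (t + 1) + card (F - {B})"
      proof -
        have "(card D + 1) * (t + 1) \<le> (card D + L) * (t + 1)" using L0 by (intro mult_right_mono) auto
        then show ?thesis using cD cF ltF by (simp add: algebra_simps)
      qed
      then have "\<not> valid (D \<union> B, F - {B})" by (rule mx)
      moreover have "valid (D \<union> B, F - {B})"
      proof -
        have "nbhd adj (V - \<Union>(F - {B})) (D \<union> B) \<subseteq> nbhd adj (V - \<Union>F) D \<union> nbhd adj Y B"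
          by (auto simp: nbhd_def Y_def)
        moreover have "finite (nbhd adj Y B)" using fY by (simp add: nbhd_def)
        ultimately have "card (nbhd adj (V - \<Union>(F - {B})) (D \<union> B)) \<le> card (nbhd adj (V - \<Union>F) D) + card (nbhd adj Y B)"
          using card_mono card_Un_le fnb by (meson finite_UnI order_trans)
        then have "real (card (nbhd adj (V - \<Union>(F - {B})) (D \<union> B))) \<le> \<beta> * card (D \<union> B)"
          using n D(3) by (simp add: cD distrib_left)
        moreover have "clique_family adj (V - (D \<union> B)) (F - {B})"
        proof (rule clique_family_subset[OF F(1)])
          fix A assume A: "A \<in> F - {B}"
          then have "A \<subseteq> V" "A \<inter> D = {}" "A \<inter> B = {}" using FV[of A] Fadj[of A B] B by auto
          then show "A \<subseteq> V - (D \<union> B)" by blast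
        qed blast
        moreover have "8 * card (D \<union> B) \<le> 5 * N" using cD D8 LN by simp
        ultimately show ?thesis using D(1) FV[OF B] F(2) cF F(3) by (auto simp: valid_def)
      qed
      ultimately show False by blast
    qed
    \<comment> \<open>A non-expanding \<open>S\<close> could be moved into \<open>D\<close>, with
      boundaries adding up; \<open>D8\<close> and the size condition on \<open>S\<close> keep the
      result below \<open>5 * N / 8\<close>.\<close>
    have b: "\<beta> * card S \<le> card (nbhd adj Y S)" if S: "S \<subseteq> Y" "S \<noteq> {}" "2 * card S \<le> card Y" for S
    proof (rule ccontr)
      assume n: "\<not> ?thesis"
      have fS: "finite S" using S fY finite_subset by blast
      have cD: "card (D \<union> S) = card D + card S" using S fS fD by (subst card_Un_disjoint) (auto simp: Y_def)
      have cS: "card S > 0" using S fS by (simp add: card_gt_0_iff)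
      have "card D * (t + 1) + card F < card (D \<union> S) * (t + 1) + card F"
        using cD cS by (simp add: add_mult_distrib)
      then have "\<not> valid (D \<union> S, F)" by (rule mx)
      moreover have "valid (D \<union> S, F)"
      proof -
        have "nbhd adj (V - \<Union>F) (D \<union> S) \<subseteq> nbhd adj (V - \<Union>F) D \<union> nbhd adj Y S"
          by (auto simp: nbhd_def Y_def)
        moreover have "finite (nbhd adj Y S)" using fY by (simp add: nbhd_def)
        ultimately have "card (nbhd adj (V - \<Union>F) (D \<union> S)) \<le> card (nbhd adj (V - \<Union>F) D) + card (nbhd adj Y S)"
          using card_mono card_Un_le fnb by (meson finite_UnI order_trans)
        then have "real (card (nbhd adj (V - \<Union>F) (D \<union> S))) \<le> \<beta> * card (D \<union> S)"
          using n D(3) by (simp add: cD distrib_left)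
        moreover have "clique_family adj (V - (D \<union> S)) F"
        proof (rule clique_family_subset[OF F(1)])
          fix A assume A: "A \<in> F"
          then have "A \<subseteq> V" "A \<inter> D = {}" "A \<inter> S = {}" using FV[of A] S(1) by (auto simp: Y_def)
          then show "A \<subseteq> V - (D \<union> S)" by blast
        qed blast
        moreover have "card Y \<le> N" using fin by (auto simp: Y_def N_def intro: card_mono)
        then have "8 * card (D \<union> S) \<le> 5 * N" using cD D8 S by simp
        ultimately show ?thesis using D(1) S F by (auto simp: valid_def Y_def)
      qed
      ultimately show False by blast
    qed
    interpret Y: expander Y adj \<beta> \<Delta>
    proof
      show "Y \<noteq> {}" using cY N by auto
      fix x assume "x \<in> Y"
      then have "card {y \<in> Y. adj x y} \<le> card {y \<in> V. adj x y}"
        using fin by (intro card_mono) (auto simp: Y_def)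
      then show "card {y \<in> Y. adj x y} \<le> \<Delta>" using deg[of x] \<open>x \<in> Y\<close> by (auto simp: Y_def)
    qed (use fY beta Delta sym b in auto)
    have "\<exists>B\<subseteq>Y. conn adj B \<and> card B \<le> 2 * r + 1 \<and> (\<forall>i\<in>F. B \<inter> nbhd adj Y i \<noteq> {})"
    proof (rule Y.connected_hitting_set[where u = r])
      show "r \<le> card (nbhd adj Y i)" if "i \<in> F" for i
      proof -
        have "real r \<le> \<beta> * L" using L1 beta by (simp add: field_simps)
        then have "real r < card (nbhd adj Y i)" using a[OF that] by linarith
        then show ?thesis by simp
      qed
      have "card Y \<le> N" using fin by (auto simp: Y_def N_def intro: card_mono)
      then show "card Y \<le> r * r" using rr by simp
      have "card F * hit_const \<beta> \<Delta> \<le> t * hit_const \<beta> \<Delta>"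
        using F(3) hit_const_nonneg[OF beta(1)] by (intro mult_right_mono) auto
      then show "card F * hit_const \<beta> \<Delta> < r" using t1 by linarith
    qed (use fF r0 in \<open>auto simp: nbhd_def\<close>)
    then obtain B where B: "B \<subseteq> Y" "conn adj B" "card B \<le> 2 * r + 1" "\<forall>i\<in>F. B \<inter> nbhd adj Y i \<noteq> {}" by blast
    have "card B \<le> L" "2 * L \<le> card Y" using B(3) L3 LN cY by auto
    then obtain C where C: "B \<subseteq> C" "C \<subseteq> Y" "conn adj C" "card C = L"
      using Y.conn_pad[OF B(2,1)] by blast
    have CF: "C \<notin> F" using C(2) conn_nonempty[OF C(3)] by (auto simp: Y_def)
    have "card D * (t + 1) + card F < card D * (t + 1) + card (insert C F)" using CF fF by simp
    then have "\<not> valid (D, insert C F)" by (rule mx)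
    moreover have "valid (D, insert C F)"
    proof -
      have "nbhd adj (V - \<Union>(insert C F)) D \<subseteq> nbhd adj (V - \<Union>F) D" by (auto simp: nbhd_def)
      then have "card (nbhd adj (V - \<Union>(insert C F)) D) \<le> card (nbhd adj (V - \<Union>F) D)"
        using fnb by (intro card_mono)
      moreover have "clique_family adj (V - D) (insert C F)"
      proof (rule clique_family_insert[OF F(1) _ C(3) sym])
        show "C \<subseteq> V - D" using C by (auto simp: Y_def)
        fix A assume A: "A \<in> F"
        then obtain y where y: "y \<in> B" "y \<in> nbhd adj Y A" using B(4) by blast
        then have "\<exists>x\<in>A. adj x y" by (simp add: nbhd_def)
        then show "C \<inter> A = {} \<and> (\<exists>x\<in>A. \<exists>y\<in>C. adj x y)" using A y(1) C(1,2) by (auto simp: Y_def)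
      qed
      moreover have "real (card (nbhd adj (V - \<Union>(insert C F)) D)) \<le> \<beta> * card D"
        using calculation(1) D(3) by linarith
      ultimately show ?thesis using D F(2) C(4) ltF CF fF by (auto simp: valid_def)
    qed
    ultimately show ?thesis by blast
  qed
qed

section \<open>Graphs of linked pieces\<close>

text \<open>\<open>Q\<close> maximises \<open>w(Q, Q) / card Q powr (3/2)\<close>. As \<open>x powr (3/2)\<close> is strictly superadditive,
  the two parts of \<open>Q\<close> cannot account for all of the weight; as \<open>3/2 < 2\<close>, \<open>Q\<close> cannot be small.\<close>
lemma dense_core:
  fixes w :: "'i \<Rightarrow> 'i \<Rightarrow> real" and d :: real
  assumes fin: "finite I" and ne: "I \<noteq> {}" and sym: "\<And>i j. w i j = w j i"
    and w1: "\<And>i j. i \<in> I \<Longrightarrow> j \<in> I \<Longrightarrow> w i j \<le> 1"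
    and d: "d > 0" "d * (card I)\<^sup>2 \<le> (\<Sum>i\<in>I. \<Sum>j\<in>I. w i j)"
  shows "\<exists>Q\<subseteq>I. Q \<noteq> {} \<and> d\<^sup>2 * card I \<le> card Q \<and>
    (\<forall>X\<subseteq>Q. 2 * card X \<le> card Q \<longrightarrow> d / 8 * card X * card Q \<le> (\<Sum>i\<in>X. \<Sum>j\<in>Q - X. w i j))"
proof -
  define W where "W = (\<lambda>A B. \<Sum>i\<in>A. \<Sum>j\<in>B. w i j)"
  define g where "g = (\<lambda>A :: 'i set. real (card A) * sqrt (card A))"
  define f where "f = (\<lambda>Q. W Q Q / g Q)"
  have gpos: "g A > 0" if "A \<subseteq> I" "A \<noteq> {}" for A
  proof -
    have "card A > 0" using that finite_subset[OF that(1) fin] by (simp add: card_gt_0_iff)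
    then show ?thesis unfolding g_def by (intro mult_pos_pos) auto
  qed
  let ?C = "Pow I - {{}}"
  have C: "finite (f ` ?C)" "f ` ?C \<noteq> {}" using fin ne by auto
  have "Max (f ` ?C) \<in> f ` ?C" by (rule Max_in[OF C])
  then obtain Q where "Max (f ` ?C) = f Q" "Q \<in> ?C" by (rule imageE)
  then have Q: "Q \<subseteq> I" "Q \<noteq> {}" "f Q = Max (f ` ?C)" by auto
  have mx: "f A \<le> f Q" if "A \<subseteq> I" "A \<noteq> {}" for A
    unfolding Q(3) using that C by (intro Max_ge) auto
  have WI: "W I I \<ge> d * (card I)\<^sup>2" using d by (simp add: W_def)
  have cI: "real (card I) > 0" using fin ne by (simp add: card_gt_0_iff)
  have fQ: "f Q \<ge> d * sqrt (card I)"
  proof -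
    have "d * sqrt (card I) = d * (card I)\<^sup>2 / g I"
      using cI by (simp add: g_def power2_eq_square field_simps)
    also have "\<dots> \<le> f I" unfolding f_def using WI gpos[of I] ne by (intro divide_right_mono) auto
    also have "\<dots> \<le> f Q" using ne by (intro mx) auto
    finally show ?thesis .
  qed
  have f0: "f Q \<ge> 0" using fQ d by (meson mult_nonneg_nonneg order_trans less_imp_le real_sqrt_ge_zero of_nat_0_le_iff)
  have Wle: "W A A \<le> f Q * g A" if "A \<subseteq> I" for A
  proof (cases "A = {}")
    case True then show ?thesis by (simp add: W_def g_def)
  next
    case False
    then have "W A A = f A * g A" using gpos[OF that False] by (simp add: f_def)
    also have "\<dots> \<le> f Q * g A" using mx[OF that False] gpos[OF that False] by (intro mult_right_mono) auto
    finally show ?thesis .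
  qed
  have fQ': "finite Q" using Q fin finite_subset by blast
  define q where "q = real (card Q)"
  have q: "q > 0" using Q fQ' by (simp add: q_def card_gt_0_iff)
  have qI: "q \<le> card I" using Q fin by (simp add: q_def card_mono)
  have WQ: "W Q Q = f Q * (q * sqrt q)" using q by (simp add: f_def g_def q_def)
  \<comment> \<open>Weights at most 1 give \<open>f Q \<le> sqrt q\<close>, whereas maximality gives
    \<open>f Q \<ge> d * sqrt (card I)\<close>; here the exponent below 2 is used.\<close>
  have size: "d\<^sup>2 * card I \<le> card Q"
  proof -
    have "W Q Q \<le> (\<Sum>i\<in>Q. \<Sum>j\<in>Q. 1)" unfolding W_def using Q(1) by (intro sum_mono w1) auto
    then have "f Q * sqrt q * q \<le> q * q" using WQ by (simp add: q_def algebra_simps)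
    then have "f Q * sqrt q \<le> q" using q by simp
    then have "f Q * sqrt q \<le> sqrt q * sqrt q" using q by simp
    then have "f Q \<le> sqrt q" using q by (simp only: mult_le_cancel_right_pos real_sqrt_gt_zero)
    then have "d * sqrt (card I) \<le> sqrt q" using fQ by linarith
    then have "(d * sqrt (card I))\<^sup>2 \<le> (sqrt q)\<^sup>2" using d by (intro power_mono) auto
    then show ?thesis using q by (simp add: power_mult_distrib q_def)
  qed
  have cutX: "d / 8 * card X * card Q \<le> W X (Q - X)" if X: "X \<subseteq> Q" "2 * card X \<le> card Q" for X
  proof -
    define Y where "Y = Q - X"
    define a where "a = real (card X)"
    define b where "b = real (card Y)"
    have fX: "finite X" "finite Y" using X fQ' finite_subset by (auto simp: Y_def)
    have QXY: "Q = X \<union> Y" "X \<inter> Y = {}" using X by (auto simp: Y_def)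
    have ab: "q = a + b" using QXY fX by (simp add: q_def a_def b_def card_Un_disjoint)
    have a: "0 \<le> a" "2 * a \<le> q" "0 \<le> b" using X(2) by (auto simp: a_def b_def q_def)
    have WYX: "W Y X = W X Y" unfolding W_def using sym by (subst sum.swap) simp
    have split: "W A Q = W A X + W A Y" for A
      unfolding W_def sum.distrib[symmetric] using QXY fX by (simp add: sum.union_disjoint)
    have "W Q Q = W X Q + W Y Q"
      unfolding W_def using QXY fX by (metis sum.union_disjoint)
    then have "2 * W X Y = W Q Q - W X X - W Y Y" using WYX split[of X] split[of Y] by simp
    also have "\<dots> \<ge> f Q * (q * sqrt q) - f Q * (a * sqrt a) - f Q * (b * sqrt b)"
    proof -
      have "X \<subseteq> I" "Y \<subseteq> I" using X(1) Q(1) by (auto simp: Y_def)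
      then have "W X X \<le> f Q * (a * sqrt a)" "W Y Y \<le> f Q * (b * sqrt b)"
        using Wle by (auto simp: g_def a_def b_def)
      then show ?thesis using WQ by linarith
    qed
    also have "f Q * (q * sqrt q) - f Q * (a * sqrt a) - f Q * (b * sqrt b)
        = f Q * (a * (sqrt q - sqrt a) + b * (sqrt q - sqrt b))"
      unfolding ab by (simp add: algebra_simps)
    also have "\<dots> \<ge> f Q * (a * (sqrt q / 4) + 0)"
    proof (intro mult_left_mono add_mono f0 a(1))
      \<comment> \<open>\<open>3 / 4\<close> is a convenient rational bound for the square root of
        \<open>1 / 2\<close>, as \<open>a\<close> is at most \<open>q / 2\<close>.\<close>
      have "sqrt a \<le> sqrt ((3/4)\<^sup>2 * q)" using a q by (intro real_sqrt_le_mono) (simp add: power2_eq_square)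
      also have "\<dots> = 3 / 4 * sqrt q" by (simp add: real_sqrt_mult)
      finally show "sqrt q / 4 \<le> sqrt q - sqrt a" by linarith
      show "0 \<le> b * (sqrt q - sqrt b)" using ab a by (intro mult_nonneg_nonneg) auto
    qed
    also have "f Q * (a * (sqrt q / 4) + 0) = (f Q * sqrt q) * (a / 4)" by simp
    also have "\<dots> \<ge> (d * sqrt q * sqrt q) * (a / 4)"
    proof (intro mult_right_mono)
      have "d * sqrt q \<le> d * sqrt (card I)" using d qI by simp
      then show "d * sqrt q \<le> f Q" using fQ by linarith
    qed (use a q in auto)
    also have "(d * sqrt q * sqrt q) * (a / 4) = d * (sqrt q * sqrt q) * (a / 4)" by (simp only: mult.assoc)
    also have "\<dots> = d * q * a / 4" using q by simp
    finally show ?thesis by (simp add: Y_def q_def a_def algebra_simps)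
  qed
  then show ?thesis using Q size unfolding W_def by blast
qed

text \<open>Asking for exactly two neighbours lets every \<open>v \<in> R\<close> link at most one pair of pieces.\<close>
definition linked :: "('a \<Rightarrow> 'a \<Rightarrow> bool) \<Rightarrow> 'a set \<Rightarrow> ('i \<Rightarrow> 'a set) \<Rightarrow> 'i set \<Rightarrow> 'i \<Rightarrow> 'i \<Rightarrow> bool" where
  "linked adj R P I i j \<longleftrightarrow> i \<noteq> j \<and> (\<exists>v\<in>R. \<exists>x\<in>P i. \<exists>y\<in>P j. {z \<in> \<Union>(P ` I). adj z v} = {x, y})"

lemma linked_sym:
  assumes "linked adj R P I i j"
  shows "linked adj R P I j i"
proof -
  obtain v x y where v: "i \<noteq> j" "v \<in> R" "x \<in> P i" "y \<in> P j" "{z \<in> \<Union>(P ` I). adj z v} = {x, y}"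
    using assms unfolding linked_def by blast
  from v(5) have "{z \<in> \<Union>(P ` I). adj z v} = {y, x}" by (simp only: insert_commute)
  with v(1-4) show ?thesis unfolding linked_def by blast
qed

lemma card_linked_le:
  fixes P :: "'i \<Rightarrow> 'a set"
  assumes R: "finite R" and I: "finite I" "disjoint_family_on P I"
  shows "card {(i, j). i \<in> I \<and> j \<in> I \<and> linked adj R P I i j} \<le> 2 * card R"
proof -
  define T where "T = (\<lambda>v. {(i, j). i \<in> I \<and> j \<in> I \<and> i \<noteq> j \<and> (\<exists>x\<in>P i. \<exists>y\<in>P j. {z \<in> \<Union>(P ` I). adj z v} = {x, y})})"
  have two: "card {p, q} \<le> 2" for p q :: "'i \<times> 'i" by (simp add: card_insert_if)
  have T: "card (T v) \<le> 2" for v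
  proof (cases "T v = {}")
    case False
    then obtain i j x y where ij: "i \<in> I" "j \<in> I" "x \<in> P i" "y \<in> P j" "{z \<in> \<Union>(P ` I). adj z v} = {x, y}"
      unfolding T_def by blast
    have uniq: "i' = i''" if "i' \<in> I" "i'' \<in> I" "z \<in> P i'" "z \<in> P i''" for i' i'' z
      using I(2) that unfolding disjoint_family_on_def by blast
    have "T v \<subseteq> {(i, j), (j, i)}"
    proof
      fix p assume "p \<in> T v"
      then obtain i' j' x' y' where p: "p = (i', j')" "i' \<in> I" "j' \<in> I" "x' \<in> P i'" "y' \<in> P j'" "{x', y'} = {x, y}"
        using ij(5) unfolding T_def by auto
      from p(6) consider "x' = x" "y' = y" | "x' = y" "y' = x" by (auto simp: doubleton_eq_iff)
      then show "p \<in> {(i, j), (j, i)}"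
        by cases (use p ij uniq in blast)+
    qed
    then have "card (T v) \<le> card {(i, j), (j, i)}" by (rule card_mono[rotated]) simp
    also have "\<dots> \<le> 2" by (rule two)
    finally show ?thesis .
  qed simp
  have "{(i, j). i \<in> I \<and> j \<in> I \<and> linked adj R P I i j} = (\<Union>v\<in>R. T v)"
    by (auto simp: linked_def T_def)
  then have "card {(i, j). i \<in> I \<and> j \<in> I \<and> linked adj R P I i j} \<le> (\<Sum>v\<in>R. card (T v))"
    using card_UN_le[OF R] by simp
  also have "\<dots> \<le> (\<Sum>v\<in>R. 2)" by (intro sum_mono T)
  finally show ?thesis by simp
qed

lemma conn_UN:
  assumes B: "conn \<Gamma> B" and P: "\<And>i. i \<in> B \<Longrightarrow> conn adj (P i)"
    and link: "\<And>i j. i \<in> B \<Longrightarrow> j \<in> B \<Longrightarrow> \<Gamma> i j \<Longrightarrow> \<exists>x\<in>P i. \<exists>y\<in>P j. adj x y"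
  shows "conn adj (\<Union>(P ` B))"
proof -
  let ?U = "\<Union>(P ` B)"
  let ?R = "{(x, y). x \<in> ?U \<and> y \<in> ?U \<and> adj x y}\<^sup>*"
  have inner: "(u, v) \<in> ?R" if "i \<in> B" "u \<in> P i" "v \<in> P i" for i u v
    using conn_reach_mono[OF P[OF that(1)] that(2,3), of ?U] that(1) by blast
  have "(u, v) \<in> ?R" if "(i, j) \<in> {(i, j). i \<in> B \<and> j \<in> B \<and> \<Gamma> i j}\<^sup>*" "i \<in> B" "u \<in> P i" "v \<in> P j" for i j u v
    using that
  proof (induction arbitrary: v rule: rtrancl_induct)
    case base
    then show ?case using inner by blast
  next
    case (step j k)
    then obtain x y where xy: "x \<in> P j" "y \<in> P k" "adj x y" "j \<in> B" "k \<in> B" using link by blast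
    have "(u, x) \<in> ?R" using step xy by blast
    moreover have "(x, y) \<in> ?R" using xy by (intro r_into_rtrancl) auto
    moreover have "(y, v) \<in> ?R" using inner[of k y v] xy step.prems by blast
    ultimately show ?case by (meson rtrancl_trans)
  qed
  then have "\<forall>u\<in>?U. \<forall>v\<in>?U. (u, v) \<in> ?R" using B unfolding conn_def by blast
  moreover have "?U \<noteq> {}" using conn_nonempty[OF B] conn_nonempty[OF P] by blast
  ultimately show ?thesis unfolding conn_def by blast
qed

section \<open>From clique families to the Hadwiger number\<close>

lemma connected_induced_subgraph:
  assumes "B \<subseteq> verts H" "conn (\<lambda>x y. {x, y} \<in> edges H) B"
  shows "connected_graph (induced_subgraph H B)"
proof -
  have "{(x, y). {x, y} \<in> {e \<in> edges H. e \<subseteq> B}} = {(x, y). x \<in> B \<and> y \<in> B \<and> {x, y} \<in> edges H}" by auto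
  then show ?thesis using assms unfolding connected_graph_def induced_subgraph_def conn_def
    by (auto simp: Int_absorb1)
qed

lemma hadwiger_ge_card_clique_family:
  assumes fin: "finite (verts H)" and F: "finite F" "clique_family (\<lambda>x y. {x, y} \<in> edges H) (verts H) F"
  shows "card F \<le> hadwiger_number H"
proof -
  obtain B where B: "bij_betw B {..<card F} F"
    using ex_bij_betw_nat_finite[OF F(1)] unfolding atLeast0LessThan by blast
  have BF: "B x \<in> F" if "x < card F" for x using B that by (auto simp: bij_betw_def)
  have Bne: "B x \<noteq> B y" if "x < card F" "y < card F" "x \<noteq> y" for x y
    using B that by (auto simp: bij_betw_def inj_on_def)
  have "is_minor (complete_graph (card F)) H"
    unfolding is_minor_def
  proof (intro exI[of _ B] conjI)
    show "\<forall>x\<in>verts (complete_graph (card F)). B x \<subseteq> verts H \<and> connected_graph (induced_subgraph H (B x))"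
      using F(2) BF by (auto simp: complete_graph_def clique_family_def intro!: connected_induced_subgraph)
    show "disjoint_family_on B (verts (complete_graph (card F)))"
      using F(2) BF Bne unfolding disjoint_family_on_def complete_graph_def clique_family_def by auto
    show "\<forall>x\<in>verts (complete_graph (card F)). \<forall>y\<in>verts (complete_graph (card F)).
      {x, y} \<in> edges (complete_graph (card F)) \<longrightarrow> (\<exists>u\<in>B x. \<exists>v\<in>B y. {u, v} \<in> edges H)"
    proof (intro ballI impI)
      fix x y assume "x \<in> verts (complete_graph (card F))" "y \<in> verts (complete_graph (card F))"
        "{x, y} \<in> edges (complete_graph (card F))"
      then have "x < card F" "y < card F" "x \<noteq> y" by (auto simp: complete_graph_def nsets_def)
      then have "B x \<in> F" "B y \<in> F" "B x \<noteq> B y" by (auto intro: BF dest: Bne)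
      then show "\<exists>u\<in>B x. \<exists>v\<in>B y. {u, v} \<in> edges H"
        using F(2) by (simp add: clique_family_def)
    qed
  qed
  then show ?thesis unfolding hadwiger_number_def
    using finite_complete_minors[OF fin] by (intro Max_ge) auto
qed

text \<open>Every linking vertex \<open>v \<in> R\<close> is contracted into one of the two pieces it links.\<close>
lemma hadwiger_ge_linked_clique_family:
  fixes H :: "'a graph"
  defines "adj \<equiv> (\<lambda>x y. {x, y} \<in> edges H)"
  assumes lnk: "\<And>x v. lnk x v \<Longrightarrow> {x, v} \<in> edges H" and fin: "finite (verts H)" and R: "R \<subseteq> verts H"
    and P: "\<And>i. i \<in> I \<Longrightarrow> P i \<subseteq> verts H" "\<And>i. i \<in> I \<Longrightarrow> conn adj (P i)" "disjoint_family_on P I"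
    and PR: "\<And>i. i \<in> I \<Longrightarrow> P i \<inter> R = {}"
    and F: "finite F" "clique_family (linked lnk R P I) I F"
  shows "card F \<le> hadwiger_number H"
proof -
  define S where "S = (\<lambda>v. {z \<in> \<Union>(P ` I). lnk z v})"
  \<comment> \<open>Fixed once per vertex, so that the enlarged pieces stay disjoint; whichever
    piece it is, the link to the other one survives as an edge. The value is arbitrary if
    \<open>S v\<close> is empty, a case that \<open>P'\<close> excludes.\<close>
  define owner where "owner = (\<lambda>v. SOME i. i \<in> I \<and> P i \<inter> S v \<noteq> {})"
  have owner: "owner v \<in> I \<and> P (owner v) \<inter> S v \<noteq> {}" if "S v \<noteq> {}" for v
    unfolding owner_def by (rule someI_ex) (use that in \<open>auto simp: S_def\<close>)
  define P' where "P' = (\<lambda>i. P i \<union> {v \<in> R. S v \<noteq> {} \<and> owner v = i})"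
  have uniq: "i = j" if "i \<in> I" "j \<in> I" "z \<in> P i" "z \<in> P j" for i j z
    using P(3) that unfolding disjoint_family_on_def by blast
  have la: "lnk x v \<Longrightarrow> adj x v" for x v using lnk by (simp add: adj_def)
  have sym: "adj x y \<Longrightarrow> adj y x" for x y by (simp add: adj_def insert_commute)
  have P'V: "P' i \<subseteq> verts H" if "i \<in> I" for i using P(1)[OF that] R by (auto simp: P'_def)
  have P'disj: "P' i \<inter> P' j = {}" if "i \<in> I" "j \<in> I" "i \<noteq> j" for i j
    using that PR uniq by (fastforce simp: P'_def)
  have fR: "finite R" using R fin finite_subset by blast
  have P'conn: "conn adj (P' i)" if i: "i \<in> I" for i
  proof -
    have "conn adj (P i \<union> A)" if "finite A" "A \<subseteq> {v \<in> R. S v \<noteq> {} \<and> owner v = i}" for A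
      using that
    proof (induction rule: finite_induct)
      case empty
      then show ?case using P(2)[OF i] by simp
    next
      case (insert v A)
      then obtain x where x: "x \<in> P i" "adj x v" using owner[of v] la by (auto simp: S_def)
      then have "conn adj (insert v (P i \<union> A))" using insert sym by (intro conn_insert[of _ _ x]) auto
      then show ?case by simp
    qed
    from this[of "{v \<in> R. S v \<noteq> {} \<and> owner v = i}"] show ?thesis using fR by (simp add: P'_def)
  qed
  have link: "\<exists>x\<in>P' i. \<exists>y\<in>P' j. adj x y" if ij: "i \<in> I" "j \<in> I" "linked lnk R P I i j" for i j
  proof -
    obtain v x y where v: "v \<in> R" "x \<in> P i" "y \<in> P j" "S v = {x, y}"
      using ij(3) unfolding linked_def S_def by blast
    then have "lnk x v" "lnk y v" unfolding S_def by blast+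
    then have adjv: "adj x v" "adj y v" by (simp_all add: la)
    have "owner v \<in> I" "P (owner v) \<inter> {x, y} \<noteq> {}" using owner[of v] v by auto
    then have "owner v = i \<or> owner v = j" using uniq v ij by blast
    then show ?thesis
    proof
      assume "owner v = i"
      then have "v \<in> P' i" "y \<in> P' j" using v by (auto simp: P'_def)
      then show ?thesis using adjv sym by blast
    next
      assume "owner v = j"
      then have "v \<in> P' j" "x \<in> P' i" using v by (auto simp: P'_def)
      then show ?thesis using adjv sym by blast
    qed
  qed
  define h where "h = (\<lambda>B. \<Union>(P' ` B))"
  have FI: "B \<subseteq> I" "conn (linked lnk R P I) B" if "B \<in> F" for B
    using F(2) that by (auto simp: clique_family_def)
  have hconn: "conn adj (h B)" if "B \<in> F" for B
    unfolding h_def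
  proof (rule conn_UN[OF FI(2)[OF that]])
    show "conn adj (P' i)" if "i \<in> B" for i using P'conn FI(1)[OF \<open>B \<in> F\<close>] that by blast
    show "\<exists>x\<in>P' i. \<exists>y\<in>P' j. adj x y" if "i \<in> B" "j \<in> B" "linked lnk R P I i j" for i j
      using link FI(1)[OF \<open>B \<in> F\<close>] that by blast
  qed
  have hdisj: "h B \<inter> h C = {}" if "B \<in> F" "C \<in> F" "B \<noteq> C" for B C
  proof -
    have "B \<inter> C = {}" using F(2) that by (auto simp: clique_family_def)
    then have "P' i \<inter> P' j = {}" if "i \<in> B" "j \<in> C" for i j
      using P'disj[of i j] that FI(1)[OF \<open>B \<in> F\<close>] FI(1)[OF \<open>C \<in> F\<close>] by blast
    then show ?thesis by (auto simp: h_def)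
  qed
  have hadj: "\<exists>x\<in>h B. \<exists>y\<in>h C. adj x y" if BC: "B \<in> F" "C \<in> F" "B \<noteq> C" for B C
  proof -
    have "\<exists>x\<in>B. \<exists>y\<in>C. linked lnk R P I x y" using F(2) BC by (simp add: clique_family_def)
    then obtain i j where ij: "i \<in> B" "j \<in> C" "linked lnk R P I i j" by blast
    have "i \<in> I" "j \<in> I" using FI(1) BC ij by auto
    then obtain x y where "x \<in> P' i" "y \<in> P' j" "adj x y" using link[OF _ _ ij(3)] by blast
    then show ?thesis using ij unfolding h_def by blast
  qed
  have inj: "inj_on h F"
  proof (rule inj_onI, rule ccontr)
    fix B C assume "B \<in> F" "C \<in> F" "h B = h C" "B \<noteq> C"
    then have "h B = {}" using hdisj[of B C] by simp
    then show False using conn_nonempty[OF hconn[OF \<open>B \<in> F\<close>]] by simp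
  qed
  have "clique_family adj (verts H) (h ` F)"
    unfolding clique_family_def
  proof (intro conjI ballI impI)
    fix A assume "A \<in> h ` F"
    then obtain B where B: "A = h B" "B \<in> F" by blast
    show "conn adj A" unfolding B(1) by (rule hconn[OF B(2)])
    show "A \<subseteq> verts H" unfolding B(1) h_def using P'V FI(1)[OF B(2)] by blast
    fix C assume "C \<in> h ` F" "A \<noteq> C"
    then obtain D where D: "C = h D" "D \<in> F" "B \<noteq> D" using B(1) by blast
    show "A \<inter> C = {}" unfolding B(1) D(1) by (rule hdisj[OF B(2) D(2,3)])
    show "\<exists>x\<in>A. \<exists>y\<in>C. adj x y" unfolding B(1) D(1) by (rule hadj[OF B(2) D(2,3)])
  qed
  then have "card (h ` F) \<le> hadwiger_number H"
    using F(1) fin unfolding adj_def by (intro hadwiger_ge_card_clique_family) auto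
  then show ?thesis using card_image[OF inj] by simp
qed

text \<open>There are at most \<open>2 * card R\<close> ordered links, so at most
  \<open>\<eta> * N / 2\<close> pieces have more than \<open>\<Delta>\<close> of them. Deleting
  these gives bounded degree. Put into the separator, they use up half of \<open>\<eta>\<close>;
  since at least half of the pieces remain, the factor 8 becomes 16.\<close>

lemma hadwiger_ge_of_linked_cuts:
  fixes H :: "'a graph" and P :: "'i \<Rightarrow> 'a set" and \<eta> :: real and \<Delta> t :: nat
  defines "adj \<equiv> (\<lambda>x y. {x, y} \<in> edges H)"
  assumes lnk: "\<And>x v. lnk x v \<Longrightarrow> {x, v} \<in> edges H" and fin: "finite (verts H)" and R: "R \<subseteq> verts H"
    and P: "\<And>i. i \<in> I \<Longrightarrow> P i \<subseteq> verts H" "\<And>i. i \<in> I \<Longrightarrow> conn adj (P i)" "disjoint_family_on P I"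
    and PR: "\<And>i. i \<in> I \<Longrightarrow> P i \<inter> R = {}"
    and Q: "finite I" "Q \<subseteq> I" "Q \<noteq> {}"
    and eta: "0 < \<eta>" "\<eta> \<le> 1 / 8" and Delta: "4 * card R \<le> \<eta> * card Q * \<Delta>" "\<Delta> > 0"
    and cut: "\<And>X Y. X \<subseteq> Q \<Longrightarrow> Y \<subseteq> Q \<Longrightarrow> X \<inter> Y = {} \<Longrightarrow> card Q \<le> 16 * card X \<Longrightarrow> card Q \<le> 16 * card Y
      \<Longrightarrow> card (Q - X - Y) \<le> \<eta> * card Q \<Longrightarrow> \<exists>i\<in>X. \<exists>j\<in>Y. linked lnk R P I i j"
    and t: "t * minor_const (\<eta> / 2) \<Delta> \<le> sqrt (card Q / 2)"
  shows "t \<le> hadwiger_number H"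
proof -
  let ?\<Gamma> = "linked lnk R P I"
  define N where "N = card Q"
  have fQ: "finite Q" using Q finite_subset by blast
  have N: "N > 0" using Q(3) fQ by (simp add: N_def card_gt_0_iff)
  have fR: "finite R" using R fin finite_subset by blast
  define Z where "Z = {i\<in>Q. card {j\<in>Q. ?\<Gamma> i j} > \<Delta>}"
  have fZ: "finite Z" using fQ by (simp add: Z_def)
  have "card Z * \<Delta> = (\<Sum>i\<in>Z. \<Delta>)" by simp
  also have "\<dots> \<le> (\<Sum>i\<in>Z. card {j\<in>Q. ?\<Gamma> i j})" by (intro sum_mono) (simp add: Z_def)
  also have "\<dots> = card (SIGMA i:Z. {j\<in>Q. ?\<Gamma> i j})" using fZ fQ by (simp add: card_SigmaI)
  also have "\<dots> \<le> card {(i, j). i \<in> I \<and> j \<in> I \<and> ?\<Gamma> i j}"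
  proof (rule card_mono)
    show "finite {(i, j). i \<in> I \<and> j \<in> I \<and> ?\<Gamma> i j}"
      by (rule finite_subset[of _ "I \<times> I"]) (use Q in auto)
  qed (use Q in \<open>auto simp: Z_def\<close>)
  also have "\<dots> \<le> 2 * card R" by (rule card_linked_le[OF fR Q(1) P(3)])
  finally have "2 * (real (card Z) * \<Delta>) \<le> 4 * card R" by (simp flip: of_nat_mult)
  also have "\<dots> \<le> \<eta> * N * \<Delta>" using Delta by (simp add: N_def)
  finally have Z: "card Z \<le> \<eta> * N / 2" using Delta(2) by simp
  have etaN: "\<eta> * N \<le> N / 8" using eta N by simp
  define Q' where "Q' = Q - Z"
  have fQ': "finite Q'" using fQ by (simp add: Q'_def)
  have "N = card Q' + card Z" unfolding N_def Q'_def using fQ fZ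
    by (subst card_Diff_subset) (auto simp: Z_def card_mono)
  then have N': "real N \<le> 2 * card Q'" "card Q' \<le> N" using Z etaN by linarith+
  have "\<exists>F. card F = t \<and> clique_family ?\<Gamma> Q' F"
  proof (rule clique_family_of_no_sparse_cut[where \<eta> = "\<eta> / 2"])
    show "Q' \<noteq> {}" using N' N by auto
    show "card {j \<in> Q'. ?\<Gamma> i j} \<le> \<Delta>" if "i \<in> Q'" for i
    proof -
      have "card {j \<in> Q'. ?\<Gamma> i j} \<le> card {j \<in> Q. ?\<Gamma> i j}" using fQ by (intro card_mono) (auto simp: Q'_def)
      then show ?thesis using that by (auto simp: Q'_def Z_def)
    qed
    have "sqrt (card Q / 2) \<le> sqrt (card Q')" using N' by (simp add: N_def)
    then show "t * minor_const (\<eta> / 2) \<Delta> \<le> sqrt (card Q')" using t by linarith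
    fix X Y assume XY: "X \<subseteq> Q'" "Y \<subseteq> Q'" "X \<inter> Y = {}" "card Q' \<le> 8 * card X" "card Q' \<le> 8 * card Y"
      "card (Q' - X - Y) \<le> \<eta> / 2 * card Q'"
    have "Q - X - Y \<subseteq> Z \<union> (Q' - X - Y)" by (auto simp: Q'_def)
    then have "card (Q - X - Y) \<le> card (Z \<union> (Q' - X - Y))" using fZ fQ' by (intro card_mono) auto
    also have "\<dots> \<le> card Z + card (Q' - X - Y)" by (rule card_Un_le)
    finally have "real (card (Q - X - Y)) \<le> \<eta> * N / 2 + \<eta> / 2 * card Q'" using Z XY(6) by linarith
    also have "\<dots> \<le> \<eta> * N / 2 + \<eta> / 2 * N" using N'(2) eta by (intro add_mono mult_left_mono) auto
    finally have "real (card (Q - X - Y)) \<le> \<eta> * card Q" by (simp add: N_def)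
    moreover have "N \<le> 2 * card Q'" using N'(1) by linarith
    ultimately show "\<exists>x\<in>X. \<exists>y\<in>Y. ?\<Gamma> x y" using XY by (intro cut) (auto simp: Q'_def N_def)
  qed (use fQ' Delta eta linked_sym in auto)
  then obtain F where F: "card F = t" "clique_family ?\<Gamma> Q' F" by blast
  have "F \<subseteq> Pow Q'" using F by (auto simp: clique_family_def)
  then have fF: "finite F" using fQ' by (meson finite_Pow_iff finite_subset)
  have "clique_family ?\<Gamma> I F" using clique_family_subset[OF F(2), of F I] F(2) Q(2)
    by (auto simp: clique_family_def Q'_def)
  then have "card F \<le> hadwiger_number H"
    using lnk fin R P PR fF unfolding adj_def by (intro hadwiger_ge_linked_clique_family) auto
  then show ?thesis using F by simp
qed

section \<open>Depth-first search in a random subgraph\<close>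

abbreviation bernoulli_edges :: "'e set \<Rightarrow> real \<Rightarrow> ('e \<Rightarrow> bool) pmf" where
  "bernoulli_edges E p \<equiv> Pi_pmf E False (\<lambda>_. bernoulli_pmf p)"

lemma prob_bind_pmf:
  "measure_pmf.prob (bind_pmf M N) X = measure_pmf.expectation M (\<lambda>x. measure_pmf.prob (N x) X)"
proof -
  have int: "integrable M (\<lambda>x. measure_pmf.prob (N x) X)"
    by (rule measure_pmf.integrable_const_bound[where B = 1]) auto
  have "ennreal (measure_pmf.prob (bind_pmf M N) X) = (\<integral>\<^sup>+x. ennreal (measure_pmf.prob (N x) X) \<partial>M)"
    by (simp flip: measure_pmf.emeasure_eq_measure)
  also have "\<dots> = ennreal (measure_pmf.expectation M (\<lambda>x. measure_pmf.prob (N x) X))"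
    by (rule nn_integral_eq_integral[OF int]) simp
  finally show ?thesis by (simp add: Bochner_Integration.integral_nonneg)
qed

lemma prob_bernoulli_edges_split:
  assumes "finite E" "e \<in> E" "0 \<le> p" "p \<le> 1"
  shows "measure_pmf.prob (bernoulli_edges E p) {f. Q f} =
    p * measure_pmf.prob (bernoulli_edges (E - {e}) p) {f. Q (f(e := True))} +
    (1 - p) * measure_pmf.prob (bernoulli_edges (E - {e}) p) {f. Q (f(e := False))}"
proof -
  have "bernoulli_edges (insert e (E - {e})) p =
      do {y \<leftarrow> bernoulli_pmf p; map_pmf (\<lambda>f. f(e := y)) (bernoulli_edges (E - {e}) p)}"
    using assms by (subst Pi_pmf_insert') (auto simp: map_pmf_def)
  moreover have "insert e (E - {e}) = E" using assms by auto
  ultimately have "measure_pmf.prob (bernoulli_edges E p) {f. Q f} =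
      measure_pmf.expectation (bernoulli_pmf p)
        (\<lambda>y. measure_pmf.prob (map_pmf (\<lambda>f. f(e := y)) (bernoulli_edges (E - {e}) p)) {f. Q f})"
    by (simp add: prob_bind_pmf)
  also have "\<dots> = p * measure_pmf.prob (bernoulli_edges (E - {e}) p) {f. Q (f(e := True))} +
    (1 - p) * measure_pmf.prob (bernoulli_edges (E - {e}) p) {f. Q (f(e := False))}"
    using assms by (simp add: vimage_def)
  finally show ?thesis .
qed

definition has_path :: "'a set \<Rightarrow> nat \<Rightarrow> 'a set set \<Rightarrow> bool" where
  "has_path V l F \<longleftrightarrow> (\<exists>us. length us = l \<and> distinct us \<and> set us \<subseteq> V \<and> successively (\<lambda>u w. {u, w} \<in> F) us)"

text \<open>A stage of depth-first search: \<open>S\<close> is the set of finished vertices and \<open>us\<close> the current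
  path (the stack); \<open>A\<close> and \<open>B\<close> are the edges queried so far that turned out to be present and absent.\<close>
definition dfs_state :: "'a set \<Rightarrow> 'a set set \<Rightarrow> nat \<Rightarrow> nat \<Rightarrow> 'a set \<Rightarrow> 'a list \<Rightarrow> 'a set set \<Rightarrow> 'a set set \<Rightarrow> bool" where
  "dfs_state V E m l S us A B \<longleftrightarrow>
     A \<subseteq> E \<and> B \<subseteq> E \<and> A \<inter> B = {} \<and> S \<subseteq> V \<and> set us \<subseteq> V \<and> S \<inter> set us = {} \<and> distinct us \<and>
     successively (\<lambda>u w. {u, w} \<in> A) us \<and> length us \<le> l \<and> card S + length us \<le> m \<and>
     card A \<le> card S + length us \<and> (\<forall>e\<in>A. e \<subseteq> S \<union> set us) \<and>
     (\<forall>v\<in>S. \<forall>w\<in>V - S - set us. {v, w} \<in> E \<longrightarrow> {v, w} \<in> B)"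

text \<open>Along the search, \<open>x ^ card A * y ^ card B\<close> is a supermartingale. When \<open>m\<close> vertices have been reached
  without a path on \<open>l\<close> vertices, all edges from \<open>S\<close> to the unreached vertices have been queried and are absent,
  which makes \<open>B\<close> so large that \<open>C * x ^ card A * y ^ card B \<ge> 1\<close>.\<close>
lemma dfs_failure_prob:
  fixes k C x y p :: real
  assumes finV: "finite V" and E: "E \<subseteq> nsets V 2"
    and deg: "\<And>v. v \<in> V \<Longrightarrow> k \<le> card {w\<in>V. {v, w} \<in> E}"
    and p: "0 \<le> p" "p \<le> 1" and xy: "0 \<le> x" "0 \<le> y" "p * x + (1 - p) * y \<le> 1" and C: "0 \<le> C"
    and m: "m < card V" "real m \<le> k" and l: "0 < l"
    and final: "\<And>a b :: nat. a \<le> m \<Longrightarrow> (real m - real l) * (k - m) \<le> b \<Longrightarrow> 1 \<le> C * x ^ a * y ^ b"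
    and st: "dfs_state V E m l S us A B"
  shows "measure_pmf.prob (bernoulli_edges (E - A - B) p) {f. \<not> has_path V l (A \<union> ({e. f e} \<inter> (E - A - B)))}
     \<le> C * x ^ card A * y ^ card B"
  using st
\<comment> \<open>A query lowers the number of unqueried edges. Pushing a root lowers the second
  summand by one, and so does popping, since finishing a vertex lowers
  \<open>2 * card (V - S)\<close> by two. By \<open>lenus\<close> the subtraction is not
  truncated.\<close>
proof (induction "card (E - A - B) + (2 * card (V - S) - length us)" arbitrary: S us A B rule: less_induct)
  case less
  have st: "A \<subseteq> E" "B \<subseteq> E" "A \<inter> B = {}" "S \<subseteq> V" "set us \<subseteq> V" "S \<inter> set us = {}" "distinct us"
    "successively (\<lambda>u w. {u, w} \<in> A) us" "length us \<le> l" "card S + length us \<le> m"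
    "card A \<le> card S + length us" "\<forall>e\<in>A. e \<subseteq> S \<union> set us"
    "\<forall>v\<in>S. \<forall>w\<in>V - S - set us. {v, w} \<in> E \<longrightarrow> {v, w} \<in> B"
    using less.prems by (simp_all add: dfs_state_def)
  let ?P = "\<lambda>A B. measure_pmf.prob (bernoulli_edges (E - A - B) p) {f. \<not> has_path V l (A \<union> ({e. f e} \<inter> (E - A - B)))}"
  have finE: "finite E" by (rule finite_subset[OF E]) (rule finite_imp_finite_nsets[OF finV])
  have fin: "finite S" "finite A" "finite B"
    by (rule finite_subset[OF st(4) finV], rule finite_subset[OF st(1) finE], rule finite_subset[OF st(2) finE])
  have rhs0: "0 \<le> C * x ^ card A * y ^ card B" using xy(1,2) C by (intro mult_nonneg_nonneg zero_le_power)
  have lenus: "length us \<le> card (V - S)"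
  proof -
    have "card (set us) \<le> card (V - S)" using st(5,6) finV by (intro card_mono) auto
    then show ?thesis using st(7) by (simp add: distinct_card)
  qed
  define T where "T = V - S - set us"
  show ?case
  proof (cases "length us = l")
    case True
    have "has_path V l F" if "A \<subseteq> F" for F
      unfolding has_path_def
    proof (intro exI[of _ us] conjI)
      show "successively (\<lambda>u w. {u, w} \<in> F) us" by (rule successively_mono[OF st(8)]) (use that in blast)
    qed (use True st(5,7) in auto)
    then have "{f. \<not> has_path V l (A \<union> ({e. f e} \<inter> (E - A - B)))} = {}" by auto
    then show ?thesis using rhs0 by simp
  next
    case lt: False
    show ?thesis
    proof (cases "card S + length us = m")
      case True
      have fT: "finite T" using finV by (simp add: T_def)
      \<comment> \<open>Only \<open>m\<close> vertices are reached, so a finished vertex has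
        \<open>k - m\<close> neighbours outside. The stack is no longer than \<open>l\<close>, so at
        least \<open>m - l\<close> vertices are finished.\<close>
      have dT: "k - m \<le> card {w\<in>T. {v, w} \<in> E}" if v: "v \<in> S" for v
      proof -
        have "{w\<in>V. {v, w} \<in> E} \<subseteq> {w\<in>T. {v, w} \<in> E} \<union> (S \<union> set us)" by (auto simp: T_def)
        then have "card {w\<in>V. {v, w} \<in> E} \<le> card ({w\<in>T. {v, w} \<in> E} \<union> (S \<union> set us))"
          using fT fin by (intro card_mono) auto
        also have "\<dots> \<le> card {w\<in>T. {v, w} \<in> E} + card (S \<union> set us)" by (rule card_Un_le)
        also have "card (S \<union> set us) \<le> m" using card_Un_le[of S "set us"] True st(7) by (simp add: distinct_card)
        finally have "real (card {w\<in>V. {v, w} \<in> E}) \<le> card {w\<in>T. {v, w} \<in> E} + m" by simp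
        moreover have "v \<in> V" using v st(4) by blast
        ultimately show ?thesis using deg[of v] by linarith
      qed
      have "card (SIGMA v:S. {w\<in>T. {v, w} \<in> E}) \<le> card B"
      proof (rule card_inj_on_le)
        show "inj_on (\<lambda>(v, w). {v, w}) (SIGMA v:S. {w\<in>T. {v, w} \<in> E})"
          by (auto simp: inj_on_def T_def doubleton_eq_iff)
        show "(\<lambda>(v, w). {v, w}) ` (SIGMA v:S. {w\<in>T. {v, w} \<in> E}) \<subseteq> B"
          using st(13) by (auto simp: T_def)
      qed (rule fin)
      then have "(\<Sum>v\<in>S. real (card {w\<in>T. {v, w} \<in> E})) \<le> card B"
        using fin fT by (simp add: card_SigmaI flip: of_nat_sum)
      moreover have "(\<Sum>v\<in>S. k - m) \<le> (\<Sum>v\<in>S. real (card {w\<in>T. {v, w} \<in> E}))" by (rule sum_mono[OF dT])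
      moreover have "(real m - real l) * (k - m) \<le> real (card S) * (k - m)"
        using True st(9) m(2) by (intro mult_right_mono) auto
      ultimately have "(real m - real l) * (k - m) \<le> card B" by simp
      moreover have "card A \<le> m" using st(11) True by simp
      ultimately have "1 \<le> C * x ^ card A * y ^ card B" by (intro final)
      then show ?thesis using measure_pmf.prob_le_1 order_trans by blast
    next
      case lm: False
      show ?thesis
      proof (cases us)
        case Nil
        have "card S < card V" using st(10) m(1) by linarith
        then have "S \<noteq> V" by auto
        then obtain v where v: "v \<in> V" "v \<notin> S" using st(4) by blast
        have "dfs_state V E m l S [v] A B"
          unfolding dfs_state_def using st v lm l Nil by auto
        moreover have "card (V - S) \<ge> 1" using v finV by (metis Diff_iff One_nat_def Suc_leI card_gt_0_iff empty_iff finite_Diff)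
        ultimately show ?thesis using less.hyps[of A B S "[v]"] Nil by simp
      next
        case (Cons v vs)
        show ?thesis
        proof (cases "\<exists>w\<in>T. {v, w} \<in> E - A - B")
          case True
          then obtain w where w: "w \<in> T" "{v, w} \<in> E - A - B" by blast
          define e where "e = {v, w}"
          have e: "e \<in> E" "e \<notin> A" "e \<notin> B" using w by (auto simp: e_def)
          define X where "X = E - A - B"
          have X: "E - insert e A - B = X - {e}" "E - A - insert e B = X - {e}" "e \<in> X" "finite X"
            using e finE by (auto simp: X_def)
          have cX: "card (X - {e}) < card X" using X by (intro card_Diff1_less) auto
          have "dfs_state V E m l S (w # us) (insert e A) B"
            unfolding dfs_state_def
          proof (intro conjI)
            show "successively (\<lambda>u w. {u, w} \<in> insert e A) (w # us)"
            proof -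
              have "successively (\<lambda>u w. {u, w} \<in> insert e A) us" by (rule successively_mono[OF st(8)]) blast
              then show ?thesis using Cons by (simp add: e_def insert_commute)
            qed
            show "card (insert e A) \<le> card S + length (w # us)" using st(11) fin by (simp add: card_insert_if)
            show "\<forall>v\<in>S. \<forall>wa\<in>V - S - set (w # us). {v, wa} \<in> E \<longrightarrow> {v, wa} \<in> B" using st(13) by auto
          qed (use st(1-7,9-12) e w lt lm Cons in \<open>auto simp: T_def e_def\<close>)
          then have 1: "?P (insert e A) B \<le> C * x ^ card (insert e A) * y ^ card B"
            using cX X by (intro less.hyps[of _ _ S "w # us"]) (auto simp: X_def)
          have "dfs_state V E m l S us A (insert e B)"
            unfolding dfs_state_def using st e by auto
          then have 2: "?P A (insert e B) \<le> C * x ^ card A * y ^ card (insert e B)"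
            using cX X by (intro less.hyps[of _ _ S us]) (auto simp: X_def)
          have sets: "{f. \<not> has_path V l (A \<union> ({e'. (f(e := True)) e'} \<inter> X))}
              = {f. \<not> has_path V l (insert e A \<union> ({e. f e} \<inter> (X - {e})))}"
            "{f. \<not> has_path V l (A \<union> ({e'. (f(e := False)) e'} \<inter> X))}
              = {f. \<not> has_path V l (A \<union> ({e. f e} \<inter> (X - {e})))}"
          proof -
            have "A \<union> ({e'. (f(e := True)) e'} \<inter> X) = insert e A \<union> ({e. f e} \<inter> (X - {e}))"
              "A \<union> ({e'. (f(e := False)) e'} \<inter> X) = A \<union> ({e. f e} \<inter> (X - {e}))" for f
              using X(3) by auto
            then show "{f. \<not> has_path V l (A \<union> ({e'. (f(e := True)) e'} \<inter> X))}
              = {f. \<not> has_path V l (insert e A \<union> ({e. f e} \<inter> (X - {e})))}"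
              "{f. \<not> has_path V l (A \<union> ({e'. (f(e := False)) e'} \<inter> X))}
              = {f. \<not> has_path V l (A \<union> ({e. f e} \<inter> (X - {e})))}" by (simp_all only:)
          qed
          \<comment> \<open>Revealing \<open>e\<close> multiplies the potential by \<open>x\<close>
            or by \<open>y\<close>, with mean at most 1.\<close>
          have "?P A B = p * ?P (insert e A) B + (1 - p) * ?P A (insert e B)"
            unfolding X X_def[symmetric]
            by (subst prob_bernoulli_edges_split[OF X(4,3) p]) (simp only: sets)
          also have "\<dots> \<le> p * (C * x ^ card (insert e A) * y ^ card B) + (1 - p) * (C * x ^ card A * y ^ card (insert e B))"
            using 1 2 p by (intro add_mono mult_left_mono) auto
          also have "\<dots> = (C * x ^ card A * y ^ card B) * (p * x + (1 - p) * y)"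
            using e fin by (simp add: algebra_simps)
          also have "\<dots> \<le> (C * x ^ card A * y ^ card B) * 1" using xy rhs0 by (intro mult_left_mono) auto
          finally show ?thesis by simp
        next
          case False
          have vS: "v \<notin> S" "v \<in> V" "v \<notin> set vs" using st(4-7) Cons by auto
          have "dfs_state V E m l (insert v S) vs A B"
            unfolding dfs_state_def
          proof (intro conjI)
            show "\<forall>u\<in>insert v S. \<forall>w\<in>V - insert v S - set vs. {u, w} \<in> E \<longrightarrow> {u, w} \<in> B"
            proof (intro ballI impI)
              fix u w assume u: "u \<in> insert v S" "w \<in> V - insert v S - set vs" "{u, w} \<in> E"
              then have wT: "w \<in> T" using Cons by (auto simp: T_def)
              show "{u, w} \<in> B"
              proof (cases "u = v")
                case True
                \<comment> \<open>Present edges join reached vertices, so a queried edge from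
                  \<open>v\<close> to an unreached vertex must be absent.\<close>
                have "{v, w} \<notin> A" using st(12) wT by (auto simp: T_def)
                then show ?thesis using False wT u True by blast
              next
                case False
                then show ?thesis using u wT st(13) by (auto simp: T_def)
              qed
            qed
            show "successively (\<lambda>u w. {u, w} \<in> A) vs" using st(8) Cons by (cases vs) auto
          qed (use st(1-7,9-12) Cons vS fin in auto)
          moreover have "2 * card (V - insert v S) - length vs < 2 * card (V - S) - length us"
          proof -
            have "V - S = insert v (V - insert v S)" using vS by auto
            then have "card (V - S) = Suc (card (V - insert v S))"
              using finV by (metis card_insert_disjoint finite_Diff DiffE insertI1)
            then show ?thesis using Cons lenus by simp
          qed
          ultimately show ?thesis by (intro less.hyps[of A B "insert v S" vs]) auto
        qed
      qed
    qed
  qed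
qed

text \<open>Exponential-moment bound with \<open>x = 1 - \<xi>\<close> and \<open>y = 1 + z\<close>,
  where \<open>z \<le> p * \<xi>\<close> gives the supermartingale. A failed search has seen at most
  \<open>m\<close> present edges but close to \<open>m * k\<close> absent ones, among which about
  \<open>(1 + e) * m\<close> present ones would be expected.\<close>

lemma path_failure_prob:
  fixes k p e :: real
  assumes finV: "finite V" and E: "E \<subseteq> nsets V 2"
    and deg: "\<And>v. v \<in> V \<Longrightarrow> k \<le> card {w\<in>V. {v, w} \<in> E}"
    and e: "0 < e" "e \<le> 1" and k: "k \<ge> 2" and p: "(1 + e) / k \<le> p" "p \<le> 1"
    and m: "m < card V" "real m \<le> e / 8 * k" and l: "0 < l" "real l \<le> e / 8 * m"
  shows "measure_pmf.prob (bernoulli_edges E p) {f. \<not> has_path V l ({e. f e} \<inter> E)} \<le> exp (- (e\<^sup>2 / 128 * m))"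
proof -
  \<comment> \<open>With this value \<open>\<xi> * (e / 4)\<close> exceeds the quadratic error
    \<open>2 * \<xi>\<^sup>2\<close> by exactly \<open>e\<^sup>2 / 128\<close>, the rate in the
    claim.\<close>
  define \<xi> where "\<xi> = e / 16"
  define z where "z = (1 + e) * \<xi> / k"
  have xi: "0 < \<xi>" "\<xi> \<le> 1 / 16" using e by (auto simp: \<xi>_def)
  have z: "0 < z" "z \<le> p * \<xi>" "z \<le> e / 8"
  proof -
    show "0 < z" using e k xi by (simp add: z_def)
    have "z = (1 + e) / k * \<xi>" by (simp add: z_def)
    also have "\<dots> \<le> p * \<xi>" using p xi by (intro mult_right_mono) auto
    finally show "z \<le> p * \<xi>" .
    also have "\<dots> \<le> 1 * \<xi>" using p xi by (intro mult_right_mono) auto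
    finally show "z \<le> e / 8" using e by (simp add: \<xi>_def)
  qed
  have p0: "0 \<le> p" using p e k by (meson add_nonneg_nonneg divide_nonneg_nonneg less_imp_le order_trans zero_le_one zero_le_numeral)
  define C where "C = exp (- (e\<^sup>2 / 128 * m))"
  have mk: "real m \<le> k" using m(2) e k by (smt (verit) mult_le_cancel_right2 divide_le_eq_1)
  have lm: "real l \<le> m"
  proof -
    have "e / 8 * m \<le> 1 * real m" using e by (intro mult_right_mono) auto
    then show ?thesis using l(2) by linarith
  qed
  have "measure_pmf.prob (bernoulli_edges (E - {} - {}) p) {f. \<not> has_path V l ({} \<union> ({e. f e} \<inter> (E - {} - {})))}
     \<le> C * (1 - \<xi>) ^ card ({} :: 'a set set) * (1 + z) ^ card ({} :: 'a set set)"
  proof (rule dfs_failure_prob[OF finV E deg p0 p(2)])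
    have "p * (1 - \<xi>) + (1 - p) * (1 + z) = 1 + (z - p * \<xi>) - p * z" by (simp add: algebra_simps)
    also have "\<dots> \<le> 1" using z p0 by (simp add: mult_nonneg_nonneg add_nonpos_nonpos) (smt (verit) mult_nonneg_nonneg)
    finally show "p * (1 - \<xi>) + (1 - p) * (1 + z) \<le> 1" .
    show "dfs_state V E m l {} [] {} {}" by (simp add: dfs_state_def)
    fix a b :: nat assume a: "a \<le> m" and b: "(real m - real l) * (k - m) \<le> b"
    have "exp (- (\<xi> + 2 * \<xi>\<^sup>2)) \<le> 1 - \<xi>"
      using ln_one_minus_pos_lower_bound[of \<xi>] xi by (simp add: ln_ge_iff)
    then have "exp (- (\<xi> + 2 * \<xi>\<^sup>2)) ^ m \<le> (1 - \<xi>) ^ m" by (intro power_mono) auto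
    also have "\<dots> \<le> (1 - \<xi>) ^ a" using a xi by (intro power_decreasing) auto
    finally have 1: "exp (- (\<xi> + 2 * \<xi>\<^sup>2) * m) \<le> (1 - \<xi>) ^ a" by (simp add: exp_of_nat2_mult)
    have "exp (z - z\<^sup>2) \<le> 1 + z"
      using ln_one_plus_pos_lower_bound[of z] z e by (simp add: ln_ge_iff)
    then have "exp (z - z\<^sup>2) ^ b \<le> (1 + z) ^ b" by (intro power_mono) auto
    then have 2: "exp ((z - z\<^sup>2) * b) \<le> (1 + z) ^ b" by (simp add: exp_of_nat2_mult)
    \<comment> \<open>The three factors \<open>1 - e / 8\<close> absorb the losses in
      \<open>m - l\<close>, \<open>k - m\<close> and \<open>1 - z\<close>; of the surplus in
      \<open>1 + e\<close> they leave \<open>e / 4\<close>.\<close>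
    have "m * (\<xi> * (1 + e / 4)) \<le> m * (\<xi> * ((1 + e) * (1 - e / 8) * (1 - e / 8) * (1 - e / 8)))"
    proof (intro mult_left_mono)
      have "1 - 3 * h \<le> (1 - h) * (1 - h) * (1 - h)" if "0 \<le> h" "h \<le> 3" for h :: real
      proof -
        have "0 \<le> h * h * (3 - h)" using that by (intro mult_nonneg_nonneg) auto
        then show ?thesis by (simp add: algebra_simps)
      qed
      from this[of "e / 8"] have "1 - 3 * (e / 8) \<le> (1 - e / 8) * (1 - e / 8) * (1 - e / 8)" using e by simp
      then have cube: "(1 + e) * (1 - 3 * (e / 8)) \<le> (1 + e) * ((1 - e / 8) * (1 - e / 8) * (1 - e / 8))"
        using e by (intro mult_left_mono) auto
      have "e * e \<le> e * 1" using e by (intro mult_left_mono) auto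
      moreover have "(1 + e) * (1 - 3 * (e / 8)) = 1 + 5 / 8 * e - 3 / 8 * (e * e)" by (simp add: field_simps)
      ultimately have "1 + e / 4 \<le> (1 + e) * (1 - 3 * (e / 8))" by linarith
      with cube show "1 + e / 4 \<le> (1 + e) * (1 - e / 8) * (1 - e / 8) * (1 - e / 8)"
        by (simp only: mult.assoc order_trans)
    qed (use xi in auto)
    also have "\<dots> = (m * (1 - e / 8)) * (k * (1 - e / 8)) * (z * (1 - e / 8))"
      using k by (simp add: z_def field_simps)
    also have "\<dots> \<le> (real m - real l) * (k - m) * (z * (1 - z))"
      using l m(2) e z k mk lm by (intro mult_mono mult_nonneg_nonneg) (auto simp: algebra_simps)
    also have "\<dots> \<le> b * (z * (1 - z))" using b z e by (intro mult_right_mono) auto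
    also have "\<dots> = (z - z\<^sup>2) * b" by (simp add: power2_eq_square algebra_simps)
    finally have 3: "m * (\<xi> * (1 + e / 4)) \<le> (z - z\<^sup>2) * b" .
    have "0 = - (e\<^sup>2 / 128 * m) + - (\<xi> + 2 * \<xi>\<^sup>2) * m + m * (\<xi> * (1 + e / 4))"
      by (simp add: \<xi>_def power2_eq_square algebra_simps)
    also have "\<dots> \<le> - (e\<^sup>2 / 128 * m) + - (\<xi> + 2 * \<xi>\<^sup>2) * m + (z - z\<^sup>2) * b" using 3 by simp
    finally have "exp 0 \<le> exp (- (e\<^sup>2 / 128 * m) + - (\<xi> + 2 * \<xi>\<^sup>2) * m + (z - z\<^sup>2) * b)"
      by (simp only: exp_le_cancel_iff)
    then have "1 \<le> C * exp (- (\<xi> + 2 * \<xi>\<^sup>2) * m) * exp ((z - z\<^sup>2) * b)"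
      by (simp only: exp_zero exp_add C_def)
    also have "\<dots> \<le> C * (1 - \<xi>) ^ a * (1 + z) ^ b"
      using 1 2 xi by (intro mult_mono mult_left_mono mult_nonneg_nonneg) (auto simp: C_def)
    finally show "1 \<le> C * (1 - \<xi>) ^ a * (1 + z) ^ b" .
  qed (use xi z m l mk in \<open>auto simp: C_def\<close>)
  then show ?thesis by (simp add: C_def)
qed

section \<open>Random links between pieces\<close>

text \<open>Induction that splits off the coordinates \<open>D v\<close> of one event: the product
  measure factors, and by \<open>dep\<close> neither part of an assignment affects the events of the
  other.\<close>

lemma prob_independent_events_le:
  fixes p :: real and q :: "'v \<Rightarrow> real"
  assumes "finite R" "finite E" "disjoint_family_on D R" "\<And>v. v \<in> R \<Longrightarrow> D v \<subseteq> E"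
    and dep: "\<And>v f g. v \<in> R \<Longrightarrow> (\<And>e. e \<in> D v \<Longrightarrow> f e = g e) \<Longrightarrow> Ev v f \<longleftrightarrow> Ev v g"
    and q: "\<And>v. v \<in> R \<Longrightarrow> measure_pmf.prob (bernoulli_edges (D v) p) {f. Ev v f} \<le> q v"
  shows "measure_pmf.prob (bernoulli_edges E p) {f. \<forall>v\<in>R. Ev v f} \<le> (\<Prod>v\<in>R. q v)"
  using assms
proof (induction R arbitrary: E rule: finite_induct)
  case empty
  then show ?case by simp
next
  case (insert v R)
  let ?M = "\<lambda>A. bernoulli_edges A p"
  let ?h = "\<lambda>f g e. if e \<in> D v then f e else g e"
  have Dv: "D v \<subseteq> E" using insert.prems(3) by auto
  have D: "finite (D v)" "D v \<subseteq> E" using finite_subset[OF Dv insert.prems(1)] Dv by auto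
  have DR: "D u \<inter> D v = {}" if "u \<in> R" for u
    using insert.prems(2) insert.hyps that by (auto simp: disjoint_family_on_def)
  have IH: "measure_pmf.prob (?M (E - D v)) {f. \<forall>v\<in>R. Ev v f} \<le> (\<Prod>v\<in>R. q v)"
  proof (rule insert.IH)
    show "disjoint_family_on D R" using insert.prems(2) by (auto simp: disjoint_family_on_def)
    show "D u \<subseteq> E - D v" if "u \<in> R" for u using insert.prems(3)[of u] DR[OF that] that by auto
    show "Ev u f \<longleftrightarrow> Ev u g" if "u \<in> R" "\<And>e. e \<in> D u \<Longrightarrow> f e = g e" for u f g
      using that by (intro insert.prems(4)) auto
    show "measure_pmf.prob (?M (D u)) {f. Ev u f} \<le> q u" if "u \<in> R" for u
      using that by (intro insert.prems(5)) auto
  qed (use insert.prems(1) in auto)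
  have ev: "(\<forall>u\<in>insert v R. Ev u (?h f g)) \<longleftrightarrow> Ev v f \<and> (\<forall>u\<in>R. Ev u g)" for f g
  proof -
    have "Ev v (?h f g) \<longleftrightarrow> Ev v f" by (rule insert.prems(4)) auto
    moreover have "Ev u (?h f g) \<longleftrightarrow> Ev u g" if "u \<in> R" for u
      by (rule insert.prems(4)) (use that DR[OF that] in auto)
    ultimately show ?thesis by auto
  qed
  have "?M (D v \<union> (E - D v)) = map_pmf (\<lambda>(f, g). ?h f g) (pair_pmf (?M (D v)) (?M (E - D v)))"
    using D insert.prems(1) by (intro Pi_pmf_union) auto
  moreover have "D v \<union> (E - D v) = E" using D by auto
  ultimately have "?M E = bind_pmf (?M (D v)) (\<lambda>f. map_pmf (?h f) (?M (E - D v)))"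
    by (simp add: pair_pmf_def map_pmf_def bind_assoc_pmf bind_return_pmf)
  then have "measure_pmf.prob (?M E) {f. \<forall>u\<in>insert v R. Ev u f} =
      measure_pmf.expectation (?M (D v)) (\<lambda>f. measure_pmf.prob (map_pmf (?h f) (?M (E - D v))) {f. \<forall>u\<in>insert v R. Ev u f})"
    by (simp only: prob_bind_pmf)
  also have "\<dots> = measure_pmf.expectation (?M (D v)) (\<lambda>f. indicator {f. Ev v f} f * measure_pmf.prob (?M (E - D v)) {f. \<forall>u\<in>R. Ev u f})"
  proof (rule Bochner_Integration.integral_cong[OF refl])
    fix f
    show "measure_pmf.prob (map_pmf (?h f) (?M (E - D v))) {f. \<forall>u\<in>insert v R. Ev u f}
      = indicator {f. Ev v f} f * measure_pmf.prob (?M (E - D v)) {f. \<forall>u\<in>R. Ev u f}"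
      unfolding measure_map_pmf vimage_def mem_Collect_eq ev by (cases "Ev v f") auto
  qed
  also have "\<dots> = measure_pmf.prob (?M (D v)) {f. Ev v f} * measure_pmf.prob (?M (E - D v)) {f. \<forall>u\<in>R. Ev u f}"
    by simp
  also have "\<dots> \<le> q v * (\<Prod>v\<in>R. q v)"
    using insert.prems(5)[of v] IH by (intro mult_mono) (auto intro: order_trans[OF measure_nonneg])
  finally show ?case using insert.hyps by simp
qed

text \<open>Count outcomes: \<open>h (x, y)\<close> is the assignment in which exactly the two edges
  from \<open>v\<close> to \<open>x\<close> and \<open>y\<close> are present. Disjointness of
  \<open>A\<close> and \<open>B\<close> makes \<open>h\<close> injective, and by Bernoulli's
  inequality all other edges are absent with probability at least \<open>1 / 2\<close>.\<close>

lemma prob_exact_pair_ge: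
  fixes p :: real
  assumes fin: "finite W" and v: "v \<notin> W" and A: "A \<subseteq> W" and B: "B \<subseteq> W" "A \<inter> B = {}"
    and p: "0 \<le> p" "card W * p \<le> 1 / 2" "p \<le> 1"
  shows "p\<^sup>2 / 2 * (card A * card B) \<le> measure_pmf.prob (bernoulli_edges ((\<lambda>z. {z, v}) ` W) p)
     {g. \<exists>x\<in>A. \<exists>y\<in>B. {z \<in> W. g {z, v}} = {x, y}}"
proof -
  define D where "D = (\<lambda>z. {z, v}) ` W"
  define h where "h = (\<lambda>(x, y) e. e \<in> {{x, v}, {y, v}})"
  have fin': "finite A" "finite B" "finite D" using fin A B finite_subset by (auto simp: D_def)
  have iv: "{x, v} = {z, v} \<longleftrightarrow> x = z" for x z by (auto simp: doubleton_eq_iff)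
  have cD: "card D \<le> card W" unfolding D_def by (rule card_image_le[OF fin])
  have inj: "inj_on h (A \<times> B)"
  proof (rule inj_onI)
    fix a b assume ab: "a \<in> A \<times> B" "b \<in> A \<times> B" and eq: "h a = h b"
    obtain x y x' y' where xy: "a = (x, y)" "b = (x', y')" by (cases a, cases b) auto
    have m: "x \<in> A" "x' \<in> A" "y \<in> B" "y' \<in> B" using ab xy by auto
    then have ne: "x \<noteq> y'" "y \<noteq> x'" using B(2) by auto
    have "z = x \<or> z = y \<longleftrightarrow> z = x' \<or> z = y'" for z
      using fun_cong[OF eq, of "{z, v}"] by (simp add: xy h_def iv)
    from this[of x] this[of y] show "a = b" using ne unfolding xy by simp
  qed
  have pmf: "p\<^sup>2 / 2 \<le> pmf (bernoulli_edges D p) (h a)" if a: "a \<in> A \<times> B" for a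
  proof -
    obtain x y where xy: "a = (x, y)" "x \<in> A" "y \<in> B" using a by auto
    have ne: "x \<noteq> y" using xy B(2) by auto
    have sub: "{{x, v}, {y, v}} \<subseteq> D" using xy A B(1) by (auto simp: D_def)
    have c2: "card {{x, v}, {y, v}} = 2" using ne by (simp add: iv)
    have out: "h a e = False" if "e \<notin> D" for e using sub that by (auto simp: h_def xy)
    have "1 / 2 \<le> 1 + real (card W) * (- p)" using p by simp
    also have "\<dots> \<le> (1 + - p) ^ card W" using p by (intro Bernoulli_inequality) auto
    also have "\<dots> \<le> (1 - p) ^ (card D - 2)" using p cD by (simp add: power_decreasing)
    finally have half: "1 / 2 \<le> (1 - p) ^ (card D - 2)" .
    have "pmf (bernoulli_edges D p) (h a) = (\<Prod>e\<in>D. pmf (bernoulli_pmf p) (h a e))"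
      using fin' out by (intro pmf_Pi') auto
    also have "\<dots> = (\<Prod>e\<in>{{x, v}, {y, v}}. pmf (bernoulli_pmf p) (h a e)) * (\<Prod>e\<in>D - {{x, v}, {y, v}}. pmf (bernoulli_pmf p) (h a e))"
      using prod.subset_diff[OF sub fin'(3)] by (simp only: mult.commute)
    also have "(\<Prod>e\<in>{{x, v}, {y, v}}. pmf (bernoulli_pmf p) (h a e)) = (\<Prod>e\<in>{{x, v}, {y, v}}. p)"
      using p by (intro prod.cong refl) (auto simp: h_def xy)
    also have "\<dots> = p\<^sup>2" by (simp only: prod_constant c2)
    also have "(\<Prod>e\<in>D - {{x, v}, {y, v}}. pmf (bernoulli_pmf p) (h a e)) = (\<Prod>e\<in>D - {{x, v}, {y, v}}. 1 - p)"
      using p by (intro prod.cong refl) (auto simp: h_def xy)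
    also have "\<dots> = (1 - p) ^ (card D - 2)"
      using card_Diff_subset[OF _ sub] by (simp add: c2)
    finally have "pmf (bernoulli_edges D p) (h a) = p\<^sup>2 * (1 - p) ^ (card D - 2)" .
    moreover have "p\<^sup>2 * (1 / 2) \<le> p\<^sup>2 * (1 - p) ^ (card D - 2)" by (rule mult_left_mono[OF half]) simp
    ultimately show ?thesis by simp
  qed
  have "p\<^sup>2 / 2 * (card A * card B) = (\<Sum>a\<in>A \<times> B. p\<^sup>2 / 2)" by (simp add: card_cartesian_product)
  also have "\<dots> \<le> (\<Sum>a\<in>A \<times> B. pmf (bernoulli_edges D p) (h a))" by (rule sum_mono[OF pmf])
  also have "\<dots> = measure_pmf.prob (bernoulli_edges D p) (h ` (A \<times> B))"
    using fin' by (simp add: measure_measure_pmf_finite sum.reindex[OF inj])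
  also have "\<dots> \<le> measure_pmf.prob (bernoulli_edges D p) {g. \<exists>x\<in>A. \<exists>y\<in>B. {z \<in> W. g {z, v}} = {x, y}}"
  proof (rule measure_pmf.finite_measure_mono)
    show "h ` (A \<times> B) \<subseteq> {g. \<exists>x\<in>A. \<exists>y\<in>B. {z \<in> W. g {z, v}} = {x, y}}"
    proof
      fix g assume "g \<in> h ` (A \<times> B)"
      then obtain x y where xy: "g = h (x, y)" "x \<in> A" "y \<in> B" by auto
      have "{z \<in> W. g {z, v}} = {x, y}" using xy A B(1) by (auto simp: h_def iv)
      then show "g \<in> {g. \<exists>x\<in>A. \<exists>y\<in>B. {z \<in> W. g {z, v}} = {x, y}}" using xy(2,3) by blast
    qed
  qed simp
  finally show ?thesis by (simp add: D_def)
qed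

text \<open>As \<open>R\<close> avoids the pieces, different \<open>v\<close> use different edges
  into them, so the events that \<open>v\<close> links \<open>X\<close> to \<open>Y\<close> are
  independent. Each is bounded by \<open>prob_exact_pair_ge\<close>, and
  \<open>1 - x \<le> exp (- x)\<close> turns the product of failure probabilities into a sum in the
  exponent.\<close>

lemma prob_no_link_le:
  fixes P :: "'i \<Rightarrow> 'a set" and p :: real
  defines "U \<equiv> \<lambda>X. \<Union>(P ` X)"
  assumes E: "finite E" and R: "finite R" and I: "finite (U I)" "disjoint_family_on P I" and RU: "R \<inter> U I = {}"
    and X: "X \<subseteq> I" "Y \<subseteq> I" "X \<inter> Y = {}"
    and p: "0 \<le> p" "p \<le> 1" "card (U I) * p \<le> 1 / 2"
  shows "measure_pmf.prob (bernoulli_edges E p) {g. \<not> (\<exists>i\<in>X. \<exists>j\<in>Y. linked (\<lambda>z v. {z, v} \<in> E \<and> g {z, v}) R P I i j)}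
     \<le> exp (- (p\<^sup>2 / 2 * (\<Sum>v\<in>R. card {x\<in>U X. {x, v} \<in> E} * card {y\<in>U Y. {y, v} \<in> E})))"
proof -
  define W where "W = (\<lambda>v. {z\<in>U I. {z, v} \<in> E})"
  define D where "D = (\<lambda>v. (\<lambda>z. {z, v}) ` W v)"
  define a where "a = (\<lambda>v. card {x\<in>U X. {x, v} \<in> E})"
  define b where "b = (\<lambda>v. card {x\<in>U Y. {x, v} \<in> E})"
  define Ev where "Ev = (\<lambda>v g. \<exists>x\<in>{x\<in>U X. {x, v} \<in> E}. \<exists>y\<in>{y\<in>U Y. {y, v} \<in> E}. {z \<in> W v. g {z, v}} = {x, y})"
  have UXI: "U X \<subseteq> U I" "U Y \<subseteq> U I" using X(1,2) unfolding U_def by blast+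
  have UXY: "U X \<inter> U Y = {}"
  proof -
    have "P i \<inter> P j = {}" if "i \<in> X" "j \<in> Y" for i j
    proof (rule disjoint_family_onD[OF I(2)])
      show "i \<in> I" "j \<in> I" using X(1,2) that by auto
      show "i \<noteq> j" using X(3) that by auto
    qed
    then show ?thesis unfolding U_def by blast
  qed
  have fW: "finite (W v)" for v using I(1) by (simp add: W_def)
  have Ev_linked: "\<exists>i\<in>X. \<exists>j\<in>Y. linked (\<lambda>z v. {z, v} \<in> E \<and> g {z, v}) R P I i j" if v: "v \<in> R" "Ev v g" for v g
  proof -
    obtain x y where xy: "x \<in> U X" "y \<in> U Y" "{z \<in> W v. g {z, v}} = {x, y}" using v(2) by (auto simp: Ev_def)
    then obtain i j where ij: "i \<in> X" "x \<in> P i" "j \<in> Y" "y \<in> P j" by (auto simp: U_def)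
    have "{z \<in> W v. g {z, v}} = {z \<in> \<Union>(P ` I). {z, v} \<in> E \<and> g {z, v}}" by (auto simp: W_def U_def)
    then have "{z \<in> \<Union>(P ` I). {z, v} \<in> E \<and> g {z, v}} = {x, y}" using xy(3) by simp
    moreover have "i \<noteq> j" using ij X(3) by blast
    ultimately have "linked (\<lambda>z v. {z, v} \<in> E \<and> g {z, v}) R P I i j"
      unfolding linked_def using ij v(1) by blast
    then show ?thesis using ij by blast
  qed
  have "measure_pmf.prob (bernoulli_edges E p) {g. \<not> (\<exists>i\<in>X. \<exists>j\<in>Y. linked (\<lambda>z v. {z, v} \<in> E \<and> g {z, v}) R P I i j)}
    \<le> measure_pmf.prob (bernoulli_edges E p) {g. \<forall>v\<in>R. \<not> Ev v g}"
    using Ev_linked by (intro measure_pmf.finite_measure_mono) auto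
  also have "\<dots> \<le> (\<Prod>v\<in>R. exp (- (p\<^sup>2 / 2 * (a v * b v))))"
  proof (rule prob_independent_events_le[OF R E, where D = D])
    show "disjoint_family_on D R"
      unfolding disjoint_family_on_def
    proof (intro ballI impI)
      fix v w assume "v \<in> R" "w \<in> R" "v \<noteq> w"
      then show "D v \<inter> D w = {}" using RU by (auto simp: D_def W_def doubleton_eq_iff)
    qed
    show "D v \<subseteq> E" for v by (auto simp: D_def W_def)
    show "(\<not> Ev v f) = (\<not> Ev v g)" if "\<And>e. e \<in> D v \<Longrightarrow> f e = g e" for v f g
    proof -
      have "{z \<in> W v. f {z, v}} = {z \<in> W v. g {z, v}}" using that by (auto simp: D_def)
      then show ?thesis unfolding Ev_def by simp
    qed
    fix v assume v: "v \<in> R"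
    have "p\<^sup>2 / 2 * (a v * b v) \<le> measure_pmf.prob (bernoulli_edges (D v) p) {g. Ev v g}"
      unfolding D_def Ev_def a_def b_def
    proof (rule prob_exact_pair_ge[OF fW])
      have "card (W v) \<le> card (U I)" using I(1) by (intro card_mono) (auto simp: W_def)
      then have "card (W v) * p \<le> card (U I) * p" using p by (intro mult_right_mono) auto
      then show "card (W v) * p \<le> 1 / 2" using p by linarith
    qed (use v RU UXI UXY p in \<open>auto simp: W_def\<close>)
    moreover have "{g. \<not> Ev v g} = UNIV - {g. Ev v g}" by auto
    ultimately have "measure_pmf.prob (bernoulli_edges (D v) p) {g. \<not> Ev v g} \<le> 1 - p\<^sup>2 / 2 * (a v * b v)"
      using measure_pmf.prob_compl[of "{g. Ev v g}" "bernoulli_edges (D v) p"] by simp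
    also have "\<dots> \<le> exp (- (p\<^sup>2 / 2 * (a v * b v)))" using exp_ge_add_one_self[of "- (p\<^sup>2 / 2 * (a v * b v))"] by simp
    finally show "measure_pmf.prob (bernoulli_edges (D v) p) {g. \<not> Ev v g} \<le> exp (- (p\<^sup>2 / 2 * (a v * b v)))" .
  qed
  also have "\<dots> = exp (- (p\<^sup>2 / 2 * (\<Sum>v\<in>R. a v * b v)))"
    using R by (simp add: exp_sum[symmetric] sum_negf sum_distrib_left)
  finally show ?thesis by (simp add: a_def b_def)
qed

text \<open>Apply \<open>dense_core\<close> to the codegrees of pieces into \<open>R\<close>,
  normalised by \<open>s\<^sup>2 * n\<close> to be at most 1. As the pieces cover at most
  \<open>k / 2\<close> vertices, each of their vertices keeps \<open>k / 2\<close> neighbours in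
  \<open>R\<close>; Cauchy-Schwarz over \<open>R\<close> then gives average weight at least
  \<open>\<nu>\<^sup>2 / 4\<close>.\<close>

lemma dense_link_core:
  fixes P :: "'i \<Rightarrow> 'a set" and k \<nu> d :: real and s n :: nat
  defines "U \<equiv> \<lambda>X. \<Union>(P ` X)" and "d \<equiv> \<nu>\<^sup>2 / 4"
  assumes V: "finite V" "card V = n" "n > 0" and nu: "\<nu> > 0" "\<nu> * n \<le> k"
    and deg: "\<And>v. v \<in> V \<Longrightarrow> k \<le> card {w\<in>V. {v, w} \<in> E}"
    and I: "finite I" "I \<noteq> {}" and P: "\<And>i. i \<in> I \<Longrightarrow> P i \<subseteq> V" "\<And>i. i \<in> I \<Longrightarrow> card (P i) = s"
      "disjoint_family_on P I" and s: "s > 0" "s * card I \<le> k / 2"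
  shows "\<exists>Q\<subseteq>I. Q \<noteq> {} \<and> d\<^sup>2 * card I \<le> card Q \<and> (\<forall>X Y. X \<subseteq> Q \<longrightarrow> Y \<subseteq> Q \<longrightarrow> X \<inter> Y = {} \<longrightarrow>
    card Q \<le> 16 * card X \<longrightarrow> card Q \<le> 16 * card Y \<longrightarrow> card (Q - X - Y) \<le> d / 256 * card Q \<longrightarrow>
    d / 256 * s\<^sup>2 * n * (card Q)\<^sup>2 \<le> (\<Sum>v\<in>V - U I. card {x\<in>U X. {x, v} \<in> E} * card {y\<in>U Y. {y, v} \<in> E}))"
proof -
  define R where "R = V - U I"
  define g where "g = (\<lambda>i v. real (card {x\<in>P i. {x, v} \<in> E}))"
  define w where "w = (\<lambda>i j. (\<Sum>v\<in>R. g i v * g j v) / (s\<^sup>2 * n))"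
  have d0: "d > 0" using nu by (simp add: d_def)
  have fR: "finite R" "card R \<le> n" using V by (auto simp: R_def intro: card_mono)
  have fP: "finite (P i)" if "i \<in> I" for i using P(1)[OF that] V(1) finite_subset by blast
  have UV: "U I \<subseteq> V" using P(1) by (auto simp: U_def)
  have fU: "finite (U I)" using UV V(1) finite_subset by blast
  have sn: "real (s\<^sup>2 * n) > 0" using s V by simp
  have cU: "card (U I) = s * card I"
  proof -
    have "card (U I) = (\<Sum>i\<in>I. card (P i))"
      unfolding U_def using I fP P(3) by (intro card_UN_disjoint) (auto simp: disjoint_family_on_def)
    then show ?thesis using P(2) by simp
  qed
  have gsum: "real (card {x\<in>U X. {x, v} \<in> E}) = (\<Sum>i\<in>X. g i v)" if X: "X \<subseteq> I" for X v
  proof -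
    have "{x\<in>U X. {x, v} \<in> E} = (\<Union>i\<in>X. {x\<in>P i. {x, v} \<in> E})" by (auto simp: U_def)
    also have "card \<dots> = (\<Sum>i\<in>X. card {x\<in>P i. {x, v} \<in> E})"
    proof (rule card_UN_disjoint)
      show "finite X" using X I(1) finite_subset by blast
      show "\<forall>i\<in>X. finite {x \<in> P i. {x, v} \<in> E}" using X fP by auto
      show "\<forall>i\<in>X. \<forall>j\<in>X. i \<noteq> j \<longrightarrow> {x \<in> P i. {x, v} \<in> E} \<inter> {x \<in> P j. {x, v} \<in> E} = {}"
      proof (intro ballI impI)
        fix i j assume "i \<in> X" "j \<in> X" "i \<noteq> j"
        then have "P i \<inter> P j = {}" using X by (intro disjoint_family_onD[OF P(3)]) auto
        then show "{x \<in> P i. {x, v} \<in> E} \<inter> {x \<in> P j. {x, v} \<in> E} = {}" by blast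
      qed
    qed
    finally show ?thesis by (simp add: g_def)
  qed
  have wXY: "(\<Sum>i\<in>X. \<Sum>j\<in>Y. w i j) = (\<Sum>v\<in>R. (\<Sum>i\<in>X. g i v) * (\<Sum>j\<in>Y. g j v)) / (s\<^sup>2 * n)" for X Y
  proof -
    have "(\<Sum>i\<in>X. \<Sum>j\<in>Y. w i j) = (\<Sum>i\<in>X. \<Sum>j\<in>Y. \<Sum>v\<in>R. g i v * g j v) / (s\<^sup>2 * n)"
      by (simp only: w_def sum_divide_distrib)
    also have "(\<Sum>i\<in>X. \<Sum>j\<in>Y. \<Sum>v\<in>R. g i v * g j v) = (\<Sum>i\<in>X. \<Sum>v\<in>R. \<Sum>j\<in>Y. g i v * g j v)"
      by (intro sum.cong refl sum.swap)
    also have "\<dots> = (\<Sum>v\<in>R. \<Sum>i\<in>X. \<Sum>j\<in>Y. g i v * g j v)" by (rule sum.swap)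
    also have "\<dots> = (\<Sum>v\<in>R. (\<Sum>i\<in>X. g i v) * (\<Sum>j\<in>Y. g j v))" by (simp only: sum_product)
    finally show ?thesis .
  qed
  have g1: "0 \<le> g i v" "i \<in> I \<Longrightarrow> g i v \<le> s" for i v
  proof -
    show "0 \<le> g i v" by (simp add: g_def)
    assume i: "i \<in> I"
    have "card {x\<in>P i. {x, v} \<in> E} \<le> card (P i)" using fP[OF i] by (intro card_mono) auto
    then show "g i v \<le> s" using P(2)[OF i] by (simp add: g_def)
  qed
  have w1: "w i j \<le> 1" if "i \<in> I" "j \<in> I" for i j
  proof -
    have "(\<Sum>v\<in>R. g i v * g j v) \<le> (\<Sum>v\<in>R. real s * s)" using g1 that by (intro sum_mono mult_mono) auto
    also have "\<dots> = card R * (s * s)" by simp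
    also have "\<dots> \<le> n * (s * s)" using fR by (intro of_nat_mono mult_right_mono) auto
    also have "\<dots> = s\<^sup>2 * n" by (simp add: power2_eq_square)
    finally show ?thesis using sn by (simp add: w_def)
  qed
  have wsym: "w i j = w j i" for i j by (simp add: w_def mult.commute)
  have k0: "k > 0" using nu V by (meson less_le_trans mult_pos_pos of_nat_0_less_iff)
  have total: "d * (card I)\<^sup>2 \<le> (\<Sum>i\<in>I. \<Sum>j\<in>I. w i j)"
  proof -
    define T where "T = (\<Sum>v\<in>R. \<Sum>i\<in>I. g i v)"
    have "T = (\<Sum>v\<in>R. real (card {x\<in>U I. {x, v} \<in> E}))" by (simp add: T_def gsum)
    also have "\<dots> = (\<Sum>v\<in>R. \<Sum>x | x \<in> U I \<and> {x, v} \<in> E. 1)" by simp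
    also have "\<dots> = (\<Sum>x\<in>U I. \<Sum>v | v \<in> R \<and> {x, v} \<in> E. 1)" using fR fU by (intro sum.swap_restrict)
    also have "\<dots> \<ge> (\<Sum>x\<in>U I. k / 2)"
    proof (rule sum_mono)
      fix x assume x: "x \<in> U I"
      have "{w\<in>V. {x, w} \<in> E} \<subseteq> {v\<in>R. {x, v} \<in> E} \<union> U I" by (auto simp: R_def)
      then have "card {w\<in>V. {x, w} \<in> E} \<le> card ({v\<in>R. {x, v} \<in> E} \<union> U I)" using fR fU by (intro card_mono) auto
      also have "\<dots> \<le> card {v\<in>R. {x, v} \<in> E} + card (U I)" by (rule card_Un_le)
      finally have "card {w\<in>V. {x, w} \<in> E} \<le> card {v\<in>R. {x, v} \<in> E} + s * card I" using cU by simp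
      moreover have "k \<le> card {w\<in>V. {x, w} \<in> E}" using x UV by (intro deg) auto
      ultimately have "k / 2 \<le> card {v\<in>R. {x, v} \<in> E}" using s(2) by linarith
      then show "k / 2 \<le> (\<Sum>v | v \<in> R \<and> {x, v} \<in> E. 1)" by simp
    qed
    finally have T: "s * card I * (k / 2) \<le> T" by (simp add: cU)
    have "\<nu> * n * (s * card I) / 2 \<le> k * (s * card I) / 2"
      using nu by (intro divide_right_mono mult_right_mono) auto
    then have T': "\<nu> * n * (s * card I) / 2 \<le> T" using T by (simp add: mult.commute)
    have "(\<nu> * n * (s * card I) / 2)\<^sup>2 \<le> T\<^sup>2" using T' nu by (intro power_mono) auto
    also have "\<dots> \<le> (\<Sum>v\<in>R. (\<Sum>i\<in>I. g i v)\<^sup>2) * card R"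
      unfolding T_def by (rule sum_squared_le_sum_of_squares)
    also have "\<dots> \<le> (\<Sum>v\<in>R. (\<Sum>i\<in>I. g i v)\<^sup>2) * n" using fR by (intro mult_left_mono) (auto intro: sum_nonneg)
    also have "(\<nu> * n * (s * card I) / 2)\<^sup>2 = d * (card I)\<^sup>2 * (s\<^sup>2 * n) * n"
      by (simp add: d_def power2_eq_square)
    finally have "d * (card I)\<^sup>2 * (s\<^sup>2 * n) \<le> (\<Sum>v\<in>R. (\<Sum>i\<in>I. g i v)\<^sup>2)" using V by simp
    then show ?thesis unfolding wXY using sn by (simp add: pos_le_divide_eq power2_eq_square)
  qed
  obtain Q where Q: "Q \<subseteq> I" "Q \<noteq> {}" "d\<^sup>2 * card I \<le> card Q"
    "\<And>X. X \<subseteq> Q \<Longrightarrow> 2 * card X \<le> card Q \<Longrightarrow> d / 8 * card X * card Q \<le> (\<Sum>i\<in>X. \<Sum>j\<in>Q - X. w i j)"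
    using dense_core[of I w d, OF I wsym w1 d0 total] by blast
  have fQ: "finite Q" using Q(1) I(1) finite_subset by blast
  define N where "N = card Q"
  have cut: "d / 256 * s\<^sup>2 * n * (card Q)\<^sup>2 \<le> (\<Sum>v\<in>R. card {x\<in>U X. {x, v} \<in> E} * card {y\<in>U Y. {y, v} \<in> E})"
    if XY: "X \<subseteq> Q" "Y \<subseteq> Q" "X \<inter> Y = {}" "card Q \<le> 16 * card X" "card Q \<le> 16 * card Y" "card (Q - X - Y) \<le> d / 256 * card Q" for X Y
  proof -
    have fXY: "finite X" "finite Y" using XY fQ finite_subset by blast+
    have XN: "real (card X) \<le> N" unfolding N_def using XY(1) fQ by (simp add: card_mono)
    \<comment> \<open>The smaller of \<open>X\<close> and \<open>Q - X\<close> has at least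
      \<open>N / 16\<close> pieces, whence \<open>d / 8 * (N / 16) * N\<close>. The leftover
      \<open>Q - X - Y\<close> later takes at most half of this, because weights are at most
      1.\<close>
    have large: "d / 128 * N\<^sup>2 \<le> (\<Sum>i\<in>X. \<Sum>j\<in>Q - X. w i j)"
    proof (cases "2 * card X \<le> card Q")
      case True
      have "d / 8 * (N / 16) * N \<le> d / 8 * card X * N"
        using d0 XY(4) by (intro mult_right_mono mult_left_mono) (auto simp: N_def)
      also have "\<dots> \<le> (\<Sum>i\<in>X. \<Sum>j\<in>Q - X. w i j)" using Q(4)[OF XY(1) True] by (simp add: N_def)
      finally show ?thesis by (simp add: power2_eq_square)
    next
      case False
      have c: "card (Q - X) = card Q - card X" using XY(1) fXY by (simp add: card_Diff_subset)
      have "card Y \<le> card (Q - X)" using XY fQ by (intro card_mono) auto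
      then have "d / 8 * (N / 16) * N \<le> d / 8 * card (Q - X) * N"
        using d0 XY(5) by (intro mult_right_mono mult_left_mono) (auto simp: N_def)
      also have "\<dots> \<le> (\<Sum>i\<in>Q - X. \<Sum>j\<in>Q - (Q - X). w i j)"
        unfolding N_def using c False by (intro Q(4)) auto
      also have "Q - (Q - X) = X" using XY(1) by auto
      also have "(\<Sum>i\<in>Q - X. \<Sum>j\<in>X. w i j) = (\<Sum>i\<in>X. \<Sum>j\<in>Q - X. w i j)"
        by (subst sum.swap) (simp add: wsym)
      finally show ?thesis by (simp add: power2_eq_square)
    qed
    have "Q - X = Y \<union> (Q - X - Y)" using XY by auto
    then have "(\<Sum>i\<in>X. \<Sum>j\<in>Q - X. w i j) = (\<Sum>i\<in>X. \<Sum>j\<in>Y \<union> (Q - X - Y). w i j)" by simp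
    also have "\<dots> = (\<Sum>i\<in>X. \<Sum>j\<in>Y. w i j) + (\<Sum>i\<in>X. \<Sum>j\<in>Q - X - Y. w i j)"
      unfolding sum.distrib[symmetric] using fXY fQ by (intro sum.cong refl sum.union_disjoint) auto
    also have "(\<Sum>i\<in>X. \<Sum>j\<in>Q - X - Y. w i j) \<le> (\<Sum>i\<in>X. \<Sum>j\<in>Q - X - Y. 1)"
      using XY(1) Q(1) by (intro sum_mono w1) auto
    also have "(\<Sum>i\<in>X. \<Sum>j\<in>Q - X - Y. 1 :: real) = card X * real (card (Q - X - Y))" by simp
    also have "\<dots> \<le> N * (d / 256 * N)" using XY(6) XN by (intro mult_mono) (auto simp: N_def)
    finally have "(\<Sum>i\<in>X. \<Sum>j\<in>Q - X. w i j) \<le> (\<Sum>i\<in>X. \<Sum>j\<in>Y. w i j) + N * (d / 256 * N)" by simp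
    moreover have "N * (d / 256 * N) = d / 256 * N\<^sup>2" "d / 128 * N\<^sup>2 = 2 * (d / 256 * N\<^sup>2)"
      by (simp_all add: power2_eq_square)
    ultimately have "d / 256 * N\<^sup>2 \<le> (\<Sum>i\<in>X. \<Sum>j\<in>Y. w i j)" using large by linarith
    then have "d / 256 * N\<^sup>2 * (s\<^sup>2 * n) \<le> (\<Sum>v\<in>R. (\<Sum>i\<in>X. g i v) * (\<Sum>j\<in>Y. g j v))"
      unfolding wXY using sn by (simp add: pos_le_divide_eq)
    also have "\<dots> = (\<Sum>v\<in>R. card {x\<in>U X. {x, v} \<in> E} * card {y\<in>U Y. {y, v} \<in> E})"
      using XY(1,2) Q(1) by (simp add: gsum)
    finally show ?thesis by (simp add: N_def algebra_simps)
  qed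
  show ?thesis using Q(1-3) cut unfolding R_def by (intro exI[of _ Q]) blast
qed

text \<open>Union bound over all pairs of subsets of \<open>Q\<close>; the factor
  \<open>4 ^ card Q\<close> is what the exponent \<open>\<theta>\<close> has to beat.\<close>

lemma prob_some_cut_unlinked_le:
  fixes P :: "'i \<Rightarrow> 'a set" and p \<theta> :: real and good :: "'i set \<Rightarrow> 'i set \<Rightarrow> bool"
  defines "U \<equiv> \<lambda>X. \<Union>(P ` X)"
  assumes E: "finite E" and R: "finite R" and I: "finite (U I)" "disjoint_family_on P I" and RU: "R \<inter> U I = {}"
    and p: "0 \<le> p" "p \<le> 1" "card (U I) * p \<le> 1 / 2" and Q: "Q \<subseteq> I" "finite Q"
    and good: "\<And>X Y. X \<subseteq> Q \<Longrightarrow> Y \<subseteq> Q \<Longrightarrow> good X Y \<Longrightarrow> X \<inter> Y = {} \<and>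
      \<theta> \<le> p\<^sup>2 / 2 * (\<Sum>v\<in>R. card {x\<in>U X. {x, v} \<in> E} * card {y\<in>U Y. {y, v} \<in> E})"
  shows "measure_pmf.prob (bernoulli_edges E p) {g. \<exists>X Y. X \<subseteq> Q \<and> Y \<subseteq> Q \<and> good X Y \<and>
      \<not> (\<exists>i\<in>X. \<exists>j\<in>Y. linked (\<lambda>z v. {z, v} \<in> E \<and> g {z, v}) R P I i j)} \<le> 4 ^ card Q * exp (- \<theta>)"
proof -
  define B where "B = (\<lambda>(X, Y). {g. good X Y \<and> \<not> (\<exists>i\<in>X. \<exists>j\<in>Y. linked (\<lambda>z v. {z, v} \<in> E \<and> g {z, v}) R P I i j)})"
  have "measure_pmf.prob (bernoulli_edges E p) (B z) \<le> exp (- \<theta>)" if zQ: "z \<in> Pow Q \<times> Pow Q" for z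
  proof -
    obtain X Y where z: "z = (X, Y)" "X \<subseteq> Q" "Y \<subseteq> Q" using zQ by blast
    show ?thesis
    proof (cases "good X Y")
      case True
      have "measure_pmf.prob (bernoulli_edges E p) (B z) \<le>
        exp (- (p\<^sup>2 / 2 * (\<Sum>v\<in>R. card {x\<in>U X. {x, v} \<in> E} * card {y\<in>U Y. {y, v} \<in> E})))"
        using prob_no_link_le[of E R P I X Y p] E R I RU p good[OF z(2,3) True] z Q(1) True
        unfolding U_def by (simp add: B_def)
      also have "\<dots> \<le> exp (- \<theta>)" using good[OF z(2,3) True] by simp
      finally show ?thesis .
    qed (simp add: B_def z)
  qed
  then have "(\<Sum>z\<in>Pow Q \<times> Pow Q. measure_pmf.prob (bernoulli_edges E p) (B z)) \<le> (\<Sum>z\<in>Pow Q \<times> Pow Q. exp (- \<theta>))"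
    by (rule sum_mono)
  also have "\<dots> = 4 ^ card Q * exp (- \<theta>)"
    using Q(2) by (simp add: card_cartesian_product card_Pow flip: power_mult_distrib)
  finally have "(\<Sum>z\<in>Pow Q \<times> Pow Q. measure_pmf.prob (bernoulli_edges E p) (B z)) \<le> 4 ^ card Q * exp (- \<theta>)" .
  moreover have "measure_pmf.prob (bernoulli_edges E p) (\<Union>z\<in>Pow Q \<times> Pow Q. B z)
      \<le> (\<Sum>z\<in>Pow Q \<times> Pow Q. measure_pmf.prob (bernoulli_edges E p) (B z))"
    using Q(2) by (intro measure_pmf.finite_measure_subadditive_finite) auto
  moreover have "{g. \<exists>X Y. X \<subseteq> Q \<and> Y \<subseteq> Q \<and> good X Y \<and>
      \<not> (\<exists>i\<in>X. \<exists>j\<in>Y. linked (\<lambda>z v. {z, v} \<in> E \<and> g {z, v}) R P I i j)} = (\<Union>z\<in>Pow Q \<times> Pow Q. B z)"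
    by (auto simp: B_def)
  ultimately show ?thesis by simp
qed

section \<open>Two-round exposure\<close>

lemma bernoulli_edges_two_rounds:
  fixes E :: "'a set"
  assumes E: "finite E" and p: "0 \<le> p1" "p1 \<le> 1" "0 \<le> p2" "p2 \<le> 1" "1 - p = (1 - p1) * (1 - p2)"
  shows "bernoulli_edges E p = bind_pmf (bernoulli_edges E p1) (\<lambda>f.
    map_pmf (\<lambda>g e. e \<in> E \<and> (f e \<or> g e)) (bernoulli_edges E p2))"
proof -
  have "0 \<le> (1 - p1) * (1 - p2)" "(1 - p1) * (1 - p2) \<le> 1"
    using p(1-4) by (auto intro!: mult_nonneg_nonneg mult_le_one)
  then have p01: "0 \<le> p" "p \<le> 1" using p(5) by auto
  have "bernoulli_pmf p = bind_pmf (bernoulli_pmf p1) (\<lambda>a. bind_pmf (bernoulli_pmf p2) (\<lambda>b. return_pmf (a \<or> b)))"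
  proof (rule pmf_eqI)
    fix b show "pmf (bernoulli_pmf p) b = pmf (bind_pmf (bernoulli_pmf p1) (\<lambda>a. bind_pmf (bernoulli_pmf p2) (\<lambda>b. return_pmf (a \<or> b)))) b"
      using p p01 by (cases b) (auto simp: pmf_bind algebra_simps)
  qed
  then have "bernoulli_edges E p = Pi_pmf E False (\<lambda>_. bind_pmf (bernoulli_pmf p1) (\<lambda>a. bind_pmf (bernoulli_pmf p2) (\<lambda>b. return_pmf (a \<or> b))))"
    by simp
  also have "\<dots> = bind_pmf (bernoulli_edges E p1) (\<lambda>f. Pi_pmf E False (\<lambda>e. bind_pmf (bernoulli_pmf p2) (\<lambda>b. return_pmf (f e \<or> b))))"
    by (rule Pi_pmf_bind[OF E])
  also have "\<dots> = bind_pmf (bernoulli_edges E p1) (\<lambda>f. bind_pmf (bernoulli_edges E p2) (\<lambda>g. Pi_pmf E False (\<lambda>e. return_pmf (f e \<or> g e))))"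
    by (subst Pi_pmf_bind[OF E, where d' = False]) (rule refl)
  also have "\<dots> = bind_pmf (bernoulli_edges E p1) (\<lambda>f.
    map_pmf (\<lambda>g e. e \<in> E \<and> (f e \<or> g e)) (bernoulli_edges E p2))"
  proof -
    have "(\<lambda>e. if e \<in> E then f e \<or> g e else False) = (\<lambda>e. e \<in> E \<and> (f e \<or> g e))" for f g :: "'a \<Rightarrow> bool" by auto
    then show ?thesis by (simp only: Pi_pmf_return_pmf[OF E] map_pmf_def)
  qed
  finally show ?thesis .
qed

text \<open>Conditioning on the first round: for a fixed good \<open>f\<close> only \<open>g\<close>
  is random, so the pieces may depend on \<open>f\<close> in any way.\<close>

lemma prob_two_rounds_le:
  assumes E: "finite E" and p: "0 \<le> p1" "p1 \<le> 1" "0 \<le> p2" "p2 \<le> 1" "1 - p = (1 - p1) * (1 - p2)"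
    and first: "measure_pmf.prob (bernoulli_edges E p1) {f. \<not> good f} \<le> \<delta>1"
    and second: "\<And>f. good f \<Longrightarrow> measure_pmf.prob (bernoulli_edges E p2) {g. bad (\<lambda>e. e \<in> E \<and> (f e \<or> g e))} \<le> \<delta>2"
    and d2: "0 \<le> \<delta>2"
  shows "measure_pmf.prob (bernoulli_edges E p) {X. bad X} \<le> \<delta>1 + \<delta>2"
proof -
  let ?M = "bernoulli_edges E p1"
  have "measure_pmf.prob (bernoulli_edges E p) {X. bad X}
      = measure_pmf.expectation ?M (\<lambda>f. measure_pmf.prob (bernoulli_edges E p2) {g. bad (\<lambda>e. e \<in> E \<and> (f e \<or> g e))})"
    by (simp add: bernoulli_edges_two_rounds[OF E p] prob_bind_pmf vimage_def)
  also have "\<dots> \<le> measure_pmf.expectation ?M (\<lambda>f. indicator {f. \<not> good f} f + \<delta>2)"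
  proof (rule integral_mono)
    fix f
    show "measure_pmf.prob (bernoulli_edges E p2) {g. bad (\<lambda>e. e \<in> E \<and> (f e \<or> g e))} \<le> indicator {f. \<not> good f} f + \<delta>2"
    proof (cases "good f")
      case True then show ?thesis using second by simp
    next
      case False
      have "measure_pmf.prob (bernoulli_edges E p2) {g. bad (\<lambda>e. e \<in> E \<and> (f e \<or> g e))} \<le> 1"
        by (rule measure_pmf.prob_le_1)
      moreover have "indicator {f. \<not> good f} f = (1 :: real)" using False by simp
      ultimately show ?thesis using d2 by linarith
    qed
  next
    show "integrable ?M (\<lambda>f. indicator {f. \<not> good f} f + \<delta>2)"
      by (rule measure_pmf.integrable_const_bound[where B = "1 + \<delta>2"]) (use d2 in \<open>auto simp: indicator_def\<close>)
    show "integrable ?M (\<lambda>f. measure_pmf.prob (bernoulli_edges E p2) {g. bad (\<lambda>e. e \<in> E \<and> (f e \<or> g e))})"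
      by (rule measure_pmf.integrable_const_bound[where B = 1]) auto
  qed
  also have "\<dots> = measure_pmf.prob ?M {f. \<not> good f} + \<delta>2"
  proof -
    have "integrable ?M (\<lambda>f. indicator {f. \<not> good f} f :: real)"
      by (rule measure_pmf.integrable_const_bound[where B = 1]) auto
    then show ?thesis by (subst Bochner_Integration.integral_add) auto
  qed
  finally show ?thesis using first by linarith
qed

lemma conn_path_segment:
  assumes "successively adj us" "\<And>x y. adj x y \<Longrightarrow> adj y x" "a + m < length us"
  shows "conn adj ((!) us ` {a..<a + Suc m})"
  using assms(3)
proof (induction m)
  case 0
  then show ?case by (simp add: conn_singleton)
next
  case (Suc m)
  have "{a..<a + Suc (Suc m)} = insert (a + Suc m) {a..<a + Suc m}" by auto
  moreover have "adj (us ! (a + m)) (us ! (a + Suc m))"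
    using assms(1) Suc.prems by (simp add: successively_conv_nth)
  ultimately show ?case using Suc assms(2) by (auto intro!: conn_insert[of _ _ "us ! (a + m)"])
qed

lemma has_path_pieces:
  assumes "has_path V (M * s) F" "s > 0"
  obtains P :: "nat \<Rightarrow> 'a set" where "\<And>i. i < M \<Longrightarrow> P i \<subseteq> V" "\<And>i. i < M \<Longrightarrow> card (P i) = s"
    "disjoint_family_on P {..<M}" "\<And>i. i < M \<Longrightarrow> conn (\<lambda>x y. {x, y} \<in> F) (P i)"
proof -
  obtain us where us: "length us = M * s" "distinct us" "set us \<subseteq> V" "successively (\<lambda>u w. {u, w} \<in> F) us"
    using assms(1) by (auto simp: has_path_def)
  define J where "J = (\<lambda>i. {i * s..<i * s + s})"
  have J: "J i \<subseteq> {..<length us}" if "i < M" for i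
  proof -
    have "Suc i * s \<le> M * s" using that by (intro mult_right_mono) auto
    then show ?thesis using us(1) by (auto simp: J_def)
  qed
  have inj: "inj_on ((!) us) {..<length us}" using us(2) by (simp add: inj_on_def nth_eq_iff_index_eq)
  have Jdiv: "j div s = i" if "j \<in> J i" for i j
    using that assms(2) by (intro div_nat_eqI) (auto simp: J_def mult.commute)
  define P where "P = (\<lambda>i. (!) us ` J i)"
  show ?thesis
  proof (rule that[of P])
    fix i assume i: "i < M"
    show "P i \<subseteq> V" using us(3) J[OF i] by (force simp: P_def)
    show "card (P i) = s" using card_image[OF inj_on_subset[OF inj J[OF i]]] by (simp add: P_def J_def)
    have s: "i * s + Suc (s - 1) = i * s + s" using assms(2) by simp
    have "i * s + (s - 1) < length us" using J[OF i] assms(2) by (auto simp: J_def subset_iff)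
    then have "conn (\<lambda>x y. {x, y} \<in> F) ((!) us ` {i * s..<i * s + Suc (s - 1)})"
      by (intro conn_path_segment[OF us(4)]) (auto simp: insert_commute)
    then show "conn (\<lambda>x y. {x, y} \<in> F) (P i)" unfolding s P_def J_def .
  next
    show "disjoint_family_on P {..<M}"
      unfolding disjoint_family_on_def
    proof (intro ballI impI)
      fix i j assume ij: "i \<in> {..<M}" "j \<in> {..<M}" "i \<noteq> j"
      have "J i \<inter> J j = {}" using Jdiv ij(3) by blast
      then have "(!) us ` (J i \<inter> J j) = {}" by simp
      then show "P i \<inter> P j = {}"
        unfolding P_def using inj_on_image_Int[OF inj J[of i] J[of j]] ij by simp
    qed
  qed
qed

text \<open>The hypothesis with the constant 6 makes the exponent of every balanced cut at least
  \<open>3 * card Q\<close>. The number of cuts is at most \<open>exp (2 * card Q)\<close>, which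
  leaves \<open>exp (- card Q)\<close>. The condition on \<open>\<Delta>\<close> is the one for
  deleting the pieces of large degree.\<close>

lemma hadwiger_failure_prob_pieces:
  fixes P :: "nat \<Rightarrow> 'a set" and k \<nu> d \<eta> p :: real and s n M \<Delta> t :: nat
  defines "d \<equiv> \<nu>\<^sup>2 / 4" and "\<eta> \<equiv> \<nu>\<^sup>2 / 4 / 256"
  assumes V: "finite V" "card V = n" "n > 0" and E: "E \<subseteq> nsets V 2" and nu: "0 < \<nu>" "\<nu> \<le> 1" "\<nu> * n \<le> k"
    and deg: "\<And>v. v \<in> V \<Longrightarrow> k \<le> card {w\<in>V. {v, w} \<in> E}"
    and M: "M > 0" and P: "\<And>i. i < M \<Longrightarrow> P i \<subseteq> V" "\<And>i. i < M \<Longrightarrow> card (P i) = s"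
      "disjoint_family_on P {..<M}" "\<And>i. i < M \<Longrightarrow> conn (\<lambda>x y. {x, y} \<in> {e. f e} \<inter> E) (P i)"
    and s: "s > 0" "real (s * M) \<le> k / 2"
    and p: "0 \<le> p" "p \<le> 1" "real (s * M) * p \<le> 1 / 2" "6 \<le> p\<^sup>2 * \<eta> * s\<^sup>2 * n * (d\<^sup>2 * M)"
    and Delta: "\<Delta> > 0" "4 * n \<le> \<eta> * (d\<^sup>2 * M) * \<Delta>"
    and t: "t * minor_const (\<eta> / 2) \<Delta> \<le> sqrt (d\<^sup>2 * M / 2)"
  shows "measure_pmf.prob (bernoulli_edges E p) {g. \<not> t \<le> hadwiger_number (Graph V {e \<in> E. f e \<or> g e})}
    \<le> exp (- (d\<^sup>2 * M))"
proof -
  define U where "U = (\<lambda>X. \<Union>(P ` X))"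
  define I where "I = {..<M}"
  define R where "R = V - U I"
  have I: "finite I" "I \<noteq> {}" "card I = M" using M by (auto simp: I_def)
  have PI: "\<And>i. i \<in> I \<Longrightarrow> P i \<subseteq> V" "\<And>i. i \<in> I \<Longrightarrow> card (P i) = s" "disjoint_family_on P I"
    using P(1-3) by (auto simp: I_def)
  have finE: "finite E" by (rule finite_subset[OF E]) (rule finite_imp_finite_nsets[OF V(1)])
  have UV: "U I \<subseteq> V" using PI(1) by (auto simp: U_def)
  have fU: "finite (U I)" by (rule finite_subset[OF UV V(1)])
  have fP: "finite (P i)" if "i \<in> I" for i using PI(1)[OF that] V(1) by (rule finite_subset)
  have cU: "card (U I) = s * M"
  proof -
    have "card (U I) = (\<Sum>i\<in>I. card (P i))"
      unfolding U_def using I(1) fP PI(3) by (intro card_UN_disjoint) (auto simp: disjoint_family_on_def)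
    then show ?thesis using PI(2) I(3) by simp
  qed
  have d0: "d > 0" using nu by (simp add: d_def)
  have eta: "0 < \<eta>" "\<eta> \<le> 1 / 8"
  proof -
    have "\<nu>\<^sup>2 \<le> 1\<^sup>2" using nu by (intro power_mono) auto
    then show "0 < \<eta>" "\<eta> \<le> 1 / 8" using nu by (auto simp: \<eta>_def)
  qed
  have "real (s * card I) \<le> k / 2" using s(2) I(3) by simp
  note core = dense_link_core[OF V nu(1,3) deg I(1,2) PI s(1) this]
  obtain Q where Q: "Q \<subseteq> I" "Q \<noteq> {}" "d\<^sup>2 * card I \<le> card Q" and cut0: "\<forall>X Y. X \<subseteq> Q \<longrightarrow> Y \<subseteq> Q \<longrightarrow> X \<inter> Y = {} \<longrightarrow>
    card Q \<le> 16 * card X \<longrightarrow> card Q \<le> 16 * card Y \<longrightarrow> card (Q - X - Y) \<le> \<eta> * card Q \<longrightarrow>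
    \<eta> * s\<^sup>2 * n * (card Q)\<^sup>2 \<le> (\<Sum>v\<in>V - \<Union>(P ` I). card {x\<in>\<Union>(P ` X). {x, v} \<in> E} * card {y\<in>\<Union>(P ` Y). {y, v} \<in> E})"
    using core unfolding d_def \<eta>_def by blast
  have cut: "\<eta> * s\<^sup>2 * n * (card Q)\<^sup>2 \<le> (\<Sum>v\<in>R. card {x\<in>U X. {x, v} \<in> E} * card {y\<in>U Y. {y, v} \<in> E})"
    if "X \<subseteq> Q" "Y \<subseteq> Q" "X \<inter> Y = {}" "card Q \<le> 16 * card X" "card Q \<le> 16 * card Y"
      "card (Q - X - Y) \<le> \<eta> * card Q" for X Y
    using cut0 that unfolding R_def U_def by meson
  have fQ: "finite Q" by (rule finite_subset[OF Q(1) I(1)])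
  define N where "N = card Q"
  have N: "d\<^sup>2 * M \<le> N" using Q(3) I(3) by (simp add: N_def)
  define good where "good = (\<lambda>X Y. X \<inter> Y = {} \<and> card Q \<le> 16 * card X \<and> card Q \<le> 16 * card Y \<and>
    card (Q - X - Y) \<le> \<eta> * card Q)"
  let ?lnk = "\<lambda>g z v. {z, v} \<in> E \<and> g {z, v}"
  let ?bad = "\<lambda>g. \<exists>X Y. X \<subseteq> Q \<and> Y \<subseteq> Q \<and> good X Y \<and> \<not> (\<exists>i\<in>X. \<exists>j\<in>Y. linked (?lnk g) R P I i j)"
  have "measure_pmf.prob (bernoulli_edges E p) {g. ?bad g} \<le> 4 ^ card Q * exp (- (3 * real N))"
  proof (rule prob_some_cut_unlinked_le[OF finE])
    show "finite R" using V by (simp add: R_def)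
    show "finite (\<Union>(P ` I))" using fU by (simp add: U_def)
    show "real (card (\<Union>(P ` I))) * p \<le> 1 / 2" using p(3) cU by (simp add: U_def)
    show "R \<inter> \<Union>(P ` I) = {}" by (auto simp: R_def U_def)
    fix X Y assume XY: "X \<subseteq> Q" "Y \<subseteq> Q" "good X Y"
    let ?S = "\<Sum>v\<in>R. card {x\<in>U X. {x, v} \<in> E} * card {y\<in>U Y. {y, v} \<in> E}"
    have S: "\<eta> * s\<^sup>2 * n * N\<^sup>2 \<le> ?S" using cut[OF XY(1,2)] XY(3) by (simp add: good_def N_def)
    have "6 \<le> p\<^sup>2 * \<eta> * s\<^sup>2 * n * (d\<^sup>2 * M)" by (rule p(4))
    also have "\<dots> \<le> p\<^sup>2 * \<eta> * s\<^sup>2 * n * N" using N eta by (intro mult_left_mono) auto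
    finally have "6 * real N \<le> p\<^sup>2 * \<eta> * s\<^sup>2 * n * N * N" by (intro mult_right_mono) auto
    then have "3 * real N \<le> p\<^sup>2 / 2 * (\<eta> * s\<^sup>2 * n * N\<^sup>2)" by (simp add: power2_eq_square algebra_simps)
    also have "\<dots> \<le> p\<^sup>2 / 2 * ?S" using S by (rule mult_left_mono) simp
    finally show "X \<inter> Y = {} \<and> 3 * real N \<le> p\<^sup>2 / 2 *
       (\<Sum>v\<in>R. card {x \<in> \<Union>(P ` X). {x, v} \<in> E} * card {y \<in> \<Union>(P ` Y). {y, v} \<in> E})"
      using XY(3) by (simp add: good_def U_def)
  qed (use PI(3) p Q(1) fQ in auto)
  also have "4 ^ card Q * exp (- (3 * real N)) \<le> exp (- (d\<^sup>2 * M))"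
  proof -
    have "(2 :: real) \<le> exp 1" using exp_ge_add_one_self[of "1 :: real"] by simp
    then have "(2 :: real) * 2 \<le> exp 1 * exp 1" by (intro mult_mono) auto
    then have "(4 :: real) \<le> exp 2" by (simp flip: exp_add)
    then have "(4 :: real) ^ N \<le> exp 2 ^ N" by (intro power_mono) auto
    then have "4 ^ card Q * exp (- (3 * real N)) \<le> exp (2 * real N) * exp (- (3 * real N))"
      by (intro mult_right_mono) (auto simp: N_def exp_of_nat2_mult)
    also have "\<dots> = exp (- real N)" by (simp flip: exp_add)
    also have "\<dots> \<le> exp (- (d\<^sup>2 * M))" using N by simp
    finally show ?thesis .
  qed
  finally have bad: "measure_pmf.prob (bernoulli_edges E p) {g. ?bad g} \<le> exp (- (d\<^sup>2 * M))" .
  have "t \<le> hadwiger_number (Graph V {e \<in> E. f e \<or> g e})" if g: "\<not> ?bad g" for g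
  proof (rule hadwiger_ge_of_linked_cuts[where lnk = "?lnk g" and R = R and P = P and I = I and Q = Q
        and \<eta> = \<eta> and \<Delta> = \<Delta>])
    show "conn (\<lambda>x y. {x, y} \<in> edges (Graph V {e \<in> E. f e \<or> g e})) (P i)" if "i \<in> I" for i
      using P(4)[of i] that by (auto simp: I_def elim!: conn_mono)
    show "P i \<inter> R = {}" if "i \<in> I" for i using that by (auto simp: R_def U_def)
    show "real (4 * card R) \<le> \<eta> * card Q * \<Delta>"
    proof -
      have "card R \<le> n" using V by (auto simp: R_def intro: card_mono)
      then have "real (4 * card R) \<le> 4 * n" by simp
      also have "\<dots> \<le> \<eta> * (d\<^sup>2 * M) * \<Delta>" by (rule Delta(2))
      also have "\<dots> \<le> \<eta> * card Q * \<Delta>" using N eta by (intro mult_right_mono mult_left_mono) (auto simp: N_def)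
      finally show ?thesis .
    qed
    show "t * minor_const (\<eta> / 2) \<Delta> \<le> sqrt (card Q / 2)"
    proof -
      have "sqrt (d\<^sup>2 * M / 2) \<le> sqrt (card Q / 2)" using N by (simp add: N_def)
      then show ?thesis using t by linarith
    qed
    show "\<exists>i\<in>X. \<exists>j\<in>Y. linked (?lnk g) R P I i j"
      if "X \<subseteq> Q" "Y \<subseteq> Q" "X \<inter> Y = {}" "card Q \<le> 16 * card X" "card Q \<le> 16 * card Y"
        "real (card (Q - X - Y)) \<le> \<eta> * card Q" for X Y
    proof -
      have "good X Y" using that by (simp add: good_def)
      then show ?thesis using g that(1,2) by blast
    qed
  qed (use V PI I Q eta Delta in \<open>auto simp: R_def\<close>)
  then have "{g. \<not> t \<le> hadwiger_number (Graph V {e \<in> E. f e \<or> g e})} \<subseteq> {g. ?bad g}" by blast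
  then have "measure_pmf.prob (bernoulli_edges E p) {g. \<not> t \<le> hadwiger_number (Graph V {e \<in> E. f e \<or> g e})}
    \<le> measure_pmf.prob (bernoulli_edges E p) {g. ?bad g}"
    by (intro measure_pmf.finite_measure_mono) auto
  then show ?thesis using bad by linarith
qed

lemma degree_eq_card_neighbours:
  assumes "simple_graph G" "v \<in> verts G"
  shows "degree G v = card {w\<in>verts G. {v, w} \<in> edges G}"
proof -
  have "bij_betw (\<lambda>w. {v, w}) {w\<in>verts G. {v, w} \<in> edges G} {e \<in> edges G. v \<in> e}"
    unfolding bij_betw_def
  proof
    show "inj_on (\<lambda>w. {v, w}) {w\<in>verts G. {v, w} \<in> edges G}" by (auto simp: inj_on_def doubleton_eq_iff)
    show "(\<lambda>w. {v, w}) ` {w\<in>verts G. {v, w} \<in> edges G} = {e \<in> edges G. v \<in> e}"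
    proof (intro equalityI subsetI)
      fix e assume e: "e \<in> {e \<in> edges G. v \<in> e}"
      then have "e \<in> nsets (verts G) 2" using assms(1) by (auto simp: simple_graph_def)
      then obtain x y where xy: "e = {x, y}" "e \<subseteq> verts G" by (auto simp: nsets_def card_2_iff)
      then obtain w where "e = {v, w}" using e by auto
      then show "e \<in> (\<lambda>w. {v, w}) ` {w\<in>verts G. {v, w} \<in> edges G}" using e xy by auto
    qed auto
  qed
  from bij_betw_same_card[OF this] show ?thesis by (simp add: degree_def)
qed

lemma exp_minus_le_inverse:
  assumes "x > 0"
  shows "exp (- x) \<le> 1 / (x :: real)"
proof -
  have "x \<le> exp x" using exp_ge_add_one_self[of x] by linarith
  then show ?thesis using assms by (simp add: exp_minus field_simps)
qed

theorem theorem1p3: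
  fixes \<nu> \<epsilon> :: real
  assumes "\<nu> > 0" and "\<epsilon> > 0"
  shows "\<exists>c::real. c > 0 \<and> (\<forall>\<eta>::real. \<eta> > 0 \<longrightarrow>
    (\<forall>\<^sub>F k::real in at_top. \<forall>(G :: 'a graph) (n :: nat).
       simple_graph G \<longrightarrow> card (verts G) = n \<longrightarrow>
       real (min_degree G) \<ge> k \<longrightarrow> k \<ge> \<nu> * real n \<longrightarrow>
       measure_pmf.prob (random_subgraph G ((1 + \<epsilon>) / k))
         {H. real (hadwiger_number H) \<ge> c * sqrt k} \<ge> 1 - \<eta>))"
proof -
  \<comment> \<open>Lowering \<open>\<nu>\<close> only weakens \<open>\<nu> * n \<le> k\<close>; the
    bound \<open>\<nu>' \<le> 1\<close> keeps the separator proportion \<open>h\<close> below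
    \<open>1 / 8\<close>.\<close>
  define \<nu>' where "\<nu>' = min \<nu> 1"
  \<comment> \<open>Since \<open>2 * e \<le> \<epsilon>\<close>, a second round with probability
    \<open>e / k\<close> leaves at least \<open>(1 + e) / k\<close> for the first.\<close>
  define e where "e = min \<epsilon> 1 / 2"
  define d where "d = \<nu>'\<^sup>2 / 4"
  define h where "h = \<nu>'\<^sup>2 / 4 / 256"
  \<comment> \<open>The pieces cover at least \<open>\<alpha> * k\<close> vertices:
    \<open>e / 8 * m\<close> with \<open>m \<ge> e / 16 * k\<close>, of which half may be lost by
    rounding to a multiple of \<open>s\<close>.\<close>
  define \<alpha> where "\<alpha> = e\<^sup>2 / 256"
  have nu': "0 < \<nu>'" "\<nu>' \<le> 1" "\<nu>' \<le> \<nu>" using assms by (auto simp: \<nu>'_def)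
  have e: "0 < e" "e \<le> 1 / 2" "2 * e \<le> \<epsilon>" using assms by (auto simp: e_def)
  have pos: "d > 0" "h > 0" "\<alpha> > 0" using nu' e by (auto simp: d_def h_def \<alpha>_def)
  define s where "s = nat \<lceil>6 / (e\<^sup>2 * h * d\<^sup>2 * \<alpha>)\<rceil> + 1"
  have s: "s > 0" "6 / (e\<^sup>2 * h * d\<^sup>2 * \<alpha>) \<le> s" unfolding s_def by (simp, linarith)
  \<comment> \<open>At most \<open>n\<close> vertices create links between about
    \<open>\<alpha> * k / s\<close> pieces, so the degree bound has to be of order
    \<open>s\<close>.\<close>
  define \<Delta> where "\<Delta> = nat \<lceil>4 * s / (h * d\<^sup>2 * \<alpha> * \<nu>')\<rceil> + 1"
  have Delta: "\<Delta> > 0" "4 * s / (h * d\<^sup>2 * \<alpha> * \<nu>') \<le> \<Delta>" unfolding \<Delta>_def by (simp, linarith)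
  define mc where "mc = minor_const (h / 2) \<Delta>"
  have mc: "mc > 0" unfolding mc_def using pos by (intro minor_const_pos) simp
  define c1 where "c1 = sqrt (d\<^sup>2 * \<alpha> / (2 * s)) / mc"
  have c1: "c1 > 0" using pos s mc by (simp add: c1_def)
  define a where "a = e ^ 3 / 2048"
  define b where "b = d\<^sup>2 * \<alpha> / s"
  have ab: "a > 0" "b > 0" using e pos s by (auto simp: a_def b_def)
  \<comment> \<open>None of the thresholds on \<open>k\<close> depends on \<open>G\<close>. The
    first two bound the edge probabilities, the next three make each rounding of \<open>m\<close>,
    \<open>M\<close> and \<open>t\<close> cost at most half, and the last two bring each failure
    probability below \<open>\<eta> / 2\<close>.\<close>
  have main: "measure_pmf.prob (random_subgraph G ((1 + \<epsilon>) / k)) {H. real (hadwiger_number H) \<ge> c1 / 2 * sqrt k} \<ge> 1 - \<eta>"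
    if \<eta>: "\<eta> > 0" and k: "k \<ge> 2" "k \<ge> 1 + \<epsilon>" "k \<ge> 16 / e" "k \<ge> 256 * s / e\<^sup>2" "k \<ge> (2 / c1)\<^sup>2"
        "k \<ge> 2 / (a * \<eta>)" "k \<ge> 2 / (b * \<eta>)"
      and G: "simple_graph G" "card (verts G) = n" "real (min_degree G) \<ge> k" "k \<ge> \<nu> * real n"
    for \<eta> k :: real and G :: "'a graph" and n :: nat
  proof -
    define V where "V = verts G"
    define E where "E = edges G"
    have V: "finite V" "card V = n" "V \<noteq> {}" and E: "E \<subseteq> nsets V 2"
      using G by (auto simp: V_def E_def simple_graph_def)
    have n0: "n > 0" using V by (metis card_gt_0_iff)
    have finE: "finite E" by (rule finite_subset[OF E]) (rule finite_imp_finite_nsets[OF V(1)])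
    have deg: "k \<le> card {w\<in>V. {v, w} \<in> E}" if "v \<in> V" for v
    proof -
      have "min_degree G \<le> degree G v" unfolding min_degree_def using V that by (auto simp: V_def)
      then show ?thesis using G(3) degree_eq_card_neighbours[OF G(1)] that by (auto simp: V_def E_def)
    qed
    have kn: "k \<le> n"
    proof -
      obtain v where v: "v \<in> V" using V by blast
      have "card {w\<in>V. {v, w} \<in> E} \<le> card V" using V by (intro card_mono) auto
      then show ?thesis using deg[OF v] V by linarith
    qed
    have k0: "k > 0" using k by simp
    define m where "m = nat \<lfloor>e / 8 * k\<rfloor>"
    have ek: "e * k \<ge> 16" using k(3) e by (simp add: field_simps)
    have m: "real m \<le> e / 8 * k" "real m \<ge> e / 16 * k"
      using ek unfolding m_def by linarith+
    define M where "M = nat \<lfloor>e / 8 * m / s\<rfloor>"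
    have Ms: "real (M * s) \<le> e / 8 * m"
    proof -
      have "0 \<le> e / 8 * m / s" using e by simp
      then have "real M \<le> e / 8 * m / s" unfolding M_def by linarith
      then show ?thesis using s by (simp add: pos_le_divide_eq)
    qed
    have Ms': "\<alpha> * k \<le> real (M * s)"
    proof -
      have "e / 8 * m / s - 1 \<le> M" unfolding M_def by linarith
      then have "(e / 8 * m / s - 1) * s \<le> real M * real s" using s by (intro mult_right_mono) auto
      then have "e / 8 * m - s \<le> real (M * s)" using s by (simp add: left_diff_distrib)
      moreover have "e / 8 * (e / 16 * k) \<le> e / 8 * m" using m e by (intro mult_left_mono) auto
      moreover have "s \<le> e\<^sup>2 / 256 * k" using k(4) e by (simp add: field_simps)
      moreover have "e / 8 * (e / 16 * k) = 2 * (e\<^sup>2 / 256 * k)" by (simp add: power2_eq_square)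
      ultimately show ?thesis unfolding \<alpha>_def by linarith
    qed
    have M0: "M > 0" using Ms' pos k0 by (cases M) (auto simp: mult_le_0_iff)
    have Mk: "d\<^sup>2 * M \<ge> b * k"
    proof -
      have "\<alpha> * k / s \<le> M" using Ms' s by (simp add: pos_divide_le_eq)
      then have "d\<^sup>2 * (\<alpha> * k / s) \<le> d\<^sup>2 * M" by (intro mult_left_mono) auto
      then show ?thesis by (simp add: b_def)
    qed
    define p where "p = (1 + \<epsilon>) / k"
    define p2 where "p2 = e / k"
    define p1 where "p1 = (p - p2) / (1 - p2)"
    have p2: "0 < p2" "p2 \<le> 1 / 2" using e k k0 by (auto simp: p2_def field_simps)
    have p: "p \<le> 1" using k k0 by (simp add: p_def)
    have pp: "(1 + e) / k \<le> p - p2" using e k0 by (simp add: p_def p2_def field_simps)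
    then have pp0: "0 \<le> p - p2" using e k0 by (meson add_nonneg_nonneg divide_nonneg_pos less_imp_le order_trans zero_le_one)
    have p1: "(1 + e) / k \<le> p1" "p1 \<le> 1" "0 \<le> p1"
    proof -
      have "(p - p2) * (1 - p2) \<le> (p - p2) * 1" using pp0 p2 by (intro mult_left_mono) auto
      then have "p - p2 \<le> p1" using p2 by (simp add: p1_def pos_le_divide_eq)
      then show "(1 + e) / k \<le> p1" "0 \<le> p1" using pp pp0 by auto
      show "p1 \<le> 1" using p p2 by (simp add: p1_def)
    qed
    have split: "1 - p = (1 - p1) * (1 - p2)" using p2 by (simp add: p1_def field_simps)
    define t where "t = nat \<lfloor>c1 * sqrt k\<rfloor>"
    have t1: "real t \<le> c1 * sqrt k" unfolding t_def using c1 k0 by (simp add: of_nat_nat)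
    have t2: "c1 / 2 * sqrt k \<le> t"
    proof -
      have "2 / c1 \<le> sqrt k" using k(5) c1 by (intro real_le_rsqrt) auto
      then have "2 \<le> c1 * sqrt k" using c1 by (simp add: field_simps)
      then show ?thesis unfolding t_def by linarith
    qed
    have fail: "measure_pmf.prob (bernoulli_edges E p) {X. \<not> t \<le> hadwiger_number (Graph V {e \<in> E. X e})}
      \<le> exp (- (e\<^sup>2 / 128 * m)) + exp (- (d\<^sup>2 * M))"
    proof (rule prob_two_rounds_le[OF finE p1(3,2) _ _ split,
          where good = "\<lambda>f. has_path V (M * s) ({e. f e} \<inter> E)"])
      have "real m < card V" using m(1) kn e k0 V ek
        by (smt (verit, best) mult_le_cancel_right2 divide_less_eq_1 mult_less_cancel_right2)
      then show "measure_pmf.prob (bernoulli_edges E p1) {f. \<not> has_path V (M * s) ({e. f e} \<inter> E)} \<le> exp (- (e\<^sup>2 / 128 * m))"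
        using e k(1) m Ms M0 s p1 by (intro path_failure_prob[OF V(1) E deg]) auto
      fix f assume "has_path V (M * s) ({e. f e} \<inter> E)"
      then obtain P where P: "\<And>i. i < M \<Longrightarrow> P i \<subseteq> V" "\<And>i. i < M \<Longrightarrow> card (P i) = s"
        "disjoint_family_on P {..<M}" "\<And>i. i < M \<Longrightarrow> conn (\<lambda>x y. {x, y} \<in> {e. f e} \<inter> E) (P i)"
        using has_path_pieces[OF _ s(1)] by metis
      have sM: "real (s * M) \<le> e / 8 * (e / 8 * k)"
      proof -
        have "e / 8 * m \<le> e / 8 * (e / 8 * k)" using m(1) e by (intro mult_left_mono) auto
        then show ?thesis using Ms by (simp add: mult.commute)
      qed
      have e8: "e / 8 * (e / 8 * k) \<le> 1 / 64 * k"
      proof -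
        have "e / 8 * (e / 8) \<le> 1 / 8 * (1 / 8)" using e by (intro mult_mono) auto
        then have "(e / 8 * (e / 8)) * k \<le> (1 / 8 * (1 / 8)) * k" using k0 by (intro mult_right_mono) auto
        then show ?thesis by simp
      qed
      have "measure_pmf.prob (bernoulli_edges E p2) {g. \<not> t \<le> hadwiger_number (Graph V {e \<in> E. f e \<or> g e})}
        \<le> exp (- ((\<nu>'\<^sup>2 / 4)\<^sup>2 * M))"
      proof (rule hadwiger_failure_prob_pieces[OF V(1,2) n0 E nu'(1,2) _ deg M0 P s(1)])
        have "\<nu>' * n \<le> \<nu> * n" using nu' by (intro mult_right_mono) auto
        then show "\<nu>' * n \<le> k" using G(4) by linarith
        show "real (s * M) \<le> k / 2" using sM e8 k0 by linarith
        have "real (s * M) * p2 \<le> (1 / 64 * k) * p2" using sM e8 p2 by (intro mult_right_mono) auto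
        also have "\<dots> = e / 64" using k0 by (simp add: p2_def)
        finally show "real (s * M) * p2 \<le> 1 / 2" using e by linarith
        show "6 \<le> p2\<^sup>2 * (\<nu>'\<^sup>2 / 4 / 256) * s\<^sup>2 * n * ((\<nu>'\<^sup>2 / 4)\<^sup>2 * M)"
        proof -
          \<comment> \<open>Of the two factors \<open>s\<close> one is absorbed by
            \<open>M * s \<ge> \<alpha> * k\<close>; the other survives, and the powers of
            \<open>k\<close> cancel, so a large constant \<open>s\<close> suffices.\<close>
          have "6 \<le> e\<^sup>2 * h * d\<^sup>2 * \<alpha> * s" using s(2) pos e by (simp add: pos_divide_le_eq algebra_simps)
          also have "\<dots> = (e / k)\<^sup>2 * h * s * k * d\<^sup>2 * (\<alpha> * k)" using k0 by (simp add: power2_eq_square field_simps)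
          also have "\<dots> \<le> (e / k)\<^sup>2 * h * s * n * d\<^sup>2 * (M * s)"
            using pos e k0 kn Ms' by (intro mult_mono mult_left_mono mult_right_mono mult_nonneg_nonneg) auto
          also have "\<dots> = p2\<^sup>2 * h * s\<^sup>2 * n * (d\<^sup>2 * M)" by (simp add: p2_def power2_eq_square algebra_simps)
          finally show ?thesis by (simp only: h_def d_def)
        qed
        show "\<Delta> > 0" by (rule Delta(1))
        show "real (4 * n) \<le> \<nu>'\<^sup>2 / 4 / 256 * ((\<nu>'\<^sup>2 / 4)\<^sup>2 * M) * \<Delta>"
        proof -
          have "4 * s \<le> h * d\<^sup>2 * \<alpha> * \<nu>' * \<Delta>" using Delta(2) pos nu' by (simp add: pos_divide_le_eq algebra_simps)
          then have "4 * s * real n \<le> h * d\<^sup>2 * \<alpha> * \<nu>' * \<Delta> * n" by (intro mult_right_mono) auto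
          also have "\<dots> = h * d\<^sup>2 * \<Delta> * (\<alpha> * (\<nu>' * n))" by simp
          also have "\<dots> \<le> h * d\<^sup>2 * \<Delta> * (M * s)"
          proof (rule mult_left_mono)
            have "\<alpha> * (\<nu>' * n) \<le> \<alpha> * k" using \<open>\<nu>' * n \<le> k\<close> pos by (intro mult_left_mono) auto
            then show "\<alpha> * (\<nu>' * n) \<le> M * s" using Ms' by linarith
          qed (use pos in auto)
          finally have "real (4 * n) * s \<le> h * (d\<^sup>2 * M) * \<Delta> * s" by (simp add: algebra_simps)
          then have "real (4 * n) \<le> h * (d\<^sup>2 * M) * \<Delta>" using s(1) by (simp only: mult_le_cancel_right_pos of_nat_0_less_iff)
          then show ?thesis by (simp only: h_def d_def)
        qed
        show "t * minor_const (\<nu>'\<^sup>2 / 4 / 256 / 2) \<Delta> \<le> sqrt ((\<nu>'\<^sup>2 / 4)\<^sup>2 * M / 2)"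
        proof -
          have "t * mc \<le> c1 * sqrt k * mc" using t1 mc by (intro mult_right_mono) auto
          also have "\<dots> = sqrt (d\<^sup>2 * \<alpha> / (2 * s)) * sqrt k" using mc by (simp add: c1_def)
          also have "\<dots> = sqrt (b * k / 2)" by (simp add: b_def real_sqrt_mult[symmetric] field_simps)
          also have "\<dots> \<le> sqrt (d\<^sup>2 * M / 2)" using Mk by simp
          finally show ?thesis by (simp only: mc_def h_def d_def)
        qed
      qed (use p2 in auto)
      moreover have "{e' \<in> E. e' \<in> E \<and> (f e' \<or> g e')} = {e' \<in> E. f e' \<or> g e'}" for g by auto
      ultimately show "measure_pmf.prob (bernoulli_edges E p2)
          {g. \<not> t \<le> hadwiger_number (Graph V {e' \<in> E. e' \<in> E \<and> (f e' \<or> g e')})} \<le> exp (- (d\<^sup>2 * M))"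
        by (simp only: d_def)
    qed (use p2 in auto)
    have small: "exp (- (e\<^sup>2 / 128 * m)) \<le> \<eta> / 2" "exp (- (d\<^sup>2 * M)) \<le> \<eta> / 2"
    proof -
      have tail: "exp (- y) \<le> \<eta> / 2" if "z * k \<le> y" "z > 0" "k \<ge> 2 / (z * \<eta>)" for y z
      proof -
        have "exp (- y) \<le> exp (- (z * k))" using that by simp
        also have "\<dots> \<le> 1 / (z * k)" using that k0 by (intro exp_minus_le_inverse) simp
        also have "\<dots> \<le> \<eta> / 2" using that k0 \<eta> by (simp add: field_simps)
        finally show ?thesis .
      qed
      have "a * k = e\<^sup>2 / 128 * (e / 16 * k)" by (simp add: a_def power2_eq_square power3_eq_cube)
      also have "\<dots> \<le> e\<^sup>2 / 128 * m" using m(2) by (intro mult_left_mono) auto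
      finally show "exp (- (e\<^sup>2 / 128 * m)) \<le> \<eta> / 2" by (rule tail[OF _ ab(1) k(6)])
      show "exp (- (d\<^sup>2 * M)) \<le> \<eta> / 2" by (rule tail[OF Mk ab(2) k(7)])
    qed
    let ?B = "{X. \<not> t \<le> hadwiger_number (Graph V {e \<in> E. X e})}"
    have "1 - \<eta> \<le> 1 - measure_pmf.prob (bernoulli_edges E p) ?B" using fail small by linarith
    also have "\<dots> = measure_pmf.prob (bernoulli_edges E p) (UNIV - ?B)"
      using measure_pmf.prob_compl[of ?B "bernoulli_edges E p"] by simp
    also have "\<dots> \<le> measure_pmf.prob (bernoulli_edges E p) {X. c1 / 2 * sqrt k \<le> hadwiger_number (Graph V {e \<in> E. X e})}"
      using t2 by (intro measure_pmf.finite_measure_mono) auto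
    also have "\<dots> = measure_pmf.prob (random_subgraph G ((1 + \<epsilon>) / k)) {H. real (hadwiger_number H) \<ge> c1 / 2 * sqrt k}"
      by (simp add: random_subgraph_def V_def E_def p_def vimage_def)
    finally show ?thesis .
  qed
  show ?thesis
  proof (intro exI[of _ "c1 / 2"] conjI allI impI)
    show "c1 / 2 > 0" using c1 by simp
    fix \<eta> :: real assume \<eta>: "\<eta> > 0"
    have "\<forall>\<^sub>F k in at_top. k \<ge> 2 \<and> k \<ge> 1 + \<epsilon> \<and> k \<ge> 16 / e \<and> k \<ge> 256 * s / e\<^sup>2 \<and> k \<ge> (2 / c1)\<^sup>2 \<and>
        k \<ge> 2 / (a * \<eta>) \<and> k \<ge> 2 / (b * \<eta>)"
      by (intro eventually_conj eventually_ge_at_top)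
    then show "\<forall>\<^sub>F k::real in at_top. \<forall>(G :: 'a graph) (n :: nat).
       simple_graph G \<longrightarrow> card (verts G) = n \<longrightarrow>
       real (min_degree G) \<ge> k \<longrightarrow> k \<ge> \<nu> * real n \<longrightarrow>
       measure_pmf.prob (random_subgraph G ((1 + \<epsilon>) / k))
         {H. real (hadwiger_number H) \<ge> c1 / 2 * sqrt k} \<ge> 1 - \<eta>"
      by eventually_elim (use main[OF \<eta>] in blast)
  qed
qed

end
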